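(* Let $G$ be a group, let $\mathbb{F}$ be an infinite field, let $n\ge 1$, let $\Gamma$ be a $G$-grading on the algebra $\mathrm{UT}_n$ of $n\times n$ upper triangular matrices over $\mathbb{F}$, and let $\ast$ be a graded-involution on $(\mathrm{UT}_n,\Gamma)$. Then, as $m\to\infty$, $$c_m(\mathrm{UT}_n,\Gamma,\ast)\sim\frac{2^{\lfloor\frac{n-1}{2}\rfloor}}{n^{n-1}}\,m^{n-1}n^m.$$
   Context: All algebras are over the field $\mathbb{F}$; $\mathrm{UT}_n$ is the associative algebra of $n\times n$ upper triangular matrices over $\mathbb{F}$. $G$ is an arbitrary group, written multiplicatively. A $G$-grading $\Gamma$ on an algebra $\mathcal{A}$ is a vector space decomposition $\mathcal{A}=\bigoplus_{g\in G}\mathcal{A}_g$ with $\mathcal{A}_g\mathcal{A}_h\subseteq\mathcal{A}_{gh}$ for all $g,h\in G$. An involution on $\mathcal{A}$ is an $\mathbb{F}$-linear map $\ast:\mathcal{A}\to\mathcal{A}$ with $(ab)^\ast=b^\ast a^\ast$ and $(a^\ast)^\ast=a$. It is a graded-involution on $(\mathcal{A},\Gamma)$ if $\mathcal{A}_g^\ast\subseteq\mathcal{A}_g$ for all $g\in G$. For each $g\in G$ take variables $x_1^{(g)},x_2^{(g)},\ldots$ of degree $g$. In the free $G$-graded associative algebra with involution $\ast$ on these variables (that is, the free associative algebra in the symbols $x_i^{(g)}$ and $(x_i^{(g)})^\ast$, with $\ast$ extended as an involution), let $$P^{(\ast)}_m=\mathrm{Span}\left\{\left(x_{\sigma(1)}^{(g_1)}\right)^{\delta_1}\cdots\left(x_{\sigma(m)}^{(g_m)}\right)^{\delta_m}\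 \middle|\ \sigma\in\mathcal{S}_m,\ g_1,\ldots,g_m\in G,\ \delta_\ell\in\{\emptyset,\ast\}\right\},$$ where $\mathcal{S}_m$ is the symmetric group on $m$ elements, $x^{\emptyset}=x$ and $x^{\ast}$ is the image of $x$ under $\ast$. Let $\mathrm{Id}(\mathcal{A},\Gamma,\ast)$ be the set of graded polynomial identities with involution of $(\mathcal{A},\Gamma,\ast)$, i.e. the elements of this free algebra that vanish under every substitution of each $x_i^{(g)}$ by an element $a_i^{(g)}$ of $\mathcal{A}_g$ and of $(x_i^{(g)})^\ast$ by $(a_i^{(g)})^\ast$. The graded-star-codimension sequence is $$c_m(\mathcal{A},\Gamma,\ast)=\dim P_m^{(\ast)}/\bigl(P_m^{(\ast)}\cap\mathrm{Id}(\mathcal{A},\Gamma,\ast)\bigr).$$ For $f,g:\mathbb{N}\to\mathbb{N}$ (or real-valued), $f\sim g$ means $\lim_{m\to\infty}f(m)/g(m)=1$. *)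

theory Defs
  imports
    "Jordan_Normal_Form.VS_Connect"
    "HOL-Algebra.AbelCoset"
    "HOL-Library.Poly_Mapping"
    "HOL-Library.Landau_Symbols"
    "HOL-Combinatorics.Permutations"
begin

text \<open>
  An algebra over a field \<open>K\<close> is represented by a \<open>module\<close> record, which carries a
  multiplication and a unit besides the vector space structure. (The HOL-Algebra locale
  \<open>algebra\<close> is not used, since it demands commutativity.) A field given as a type \<open>'f\<close> is
  turned into a record by \<^term>\<open>class_ring\<close>.
\<close>

section \<open>Upper triangular matrices\<close>

definition ut_algebra :: "nat \<Rightarrow> ('f :: field, 'f mat) module" where
  "ut_algebra n =
    \<lparr>carrier = {A \<in> carrier_mat n n. upper_triangular A},
     mult = (*), one = 1\<^sub>m n, zero = 0\<^sub>m n n, add = (+), smult = (\<cdot>\<^sub>m)\<rparr>"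


section \<open>Gradings and graded involutions\<close>

text \<open>
  The second conjunct says that \<open>A\<close> is the direct sum of the family \<open>\<Gamma> g\<close>, \<open>g \<in> G\<close>: every
  element is, in exactly one way, a sum of a finitely supported family of homogeneous
  components.
\<close>

definition grading ::
  "('g, 'r) monoid_scheme \<Rightarrow> ('k, 's) ring_scheme \<Rightarrow> ('k, 'a, 't) module_scheme \<Rightarrow>
     ('g \<Rightarrow> 'a set) \<Rightarrow> bool" where
  "grading G K A \<Gamma> \<longleftrightarrow>
    (\<forall>g \<in> carrier G. VectorSpace.subspace K (\<Gamma> g) A) \<and>
    (\<forall>v \<in> carrier A. \<exists>!c. c \<in> (\<Pi>\<^sub>E g \<in> carrier G. \<Gamma> g) \<and>
        finite {g \<in> carrier G. c g \<noteq> \<zero>\<^bsub>A\<^esub>} \<and>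
        v = (\<Oplus>\<^bsub>A\<^esub> g \<in> {g \<in> carrier G. c g \<noteq> \<zero>\<^bsub>A\<^esub>}. c g)) \<and>
    (\<forall>g \<in> carrier G. \<forall>h \<in> carrier G. \<forall>a \<in> \<Gamma> g. \<forall>b \<in> \<Gamma> h.
        a \<otimes>\<^bsub>A\<^esub> b \<in> \<Gamma> (g \<otimes>\<^bsub>G\<^esub> h))"

definition involution ::
  "('k, 's) ring_scheme \<Rightarrow> ('k, 'a, 't) module_scheme \<Rightarrow> ('a \<Rightarrow> 'a) \<Rightarrow> bool" where
  "involution K A star \<longleftrightarrow>
    star \<in> LinearCombinations.module_hom K A A \<and>
    (\<forall>a \<in> carrier A. \<forall>b \<in> carrier A. star (a \<otimes>\<^bsub>A\<^esub> b) = star b \<otimes>\<^bsub>A\<^esub> star a) \<and>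
    (\<forall>a \<in> carrier A. star (star a) = a)"

definition graded_involution ::
  "('g, 'r) monoid_scheme \<Rightarrow> ('k, 's) ring_scheme \<Rightarrow> ('k, 'a, 't) module_scheme \<Rightarrow>
     ('g \<Rightarrow> 'a set) \<Rightarrow> ('a \<Rightarrow> 'a) \<Rightarrow> bool" where
  "graded_involution G K A \<Gamma> star \<longleftrightarrow>
    involution K A star \<and> (\<forall>g \<in> carrier G. star ` \<Gamma> g \<subseteq> \<Gamma> g)"


section \<open>The free graded algebra with involution\<close>

text \<open>
  Words form a free monoid, written additively so that \<open>'x word \<Rightarrow>\<^sub>0 'f\<close> with the
  convolution product of \<open>Poly_Mapping\<close> is the free (unital) associative algebra over \<open>'x\<close>.
\<close>

datatype 'x word = Word (letters: "'x list")

instantiation word :: (type) monoid_add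
begin

definition zero_word :: "'a word" where
  "0 = Word []"

definition plus_word :: "'a word \<Rightarrow> 'a word \<Rightarrow> 'a word" where
  "u + v = Word (letters u @ letters v)"

instance
  by standard (simp_all add: zero_word_def plus_word_def)

end

text \<open>\<open>Letter i g False\<close> stands for the symbol $x_i^{(g)}$ and \<open>Letter i g True\<close> for
  $(x_i^{(g)})^*$. Indices are counted from 0.\<close>

datatype 'g letter = Letter (idx: nat) (deg: 'g) (starred: bool)

text \<open>The type has letters of every degree in \<open>'g\<close>; the carrier only admits degrees in \<open>G\<close>.\<close>

definition free_algebra ::
  "('g, 'r) monoid_scheme \<Rightarrow> ('f :: field, 'g letter word \<Rightarrow>\<^sub>0 'f) module" where
  "free_algebra G =
    \<lparr>carrier = {p. \<forall>w \<in> Poly_Mapping.keys p. \<forall>x \<in> set (letters w). deg x \<in> carrier G},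
     mult = (*), one = 1, zero = 0, add = (+), smult = (\<lambda>c. Poly_Mapping.map ((*) c))\<rparr>"

definition gen :: "nat \<Rightarrow> 'g \<Rightarrow> 'g letter word \<Rightarrow>\<^sub>0 'f :: field" where
  "gen i g = Poly_Mapping.single (Word [Letter i g False]) 1"

definition letter_star :: "'g letter \<Rightarrow> 'g letter" where
  "letter_star x = Letter (idx x) (deg x) (\<not> starred x)"

definition word_star :: "'g letter word \<Rightarrow> 'g letter word" where
  "word_star w = Word (rev (map letter_star (letters w)))"

definition free_star ::
  "('g letter word \<Rightarrow>\<^sub>0 'f :: field) \<Rightarrow> 'g letter word \<Rightarrow>\<^sub>0 'f" where
  "free_star p =
    (\<Sum>w \<in> Poly_Mapping.keys p. Poly_Mapping.single (word_star w) (Poly_Mapping.lookup p w))"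

text \<open>The value of \<open>p\<close> under $x_i^{(g)} \mapsto a_i^{(g)}$, $(x_i^{(g)})^* \mapsto (a_i^{(g)})^*$.\<close>

definition letter_value :: "('a \<Rightarrow> 'a) \<Rightarrow> (nat \<Rightarrow> 'g \<Rightarrow> 'a) \<Rightarrow> 'g letter \<Rightarrow> 'a" where
  "letter_value star a x =
    (if starred x then star (a (idx x) (deg x)) else a (idx x) (deg x))"

definition word_value ::
  "('a, 't) monoid_scheme \<Rightarrow> ('a \<Rightarrow> 'a) \<Rightarrow> (nat \<Rightarrow> 'g \<Rightarrow> 'a) \<Rightarrow> 'g letter word \<Rightarrow> 'a" where
  "word_value A star a w =
    foldr (\<lambda>x y. letter_value star a x \<otimes>\<^bsub>A\<^esub> y) (letters w) \<one>\<^bsub>A\<^esub>"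

definition free_value ::
  "('f :: field, 'a, 't) module_scheme \<Rightarrow> ('a \<Rightarrow> 'a) \<Rightarrow> (nat \<Rightarrow> 'g \<Rightarrow> 'a) \<Rightarrow>
     ('g letter word \<Rightarrow>\<^sub>0 'f) \<Rightarrow> 'a" where
  "free_value A star a p =
    (\<Oplus>\<^bsub>A\<^esub> w \<in> Poly_Mapping.keys p. Poly_Mapping.lookup p w \<odot>\<^bsub>A\<^esub> word_value A star a w)"


section \<open>Identities and codimensions\<close>

definition star_identities ::
  "('g, 'r) monoid_scheme \<Rightarrow> ('f :: field, 'a, 't) module_scheme \<Rightarrow> ('g \<Rightarrow> 'a set) \<Rightarrow>
     ('a \<Rightarrow> 'a) \<Rightarrow> ('g letter word \<Rightarrow>\<^sub>0 'f) set" where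
  "star_identities G A \<Gamma> star =
    {p \<in> carrier (free_algebra G).
      \<forall>a. (\<forall>i. \<forall>g \<in> carrier G. a i g \<in> \<Gamma> g) \<longrightarrow> free_value A star a p = \<zero>\<^bsub>A\<^esub>}"

text \<open>Position \<open>k\<close> of the monomial holds the variable of index \<open>\<sigma> k\<close> and degree \<open>g k\<close>,
  starred if \<open>\<delta> k\<close>.\<close>

definition multilinear_monomial ::
  "nat \<Rightarrow> (nat \<Rightarrow> nat) \<Rightarrow> (nat \<Rightarrow> 'g) \<Rightarrow> (nat \<Rightarrow> bool) \<Rightarrow>
     ('g letter word \<Rightarrow>\<^sub>0 'f :: field)" where
  "multilinear_monomial m \<sigma> g \<delta> =
    prod_list
      (map (\<lambda>k. if \<delta> k then free_star (gen (\<sigma> k) (g k)) else gen (\<sigma> k) (g k)) [0..<m])"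

definition multilinear_space ::
  "('g, 'r) monoid_scheme \<Rightarrow> nat \<Rightarrow> ('g letter word \<Rightarrow>\<^sub>0 'f :: field) set" where
  "multilinear_space G m =
    LinearCombinations.module.span class_ring (free_algebra G)
      {multilinear_monomial m \<sigma> g \<delta> | \<sigma> g \<delta>.
        \<sigma> permutes {..<m} \<and> (\<forall>k < m. g k \<in> carrier G)}"

text \<open>The quotient vector space \<open>V / W\<close>. The multiplication and unit are dummies, required by the record.\<close>

definition quotient_space ::
  "('k, 'a, 't) module_scheme \<Rightarrow> 'a set \<Rightarrow> ('k, 'a set) module" where
  "quotient_space V W =
    \<lparr>carrier = a_rcosets\<^bsub>V\<^esub> W, mult = (\<lambda>_ _. W), one = W, zero = W, add = set_add V,
     smult = (\<lambda>c X. \<Union>x \<in> X. W +>\<^bsub>V\<^esub> (c \<odot>\<^bsub>V\<^esub> x))\<rparr>"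

definition star_codim ::
  "('g, 'r) monoid_scheme \<Rightarrow> ('f :: field, 'a, 't) module_scheme \<Rightarrow> ('g \<Rightarrow> 'a set) \<Rightarrow>
     ('a \<Rightarrow> 'a) \<Rightarrow> nat \<Rightarrow> nat" where
  "star_codim G A \<Gamma> star m =
    vectorspace.dim (class_ring :: 'f ring)
      (quotient_space
        ((free_algebra G)\<lparr>carrier := multilinear_space G m\<rparr>)
        (multilinear_space G m \<inter> star_identities G A \<Gamma> star))"

end

theory Submission
  imports Defs
begin

text \<open>
  A graded involution restricts the grading severely. If \<open>x\<close> and \<open>y\<close> are homogeneous with
  \<open>x * y \<noteq> 0\<close>, then \<open>star (x * y) = star y * star x\<close> shows that the degrees of \<open>x\<close> and \<open>y\<close>
  commute, so commutators of homogeneous elements are homogeneous (\<open>homogeneous_commutator\<close>). Over an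
  infinite field the strictly triangular matrices are precisely the commutators, and therefore the Jacobson
  radical is graded and stable under the involution (\<open>component_JJ_1\<close>, \<open>star_JJ_1\<close>). The same follows
  for the ideals cut out by annihilators of its powers: the ideal generated by the matrix unit at \<open>(k,l)\<close> is
  graded, and the involution maps it to the one at \<open>(n - 1 - l, n - 1 - k)\<close> (\<open>star_corner_ideal\<close>). Hence
  there is a homogeneous basis \<open>hbasis (k,l)\<close>, \<open>k \<le> l < n\<close>, that agrees with the matrix units up to
  entries further up and to the right, and its diagonal members have degree one.

  A multilinear polynomial in \<open>m\<close> variables is an identity iff it vanishes on all tuples \<open>t\<close> of basis
  elements, so the codimension is the rank of the functionals that send a polynomial to an entry of such an
  evaluation. A product of basis elements and their images under the involution is nonzero at \<open>(i,j)\<close> only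
  if the positions of its factors form a chain from \<open>i\<close> to \<open>j\<close>. So at most \<open>n - 1\<close> factors are strictly
  triangular, and if there are as many as that, they sit on the superdiagonal and, after the reflection of
  some of them, use every superdiagonal position once; then only the corner entry survives
  (\<open>nonvanishing_tuple\<close>). Up to the deficient tuples, which have fewer strictly triangular members and
  number \<open>O(m ^ (n - 2) * n ^ m)\<close>, the codimension is at most the number of these leading tuples.

  Conversely, a product of iterated commutators separates a leading tuple from the others
  (\<open>separating_polynomial\<close>), as long as every diagonal position except the first appears among the first \<open>r\<close>
  variables and no step does. For large \<open>r\<close> this excludes only a small proportion of the leading tuples.

  It remains to count. The places of the \<open>n - 1\<close> superdiagonal members can be chosen in \<open>m choose (n - 1)\<close>
  ways, and the diagonal members in \<open>n ^ (m - n + 1)\<close> ways. The superdiagonal positions are assigned as by a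
  permutation, except that two places that share a pair \<open>{l, n - 2 - l}\<close> may receive any two values of the
  pair: 4 possibilities instead of 2. This gives \<open>fact (n - 1) * 2 ^ ((n - 1) div 2)\<close> assignments
  (\<open>card_balanced\<close>) and, in total, the asserted main term.
\<close>

section \<open>Dimension of a quotient cut out by linear functionals\<close>

definition linear_functional :: "('f :: field, 'v, 'z) module_scheme \<Rightarrow> ('v \<Rightarrow> 'f) \<Rightarrow> bool" where
  "linear_functional V \<phi> \<longleftrightarrow>
    (\<forall>x \<in> carrier V. \<forall>y \<in> carrier V. \<phi> (x \<oplus>\<^bsub>V\<^esub> y) = \<phi> x + \<phi> y) \<and>
    (\<forall>c. \<forall>x \<in> carrier V. \<phi> (c \<odot>\<^bsub>V\<^esub> x) = c * \<phi> x)"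

lemma
  assumes "linear_functional V \<phi>" "x \<in> carrier V"
  shows linear_functional_add: "y \<in> carrier V \<Longrightarrow> \<phi> (x \<oplus>\<^bsub>V\<^esub> y) = \<phi> x + \<phi> y"
    and linear_functional_smult: "\<phi> (c \<odot>\<^bsub>V\<^esub> x) = c * \<phi> x"
  using assms unfolding linear_functional_def by auto

context
  fixes V :: "('f :: field, 'v, 'z) module_scheme"
  assumes V: "vectorspace class_ring V"
begin

interpretation V: vectorspace class_ring V by (rule V)

lemma linear_functional_zero:
  assumes "linear_functional V \<phi>"
  shows "\<phi> \<zero>\<^bsub>V\<^esub> = 0"
proof -
  have "\<phi> (0 \<odot>\<^bsub>V\<^esub> \<zero>\<^bsub>V\<^esub>) = 0 * \<phi> \<zero>\<^bsub>V\<^esub>"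
    using assms unfolding linear_functional_def by blast
  then show ?thesis using V.smult_l_null[of "\<zero>\<^bsub>V\<^esub>"] by simp
qed

lemma linear_functional_lincomb:
  assumes "linear_functional V \<phi>" "finite A" "A \<subseteq> carrier V"
  shows "\<phi> (V.lincomb a A) = (\<Sum>v\<in>A. a v * \<phi> v)"
  using assms(2,3)
proof (induction A rule: finite_induct)
  case empty
  then show ?case using linear_functional_zero[OF assms(1)] by (simp add: V.lincomb_def)
next
  case (insert x A)
  have "V.lincomb a (A \<union> {x}) = a x \<odot>\<^bsub>V\<^esub> x \<oplus>\<^bsub>V\<^esub> V.lincomb a A"
    using insert by (intro V.lincomb_insert) auto
  moreover have "V.lincomb a A \<in> carrier V"
    using insert by (intro V.lincomb_closed) auto
  moreover have "a x \<odot>\<^bsub>V\<^esub> x \<in> carrier V"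
    using insert by (intro V.smult_closed) auto
  ultimately have "\<phi> (V.lincomb a (insert x A)) = a x * \<phi> x + \<phi> (V.lincomb a A)"
    using assms(1) insert unfolding linear_functional_def by simp
  then show ?case using insert by simp
qed

text \<open>
  Induction on the set of functionals. A functional that vanishes on the common kernel of the others is
  determined by them, so the same \<open>B\<close> serves. Otherwise some vector lies in the kernel of the others and not
  in its own, and adding this vector to \<open>B\<close> allows its value to be corrected without disturbing the rest.
\<close>

lemma interpolation_by_span:
  assumes "finite \<Phi>" "\<And>\<phi>. \<phi> \<in> \<Phi> \<Longrightarrow> linear_functional V \<phi>"
  shows "\<exists>B. finite B \<and> B \<subseteq> carrier V \<and> card B \<le> card \<Phi> \<and>
           (\<forall>x \<in> carrier V. \<exists>y \<in> V.span B. \<forall>\<phi> \<in> \<Phi>. \<phi> x = \<phi> y)"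
  using assms
proof (induction \<Phi> rule: finite_induct)
  case empty
  have "\<zero>\<^bsub>V\<^esub> \<in> V.span {}" by (simp add: V.span_empty)
  then show ?case by (intro exI[of _ "{}"]) auto
next
  case (insert \<phi> \<Phi>)
  from insert obtain B where B: "finite B" "B \<subseteq> carrier V" "card B \<le> card \<Phi>"
    "\<And>x. x \<in> carrier V \<Longrightarrow> \<exists>y \<in> V.span B. \<forall>\<phi> \<in> \<Phi>. \<phi> x = \<phi> y"
    by auto
  have lin: "linear_functional V \<psi>" if "\<psi> \<in> insert \<phi> \<Phi>" for \<psi> using insert.prems that by blast
  have add: "\<psi> (x \<oplus>\<^bsub>V\<^esub> y) = \<psi> x + \<psi> y" and smult: "\<psi> (c \<odot>\<^bsub>V\<^esub> x) = c * \<psi> x"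
    if "\<psi> \<in> insert \<phi> \<Phi>" "x \<in> carrier V" "y \<in> carrier V" for \<psi> x y c
    using lin[OF that(1)] that unfolding linear_functional_def by auto
  have sub: "V.span B \<subseteq> carrier V" using B(2) by (rule V.span_is_subset2)
  show ?case
  proof (cases "\<forall>x \<in> carrier V. (\<forall>\<psi>\<in>\<Phi>. \<psi> x = 0) \<longrightarrow> \<phi> x = 0")
    case True
    have "\<exists>y \<in> V.span B. \<forall>\<psi> \<in> insert \<phi> \<Phi>. \<psi> x = \<psi> y" if x: "x \<in> carrier V" for x
    proof -
      obtain y where y: "y \<in> V.span B" "\<forall>\<psi> \<in> \<Phi>. \<psi> x = \<psi> y" using B(4)[OF x] by blast
      have yc: "y \<in> carrier V" using sub y(1) by auto
      define z where "z = x \<oplus>\<^bsub>V\<^esub> (- 1) \<odot>\<^bsub>V\<^esub> y"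
      have zc: "z \<in> carrier V" using x yc by (auto simp: z_def intro!: V.smult_closed)
      have "\<psi> z = \<psi> x - \<psi> y" if "\<psi> \<in> insert \<phi> \<Phi>" for \<psi>
        unfolding z_def using add[OF that x, of "(- 1) \<odot>\<^bsub>V\<^esub> y"] smult[OF that yc yc, of "- 1"] yc
        by (simp add: V.smult_closed)
      moreover from this have "\<phi> z = 0" using True zc y(2) by (metis insertCI right_minus_eq)
      ultimately have "\<phi> x = \<phi> y" by (metis insertI1 right_minus_eq)
      then show ?thesis using y by auto
    qed
    then show ?thesis using B insert.hyps by (intro exI[of _ B]) auto
  next
    case False
    then obtain v where v: "v \<in> carrier V" "\<forall>\<psi>\<in>\<Phi>. \<psi> v = 0" "\<phi> v \<noteq> 0" by auto
    have "\<exists>y \<in> V.span (insert v B). \<forall>\<psi> \<in> insert \<phi> \<Phi>. \<psi> x = \<psi> y" if x: "x \<in> carrier V" for x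
    proof -
      obtain y where y: "y \<in> V.span B" "\<forall>\<psi> \<in> \<Phi>. \<psi> x = \<psi> y" using B(4)[OF x] by blast
      have yc: "y \<in> carrier V" using sub y(1) by auto
      define c where "c = (\<phi> x - \<phi> y) / \<phi> v"
      have sc: "insert v B \<subseteq> carrier V" using v B by auto
      have 1: "y \<in> V.span (insert v B)" using V.span_is_monotone[of B "insert v B"] y by auto
      have "v \<in> V.span (insert v B)" using V.span_mem[of "insert v B" v] sc by auto
      then have 2: "c \<odot>\<^bsub>V\<^esub> v \<in> V.span (insert v B)"
        using submodule.smult_closed[OF V.span_is_submodule[OF sc]] by simp
      have "y \<oplus>\<^bsub>V\<^esub> c \<odot>\<^bsub>V\<^esub> v \<in> V.span (insert v B)"
        using submodule.m_closed[OF V.span_is_submodule[OF sc] 1 2] .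
      moreover have "\<psi> x = \<psi> (y \<oplus>\<^bsub>V\<^esub> c \<odot>\<^bsub>V\<^esub> v)" if "\<psi> \<in> insert \<phi> \<Phi>" for \<psi>
      proof -
        have "\<psi> (y \<oplus>\<^bsub>V\<^esub> c \<odot>\<^bsub>V\<^esub> v) = \<psi> y + c * \<psi> v"
          using add[OF that yc, of "c \<odot>\<^bsub>V\<^esub> v"] smult[OF that v(1) v(1), of c] v by (simp add: V.smult_closed)
        then show ?thesis using that y(2) v(2,3) by (auto simp: c_def)
      qed
      ultimately show ?thesis by blast
    qed
    moreover have "card (insert v B) \<le> card (insert \<phi> \<Phi>)"
      using B insert.hyps by (simp add: card_insert_if)
    ultimately show ?thesis using B v by (intro exI[of _ "insert v B"]) auto
  qed
qed

lemma dim_le_separating_functionals: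
  assumes "finite \<Phi>" "\<And>\<phi>. \<phi> \<in> \<Phi> \<Longrightarrow> linear_functional V \<phi>"
    and sep: "\<And>x. x \<in> carrier V \<Longrightarrow> (\<And>\<phi>. \<phi> \<in> \<Phi> \<Longrightarrow> \<phi> x = 0) \<Longrightarrow> x = \<zero>\<^bsub>V\<^esub>"
  shows "V.fin_dim" "V.dim \<le> card \<Phi>"
proof -
  obtain B where B: "finite B" "B \<subseteq> carrier V" "card B \<le> card \<Phi>"
    "\<And>x. x \<in> carrier V \<Longrightarrow> \<exists>y \<in> V.span B. \<forall>\<phi> \<in> \<Phi>. \<phi> x = \<phi> y"
    using interpolation_by_span[OF assms(1,2)] by blast
  have sub: "V.span B \<subseteq> carrier V" using B(2) by (rule V.span_is_subset2)
  have "x \<in> V.span B" if x: "x \<in> carrier V" for x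
  proof -
    obtain y where y: "y \<in> V.span B" "\<forall>\<phi> \<in> \<Phi>. \<phi> x = \<phi> y" using B(4)[OF x] by blast
    have yc: "y \<in> carrier V" using y sub by auto
    have "x \<oplus>\<^bsub>V\<^esub> (- 1) \<odot>\<^bsub>V\<^esub> y = \<zero>\<^bsub>V\<^esub>"
    proof (rule sep)
      fix \<phi> assume "\<phi> \<in> \<Phi>"
      then have l: "linear_functional V \<phi>" using assms by auto
      have "\<phi> (x \<oplus>\<^bsub>V\<^esub> (- 1) \<odot>\<^bsub>V\<^esub> y) = \<phi> x + (- 1) * \<phi> y"
        using l x yc V.smult_closed[of "- 1" y] unfolding linear_functional_def by simp
      then show "\<phi> (x \<oplus>\<^bsub>V\<^esub> (- 1) \<odot>\<^bsub>V\<^esub> y) = 0" using y \<open>\<phi> \<in> \<Phi>\<close> by auto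
    qed (use x yc in \<open>auto intro!: V.smult_closed\<close>)
    moreover have "(- 1) \<odot>\<^bsub>V\<^esub> y \<oplus>\<^bsub>V\<^esub> y = \<zero>\<^bsub>V\<^esub>"
      using V.smult_l_distr[of "- 1" 1 y] V.smult_one[OF yc] V.smult_l_null[OF yc] yc by simp
    moreover have "x = x \<oplus>\<^bsub>V\<^esub> ((- 1) \<odot>\<^bsub>V\<^esub> y \<oplus>\<^bsub>V\<^esub> y)"
      using calculation(2) x by simp
    ultimately have "x = y"
      using x yc V.smult_closed[of "- 1" y] V.M.a_assoc[of x "(- 1) \<odot>\<^bsub>V\<^esub> y" y] by simp
    then show ?thesis using y by simp
  qed
  then have gen: "V.gen_set B" using sub by auto
  then show "V.fin_dim" using B unfolding V.fin_dim_def by blast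
  show "V.dim \<le> card \<Phi>" using V.gen_ge_dim[OF B(1,2) gen] B(3) by linarith
qed

text \<open>
  The vectors \<open>f t\<close> are linearly independent, because \<open>\<psi> t\<close> reads off a nonzero multiple of the
  coefficient of \<open>f t\<close>.
\<close>

lemma dim_ge_dual_family:
  assumes "V.fin_dim" "finite T" "\<And>t. t \<in> T \<Longrightarrow> f t \<in> carrier V"
    and lin: "\<And>t. t \<in> T \<Longrightarrow> linear_functional V (\<psi> t)"
    and dual: "\<And>s t. s \<in> T \<Longrightarrow> t \<in> T \<Longrightarrow> \<psi> t (f s) \<noteq> 0 \<longleftrightarrow> s = t"
  shows "card T \<le> V.dim"
proof -
  have inj: "inj_on f T"
    using dual by (metis inj_onI)
  have "V.lin_indpt (f ` T)"
  proof (rule V.finite_lin_indpt2)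
    fix a assume a: "V.lincomb a (f ` T) = \<zero>\<^bsub>V\<^esub>"
    show "\<forall>v\<in>f ` T. a v = \<zero>\<^bsub>class_ring\<^esub>"
    proof safe
      fix t assume t: "t \<in> T"
      have "0 = \<psi> t (V.lincomb a (f ` T))" using a linear_functional_zero[OF lin[OF t]] by simp
      also have "\<dots> = (\<Sum>v\<in>f ` T. a v * \<psi> t v)"
        using assms t by (intro linear_functional_lincomb) auto
      also have "\<dots> = (\<Sum>s\<in>T. a (f s) * \<psi> t (f s))" using inj by (simp add: sum.reindex)
      also have "\<dots> = (\<Sum>s\<in>T. if s = t then a (f t) * \<psi> t (f t) else 0)"
        using dual t by (intro sum.cong) auto
      also have "\<dots> = a (f t) * \<psi> t (f t)" using assms t by simp
      finally show "a (f t) = \<zero>\<^bsub>class_ring\<^esub>" using dual[OF t t] by simp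
    qed
  qed (use assms in auto)
  then have "card (f ` T) \<le> V.dim" using assms by (intro V.li_le_dim) auto
  then show ?thesis using inj by (simp add: card_image)
qed

end

context
  fixes V :: "('f :: field, 'v, 'z) module_scheme" and \<Phi> :: "('v \<Rightarrow> 'f) set" and W :: "'v set"
  assumes V: "vectorspace class_ring V"
    and lin: "\<And>\<phi>. \<phi> \<in> \<Phi> \<Longrightarrow> linear_functional V \<phi>"
    and W: "W = {v \<in> carrier V. \<forall>\<phi>\<in>\<Phi>. \<phi> v = 0}"
begin

interpretation V: vectorspace class_ring V by (rule V)

private lemma W_mem: "v \<in> W \<longleftrightarrow> v \<in> carrier V \<and> (\<forall>\<phi>\<in>\<Phi>. \<phi> v = 0)"
  by (simp add: W)

private lemma W_closed:
  "\<zero>\<^bsub>V\<^esub> \<in> W" "W \<subseteq> carrier V" "x \<in> W \<Longrightarrow> y \<in> W \<Longrightarrow> x \<oplus>\<^bsub>V\<^esub> y \<in> W"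
  "x \<in> W \<Longrightarrow> c \<odot>\<^bsub>V\<^esub> x \<in> W"
proof -
  show "\<zero>\<^bsub>V\<^esub> \<in> W" using lin linear_functional_zero[OF V] by (auto simp: W)
  show "W \<subseteq> carrier V" by (auto simp: W)
  show "x \<in> W \<Longrightarrow> y \<in> W \<Longrightarrow> x \<oplus>\<^bsub>V\<^esub> y \<in> W"
    by (auto simp: W linear_functional_add[OF lin])
  show "x \<in> W \<Longrightarrow> c \<odot>\<^bsub>V\<^esub> x \<in> W"
    by (auto simp: W linear_functional_smult[OF lin] V.smult_closed)
qed

private lemma W_subgroup: "abelian_subgroup W V"
proof (rule abelian_subgroupI3)
  show "additive_subgroup W V"
    unfolding additive_subgroup_def
  proof (rule V.add.subgroupI)
    fix a assume a: "a \<in> W"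
    then have ac: "a \<in> carrier V" using W_closed by auto
    have "(- 1) \<odot>\<^bsub>V\<^esub> a \<oplus>\<^bsub>V\<^esub> a = \<zero>\<^bsub>V\<^esub>"
      using V.smult_l_distr[of "- 1" 1 a] V.smult_one[OF ac] V.smult_l_null[OF ac] ac by simp
    then have "\<ominus>\<^bsub>V\<^esub> a = (- 1) \<odot>\<^bsub>V\<^esub> a"
      using ac V.M.minus_equality[of "(- 1) \<odot>\<^bsub>V\<^esub> a" a] V.smult_closed[of "- 1" a] by simp
    then show "\<ominus>\<^bsub>V\<^esub> a \<in> W" using W_closed(4)[OF a] by simp
  qed (use W_closed in auto)
  show "abelian_group V" ..
qed

interpretation W: abelian_subgroup W V by (rule W_subgroup)

private abbreviation Q where "Q \<equiv> quotient_space V W"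

private lemma Q_carrier: "carrier Q = (\<lambda>x. W +>\<^bsub>V\<^esub> x) ` carrier V"
  by (auto simp: quotient_space_def A_RCOSETS_def')

private lemma Q_zero: "\<zero>\<^bsub>Q\<^esub> = W +>\<^bsub>V\<^esub> \<zero>\<^bsub>V\<^esub>"
  using V.a_coset_add_zero[OF W_closed(2)] by (simp add: quotient_space_def)

private lemma Q_add: "x \<in> carrier V \<Longrightarrow> y \<in> carrier V \<Longrightarrow>
    (W +>\<^bsub>V\<^esub> x) \<oplus>\<^bsub>Q\<^esub> (W +>\<^bsub>V\<^esub> y) = W +>\<^bsub>V\<^esub> (x \<oplus>\<^bsub>V\<^esub> y)"
  by (simp add: quotient_space_def W.a_rcos_sum)

private lemma coset_eq: 
  assumes "x \<in> carrier V" "y \<in> carrier V"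
  shows "W +>\<^bsub>V\<^esub> x = W +>\<^bsub>V\<^esub> y \<longleftrightarrow> (\<forall>\<phi>\<in>\<Phi>. \<phi> x = \<phi> y)"
proof -
  have m: "\<phi> (x \<ominus>\<^bsub>V\<^esub> y) = \<phi> x - \<phi> y" if "\<phi> \<in> \<Phi>" for \<phi>
  proof -
    have "\<phi> ((x \<ominus>\<^bsub>V\<^esub> y) \<oplus>\<^bsub>V\<^esub> y) = \<phi> (x \<ominus>\<^bsub>V\<^esub> y) + \<phi> y"
      using lin[OF that] assms unfolding linear_functional_def by auto
    moreover have "(x \<ominus>\<^bsub>V\<^esub> y) \<oplus>\<^bsub>V\<^esub> y = x" using assms
      by (simp add: a_minus_def V.M.a_assoc V.M.l_neg)
    ultimately show ?thesis by simp
  qed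
  have "W +>\<^bsub>V\<^esub> x = W +>\<^bsub>V\<^esub> y \<longleftrightarrow> x \<in> W +>\<^bsub>V\<^esub> y"
    using W.a_repr_independence'[of x y] W.a_rcos_self[of x] assms by auto
  also have "\<dots> \<longleftrightarrow> x \<ominus>\<^bsub>V\<^esub> y \<in> W"
    using W.a_rcos_module[OF assms(2,1)] by (simp add: a_minus_def)
  also have "\<dots> \<longleftrightarrow> (\<forall>\<phi>\<in>\<Phi>. \<phi> (x \<ominus>\<^bsub>V\<^esub> y) = 0)"
    using V.minus_closed[OF assms] by (simp only: W_mem simp_thms)
  also have "\<dots> \<longleftrightarrow> (\<forall>\<phi>\<in>\<Phi>. \<phi> x = \<phi> y)"
    by (rule ball_cong[OF refl]) (simp only: m right_minus_eq)
  finally show ?thesis .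
qed

private lemma Q_smult: 
  assumes "x \<in> carrier V" 
  shows "c \<odot>\<^bsub>Q\<^esub> (W +>\<^bsub>V\<^esub> x) = W +>\<^bsub>V\<^esub> (c \<odot>\<^bsub>V\<^esub> x)"
proof -
  have sub: "W +>\<^bsub>V\<^esub> x \<subseteq> carrier V" using assms W_closed(2) by (rule V.a_r_coset_subset_G[rotated])
  have self: "x \<in> W +>\<^bsub>V\<^esub> x" using assms by (rule W.a_rcos_self)
  have *: "W +>\<^bsub>V\<^esub> (c \<odot>\<^bsub>V\<^esub> y) = W +>\<^bsub>V\<^esub> (c \<odot>\<^bsub>V\<^esub> x)" if "y \<in> W +>\<^bsub>V\<^esub> x" for y
  proof -
    have yc: "y \<in> carrier V" using that sub by auto
    have "W +>\<^bsub>V\<^esub> y = W +>\<^bsub>V\<^esub> x" using W.a_repr_independence'[OF that assms] by simp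
    then have "\<forall>\<phi>\<in>\<Phi>. \<phi> y = \<phi> x" using coset_eq[OF yc assms] by simp
    then show ?thesis using coset_eq[of "c \<odot>\<^bsub>V\<^esub> y" "c \<odot>\<^bsub>V\<^esub> x"] yc assms V.smult_closed[of c]
      by (simp add: linear_functional_smult[OF lin])
  qed
  have "c \<odot>\<^bsub>Q\<^esub> (W +>\<^bsub>V\<^esub> x) = (\<Union>y \<in> W +>\<^bsub>V\<^esub> x. W +>\<^bsub>V\<^esub> (c \<odot>\<^bsub>V\<^esub> y))"
    by (simp only: quotient_space_def module.simps)
  also have "\<dots> = (\<Union>y \<in> W +>\<^bsub>V\<^esub> x. W +>\<^bsub>V\<^esub> (c \<odot>\<^bsub>V\<^esub> x))" using * by (intro SUP_cong refl)
  also have "\<dots> = W +>\<^bsub>V\<^esub> (c \<odot>\<^bsub>V\<^esub> x)" using self by blast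
  finally show ?thesis .
qed

lemma vectorspace_quotient: "vectorspace class_ring Q"
proof -
  have rep: "\<exists>x \<in> carrier V. X = W +>\<^bsub>V\<^esub> x" if "X \<in> carrier Q" for X
    using that unfolding Q_carrier by blast
  have mem: "W +>\<^bsub>V\<^esub> x \<in> carrier Q" if "x \<in> carrier V" for x
    using that unfolding Q_carrier by blast
  have "abelian_group Q"
  proof (rule abelian_groupI)
    fix X Y assume "X \<in> carrier Q" "Y \<in> carrier Q"
    then obtain x y where xy: "x \<in> carrier V" "X = W +>\<^bsub>V\<^esub> x" "y \<in> carrier V" "Y = W +>\<^bsub>V\<^esub> y"
      using rep by metis
    show "X \<oplus>\<^bsub>Q\<^esub> Y \<in> carrier Q" using xy by (simp only: Q_add mem V.a_closed)
    show "X \<oplus>\<^bsub>Q\<^esub> Y = Y \<oplus>\<^bsub>Q\<^esub> X" using xy V.a_comm[of x y] by (simp only: Q_add)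
    fix Z assume "Z \<in> carrier Q"
    then obtain z where "z \<in> carrier V" "Z = W +>\<^bsub>V\<^esub> z" using rep by metis
    then show "X \<oplus>\<^bsub>Q\<^esub> Y \<oplus>\<^bsub>Q\<^esub> Z = X \<oplus>\<^bsub>Q\<^esub> (Y \<oplus>\<^bsub>Q\<^esub> Z)"
      using xy by (simp only: Q_add V.a_closed V.a_assoc)
  next
    fix X assume "X \<in> carrier Q"
    then obtain x where x: "x \<in> carrier V" "X = W +>\<^bsub>V\<^esub> x" using rep by metis
    show "\<zero>\<^bsub>Q\<^esub> \<oplus>\<^bsub>Q\<^esub> X = X" using x by (simp only: Q_zero Q_add V.zero_closed V.l_zero)
    have "(W +>\<^bsub>V\<^esub> (\<ominus>\<^bsub>V\<^esub> x)) \<oplus>\<^bsub>Q\<^esub> X = \<zero>\<^bsub>Q\<^esub>"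
      using x by (simp only: Q_zero Q_add V.a_inv_closed V.l_neg)
    then show "\<exists>Y\<in>carrier Q. Y \<oplus>\<^bsub>Q\<^esub> X = \<zero>\<^bsub>Q\<^esub>" using mem V.a_inv_closed[OF x(1)] by blast
  next
    show "\<zero>\<^bsub>Q\<^esub> \<in> carrier Q" using mem[OF V.zero_closed] by (simp only: Q_zero)
  qed
  moreover have "module_axioms class_ring Q"
  proof
    fix a X assume "X \<in> carrier Q"
    then obtain x where x: "x \<in> carrier V" "X = W +>\<^bsub>V\<^esub> x" using rep by metis
    have sc: "c \<odot>\<^bsub>V\<^esub> x \<in> carrier V" for c using x V.smult_closed[of c x] by simp
    show "a \<odot>\<^bsub>Q\<^esub> X \<in> carrier Q" using x mem[OF sc] by (simp only: Q_smult)
    show "\<one>\<^bsub>class_ring\<^esub> \<odot>\<^bsub>Q\<^esub> X = X" using x V.smult_one[OF x(1)] by (simp only: Q_smult)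
    fix b
    show "(a \<oplus>\<^bsub>class_ring\<^esub> b) \<odot>\<^bsub>Q\<^esub> X = a \<odot>\<^bsub>Q\<^esub> X \<oplus>\<^bsub>Q\<^esub> b \<odot>\<^bsub>Q\<^esub> X"
      using x sc V.smult_l_distr[of a b x] by (simp add: Q_smult Q_add)
    show "(a \<otimes>\<^bsub>class_ring\<^esub> b) \<odot>\<^bsub>Q\<^esub> X = a \<odot>\<^bsub>Q\<^esub> (b \<odot>\<^bsub>Q\<^esub> X)"
      using x sc V.smult_assoc1[of a b x] by (simp add: Q_smult)
    fix Y assume "Y \<in> carrier Q"
    then obtain y where y: "y \<in> carrier V" "Y = W +>\<^bsub>V\<^esub> y" using rep by metis
    have sc': "c \<odot>\<^bsub>V\<^esub> y \<in> carrier V" for c using y V.smult_closed[of c y] by simp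
    show "a \<odot>\<^bsub>Q\<^esub> (X \<oplus>\<^bsub>Q\<^esub> Y) = a \<odot>\<^bsub>Q\<^esub> X \<oplus>\<^bsub>Q\<^esub> a \<odot>\<^bsub>Q\<^esub> Y"
      using x y sc sc' V.smult_r_distr[of a x y] by (simp add: Q_smult Q_add)
  qed
  ultimately have "Module.module class_ring Q"
    using V.module_axioms unfolding Module.module_def by blast
  then show ?thesis using class_field by (simp add: vectorspace_def)
qed

text \<open>
  A functional on the quotient, given by any representative; the choice is immaterial when \<open>\<psi>\<close> vanishes
  on \<open>W\<close>.
\<close>

definition on_coset :: "('v \<Rightarrow> 'f) \<Rightarrow> 'v set \<Rightarrow> 'f" where
  "on_coset \<psi> X = \<psi> (SOME x. x \<in> X)"

private lemma on_coset:
  assumes l: "linear_functional V \<psi>" and "\<And>w. w \<in> W \<Longrightarrow> \<psi> w = 0" and x: "x \<in> carrier V"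
  shows "on_coset \<psi> (W +>\<^bsub>V\<^esub> x) = \<psi> x"
proof -
  have self: "x \<in> W +>\<^bsub>V\<^esub> x" using assms by (intro W.a_rcos_self)
  have "\<psi> y = \<psi> x" if "y \<in> W +>\<^bsub>V\<^esub> x" for y
  proof -
    from that obtain w where w: "w \<in> W" "y = w \<oplus>\<^bsub>V\<^esub> x" by (auto simp: a_r_coset_def')
    then have "w \<in> carrier V" using W_closed(2) by blast
    then show ?thesis using linear_functional_add[OF l _ x, of w] assms(2)[OF w(1)] w(2) by simp
  qed
  then show ?thesis unfolding on_coset_def by (rule someI2[where P = "\<lambda>y. y \<in> W +>\<^bsub>V\<^esub> x" and a = x, OF self])
qed

private lemma on_coset_linear:
  assumes l: "linear_functional V \<psi>" and "\<And>w. w \<in> W \<Longrightarrow> \<psi> w = 0"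
  shows "linear_functional Q (on_coset \<psi>)"
  unfolding linear_functional_def[of Q]
proof (intro conjI ballI allI)
  fix X c assume "X \<in> carrier Q"
  then obtain x where x: "x \<in> carrier V" "X = W +>\<^bsub>V\<^esub> x" unfolding Q_carrier by blast
  have "c \<odot>\<^bsub>V\<^esub> x \<in> carrier V" using x V.smult_closed[of c x] by simp
  then show "on_coset \<psi> (c \<odot>\<^bsub>Q\<^esub> X) = c * on_coset \<psi> X"
    using x by (simp only: Q_smult on_coset[OF assms] linear_functional_smult[OF l])
  fix Y assume "Y \<in> carrier Q"
  then obtain y where y: "y \<in> carrier V" "Y = W +>\<^bsub>V\<^esub> y" unfolding Q_carrier by blast
  show "on_coset \<psi> (X \<oplus>\<^bsub>Q\<^esub> Y) = on_coset \<psi> X + on_coset \<psi> Y"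
    using x y by (simp only: Q_add on_coset[OF assms] linear_functional_add[OF l] V.a_closed)
qed

text \<open>
  The functionals of \<open>\<Phi>\<close> descend to the quotient by their common kernel \<open>W\<close> and separate its points, so
  there are at least as many of them as dimensions. Functionals that vanish on \<open>W\<close> descend as well, and a
  family of them that is dual to a family of vectors keeps the classes of these vectors independent.
\<close>

lemma dim_quotient_bounds:
  assumes fin: "finite \<Phi>"
  shows "vectorspace.dim class_ring (quotient_space V W) \<le> card \<Phi>"
    and "\<lbrakk>finite T; \<And>t. t \<in> T \<Longrightarrow> f t \<in> carrier V;
          \<And>t. t \<in> T \<Longrightarrow> linear_functional V (\<psi> t);
          \<And>t w. t \<in> T \<Longrightarrow> w \<in> W \<Longrightarrow> \<psi> t w = 0;
          \<And>s t. s \<in> T \<Longrightarrow> t \<in> T \<Longrightarrow> \<psi> t (f s) \<noteq> 0 \<longleftrightarrow> s = t\<rbrakk>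
         \<Longrightarrow> card T \<le> vectorspace.dim class_ring (quotient_space V W)"
proof -
  have W0: "\<And>w. w \<in> W \<Longrightarrow> \<phi> w = 0" if "\<phi> \<in> \<Phi>" for \<phi> using that W_mem by blast
  have fl: "linear_functional Q \<phi>'" if "\<phi>' \<in> on_coset ` \<Phi>" for \<phi>'
    using that on_coset_linear[OF lin W0] by auto
  have sep: "X = \<zero>\<^bsub>Q\<^esub>" if X: "X \<in> carrier Q" "\<And>\<phi>. \<phi> \<in> on_coset ` \<Phi> \<Longrightarrow> \<phi> X = 0" for X
  proof -
    from X obtain x where x: "x \<in> carrier V" "X = W +>\<^bsub>V\<^esub> x" unfolding Q_carrier by blast
    have "\<phi> x = \<phi> \<zero>\<^bsub>V\<^esub>" if "\<phi> \<in> \<Phi>" for \<phi>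
      using X(2)[of "on_coset \<phi>"] that x on_coset[OF lin[OF that] W0[OF that] x(1)]
        linear_functional_zero[OF V lin[OF that]] by simp
    then show ?thesis using x coset_eq[of x "\<zero>\<^bsub>V\<^esub>"] by (simp add: Q_zero)
  qed
  have fd: "vectorspace.fin_dim class_ring Q"
    by (rule dim_le_separating_functionals(1)[OF vectorspace_quotient finite_imageI[OF fin, of on_coset]])
      (rule fl, assumption, rule sep)
  have "vectorspace.dim class_ring Q \<le> card (on_coset ` \<Phi>)"
    by (rule dim_le_separating_functionals(2)[OF vectorspace_quotient finite_imageI[OF fin, of on_coset]])
      (rule fl, assumption, rule sep)
  also have "\<dots> \<le> card \<Phi>" by (rule card_image_le[OF fin])
  finally show "vectorspace.dim class_ring Q \<le> card \<Phi>" .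
  show "card T \<le> vectorspace.dim class_ring Q" 
    if T: "finite T" "\<And>t. t \<in> T \<Longrightarrow> f t \<in> carrier V"
       "\<And>t. t \<in> T \<Longrightarrow> linear_functional V (\<psi> t)"
       "\<And>t w. t \<in> T \<Longrightarrow> w \<in> W \<Longrightarrow> \<psi> t w = 0"
       "\<And>s t. s \<in> T \<Longrightarrow> t \<in> T \<Longrightarrow> \<psi> t (f s) \<noteq> 0 \<longleftrightarrow> s = t"
  proof (rule dim_ge_dual_family[OF vectorspace_quotient fd T(1)])
    show "W +>\<^bsub>V\<^esub> f t \<in> carrier Q" if "t \<in> T" for t
      using T(2)[OF that] unfolding Q_carrier by blast
    show "linear_functional Q (on_coset (\<psi> t))" if "t \<in> T" for t
      by (rule on_coset_linear[OF T(3,4)[OF that]])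
    show "on_coset (\<psi> t) (W +>\<^bsub>V\<^esub> f s) \<noteq> 0 \<longleftrightarrow> s = t" if st: "s \<in> T" "t \<in> T" for s t
    proof -
      have "on_coset (\<psi> t) (W +>\<^bsub>V\<^esub> f s) = \<psi> t (f s)"
        by (rule on_coset) (use T(2-4) st in blast)+
      then show ?thesis using T(5)[OF st] by (simp only:)
    qed
  qed
qed

end

section \<open>Upper triangular matrices\<close>

definition UT :: "nat \<Rightarrow> 'f :: field mat set" where
  "UT n = {A \<in> carrier_mat n n. \<forall>i<n. \<forall>j<i. A $$ (i,j) = 0}"

lemma carrier_ut_algebra: "carrier (ut_algebra n) = UT n"
  by (auto simp: ut_algebra_def UT_def upper_triangular_def)

lemma UT_carrier: "A \<in> UT n \<Longrightarrow> A \<in> carrier_mat n n"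
  and UT_dims [simp]: "A \<in> UT n \<Longrightarrow> dim_row A = n" "A \<in> UT n \<Longrightarrow> dim_col A = n"
  and UT_lower: "A \<in> UT n \<Longrightarrow> j < i \<Longrightarrow> i < n \<Longrightarrow> A $$ (i,j) = 0"
  by (auto simp: UT_def)

lemma UT_eqI:
  assumes "A \<in> UT n" "B \<in> UT n" "\<And>i j. i \<le> j \<Longrightarrow> j < n \<Longrightarrow> A $$ (i,j) = B $$ (i,j)"
  shows "A = B"
proof (rule eq_matI)
  fix i j assume "i < dim_row B" "j < dim_col B"
  then have ij: "i < n" "j < n" using assms(2) by (auto simp: UT_def)
  show "A $$ (i,j) = B $$ (i,j)"
    using assms(3)[of i j] UT_lower[OF assms(1), of j i] UT_lower[OF assms(2), of j i] ij
    by (cases "i \<le> j") auto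
qed (use assms in auto)

lemma mult_entry:
  assumes "A \<in> carrier_mat n n" "B \<in> carrier_mat n n" "i < n" "j < n"
  shows "(A * B) $$ (i,j) = (\<Sum>s<n. A $$ (i,s) * B $$ (s,j))"
  using assms by (simp add: scalar_prod_def atLeast0LessThan)

lemma UT_mult_entry:
  assumes "A \<in> UT n" "B \<in> UT n" "i < n" "j < n"
  shows "(A * B) $$ (i,j) = (\<Sum>s\<in>{i..j}. A $$ (i,s) * B $$ (s,j))"
proof -
  have "(A * B) $$ (i,j) = (\<Sum>s<n. A $$ (i,s) * B $$ (s,j))"
    by (rule mult_entry) (use assms in \<open>auto simp: UT_def\<close>)
  also have "\<dots> = (\<Sum>s\<in>{i..j}. A $$ (i,s) * B $$ (s,j))"
    by (rule sum.mono_neutral_right)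
      (use assms UT_lower[OF assms(1)] UT_lower[OF assms(2)] in \<open>auto simp: not_le\<close>)
  finally show ?thesis .
qed

lemma UT_zero [simp]: "0\<^sub>m n n \<in> UT n" and UT_one [simp]: "1\<^sub>m n \<in> UT n"
  by (auto simp: UT_def)

lemma UT_add [simp]: "A \<in> UT n \<Longrightarrow> B \<in> UT n \<Longrightarrow> A + B \<in> UT n"
  and UT_minus [simp]: "A \<in> UT n \<Longrightarrow> B \<in> UT n \<Longrightarrow> A - B \<in> UT n"
  and UT_smult [simp]: "A \<in> UT n \<Longrightarrow> c \<cdot>\<^sub>m A \<in> UT n"
  by (auto simp: UT_def)

lemma UT_mult [simp]: 
  assumes "A \<in> UT n" "B \<in> UT n"
  shows "A * B \<in> UT n"
proof -
  have "A * B \<in> carrier_mat n n" using assms by (auto simp: UT_def)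
  moreover have "(A * B) $$ (i,j) = 0" if "j < i" "i < n" for i j
    using UT_mult_entry[OF assms, of i j] that by simp
  ultimately show ?thesis by (auto simp: UT_def)
qed

lemma UT_mult_diag: "A \<in> UT n \<Longrightarrow> B \<in> UT n \<Longrightarrow> i < n \<Longrightarrow> (A * B) $$ (i,i) = A $$ (i,i) * B $$ (i,i)"
  using UT_mult_entry[of A n B i i] by simp

definition mat_unit :: "nat \<Rightarrow> nat \<Rightarrow> nat \<Rightarrow> 'f :: field mat" where
  "mat_unit n k l = mat n n (\<lambda>p. if p = (k,l) then 1 else 0)"

lemma mat_unit_UT [simp]: "k \<le> l \<Longrightarrow> mat_unit n k l \<in> UT n"
  by (auto simp: UT_def mat_unit_def)

lemma mat_unit_entry: "i < n \<Longrightarrow> j < n \<Longrightarrow> mat_unit n k l $$ (i,j) = (if i = k \<and> j = l then 1 else 0)"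
  by (simp add: mat_unit_def)

lemma mat_unit_carrier: "mat_unit n k l \<in> carrier_mat n n" by (simp add: mat_unit_def)

lemma mat_unit_mult:
  assumes "A \<in> carrier_mat n n" "l < n" "i < n" "j < n"
  shows "(mat_unit n k l * A) $$ (i,j) = (if i = k then A $$ (l,j) else 0)"
proof -
  have "(mat_unit n k l * A) $$ (i,j) = (\<Sum>s<n. mat_unit n k l $$ (i,s) * A $$ (s,j))"
    using mult_entry[OF mat_unit_carrier assms(1,3,4)] .
  also have "\<dots> = (\<Sum>s<n. if s = l then (if i = k then A $$ (l,j) else 0) else 0)"
    using assms by (intro sum.cong) (auto simp: mat_unit_entry)
  finally show ?thesis using assms by simp
qed

lemma mult_mat_unit:
  assumes "A \<in> carrier_mat n n" "k < n" "i < n" "j < n"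
  shows "(A * mat_unit n k l) $$ (i,j) = (if j = l then A $$ (i,k) else 0)"
proof -
  have "(A * mat_unit n k l) $$ (i,j) = (\<Sum>s<n. A $$ (i,s) * mat_unit n k l $$ (s,j))"
    using mult_entry[OF assms(1) mat_unit_carrier assms(3,4)] .
  also have "\<dots> = (\<Sum>s<n. if s = k then (if j = l then A $$ (i,k) else 0) else 0)"
    using assms by (intro sum.cong) (auto simp: mat_unit_entry)
  finally show ?thesis using assms by simp
qed

subsection \<open>Sums and additive maps\<close>

text \<open>
  The size is a parameter, since the matrices of one type have no common zero matrix that could serve as the
  empty sum.
\<close>

definition msum :: "nat \<Rightarrow> ('s \<Rightarrow> 'f :: field mat) \<Rightarrow> 's set \<Rightarrow> 'f mat" where
  "msum n f S = mat n n (\<lambda>p. \<Sum>s\<in>S. f s $$ p)"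

lemma msum_entry [simp]: "i < n \<Longrightarrow> j < n \<Longrightarrow> msum n f S $$ (i,j) = (\<Sum>s\<in>S. f s $$ (i,j))"
  by (simp add: msum_def)

lemma msum_carrier [simp]: "msum n f S \<in> carrier_mat n n"
  and msum_dims [simp]: "dim_row (msum n f S) = n" "dim_col (msum n f S) = n"
  by (simp_all add: msum_def)

lemma msum_UT: "(\<And>s. s \<in> S \<Longrightarrow> f s \<in> UT n) \<Longrightarrow> msum n f S \<in> UT n"
  by (auto simp: UT_def intro!: sum.neutral)

lemma msum_empty [simp]: "msum n f {} = 0\<^sub>m n n"
  by (auto simp: msum_def)

lemma msum_insert: "finite S \<Longrightarrow> s \<notin> S \<Longrightarrow> f s \<in> UT n \<Longrightarrow> msum n f (insert s S) = f s + msum n f S"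
  by (rule eq_matI) auto

lemma msum_cong: "S = T \<Longrightarrow> (\<And>s. s \<in> T \<Longrightarrow> f s = g s) \<Longrightarrow> msum n f S = msum n g T"
  by (simp add: msum_def cong: sum.cong)

text \<open>
  One notion covers the multiplications by a fixed matrix, the involution and the homogeneous projections, all
  of which are pulled through finite sums.
\<close>

definition UT_additive :: "nat \<Rightarrow> ('f :: field mat \<Rightarrow> 'f mat) \<Rightarrow> bool" where
  "UT_additive n L \<longleftrightarrow> (\<forall>A \<in> UT n. L A \<in> UT n) \<and> (\<forall>A \<in> UT n. \<forall>B \<in> UT n. L (A + B) = L A + L B)"

lemma UT_additive_zero: 
  assumes "UT_additive n L"
  shows "L (0\<^sub>m n n) = 0\<^sub>m n n"
proof -
  have 0: "0\<^sub>m n n + 0\<^sub>m n n = (0\<^sub>m n n :: 'a mat)" by auto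
  have U: "L (0\<^sub>m n n) \<in> UT n" using assms by (simp add: UT_additive_def)
  have "L (0\<^sub>m n n) = L (0\<^sub>m n n) + L (0\<^sub>m n n)"
    using assms 0 unfolding UT_additive_def by (metis UT_zero)
  then have "L (0\<^sub>m n n) $$ (i,j) = L (0\<^sub>m n n) $$ (i,j) + L (0\<^sub>m n n) $$ (i,j)" if "i < n" "j < n" for i j
    using U that by (metis UT_dims index_add_mat(1))
  then have "L (0\<^sub>m n n) $$ (i,j) = 0" if "i < n" "j < n" for i j
    using that by (metis add_cancel_right_right)
  then show ?thesis using U by (intro eq_matI) auto
qed

lemma UT_additive_msum:
  assumes "UT_additive n L" "finite S" "\<And>s. s \<in> S \<Longrightarrow> f s \<in> UT n"
  shows "L (msum n f S) = msum n (\<lambda>s. L (f s)) S"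
  using assms(2,3)
proof (induction S rule: finite_induct)
  case empty
  then show ?case using UT_additive_zero[OF assms(1)] by simp
next
  case (insert s S)
  have "L (msum n f (insert s S)) = L (f s) + L (msum n f S)"
    using insert assms(1) by (auto simp: msum_insert UT_additive_def msum_UT)
  also have "\<dots> = msum n (\<lambda>s. L (f s)) (insert s S)"
    using insert assms(1) by (subst msum_insert) (auto simp: UT_additive_def)
  finally show ?case .
qed

lemma UT_additive_mult_left: "A \<in> UT n \<Longrightarrow> UT_additive n (\<lambda>B. A * B)"
  unfolding UT_additive_def
  by (intro conjI ballI UT_mult mult_add_distrib_mat[of _ n n _ n]) (simp_all add: UT_carrier)

lemma UT_additive_mult_right: "A \<in> UT n \<Longrightarrow> UT_additive n (\<lambda>B. B * A)"
  unfolding UT_additive_def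
  by (intro conjI ballI UT_mult add_mult_distrib_mat[of _ n n]) (auto intro: UT_carrier)

lemma UT_additive_minus: 
  fixes L M :: "'f :: field mat \<Rightarrow> 'f mat"
  assumes "UT_additive n L" "UT_additive n M" 
  shows "UT_additive n (\<lambda>B. L B - M B)"
  unfolding UT_additive_def
proof (intro conjI ballI)
  fix A :: "'f mat" assume "A \<in> UT n"
  then show "L A - M A \<in> UT n" using assms by (auto simp: UT_additive_def)
next
  fix A B :: "'f mat" assume AB: "A \<in> UT n" "B \<in> UT n"
  have U: "L A \<in> UT n" "L B \<in> UT n" "M A \<in> UT n" "M B \<in> UT n"
    and "L (A + B) = L A + L B" "M (A + B) = M A + M B"
    using assms AB by (auto simp: UT_additive_def)
  then show "L (A + B) - M (A + B) = L A - M A + (L B - M B)"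
    by (intro eq_matI) (auto simp: U[THEN UT_dims(1)] U[THEN UT_dims(2)])
qed

subsection \<open>Strictly upper triangular matrices\<close>

text \<open>
  The \<open>k\<close>-th power of the Jacobson radical, the whole algebra for \<open>k = 0\<close>.
\<close>

definition JJ :: "nat \<Rightarrow> nat \<Rightarrow> 'f :: field mat set" where
  "JJ n k = {A \<in> UT n. \<forall>i<n. \<forall>j<n. j < i + k \<longrightarrow> A $$ (i,j) = 0}"

lemma JJ_UT: "A \<in> JJ n k \<Longrightarrow> A \<in> UT n" by (simp add: JJ_def)
lemma JJ_0 [simp]: "JJ n 0 = UT n" by (auto simp: JJ_def UT_def)
lemma JJ_antimono: "A \<in> JJ n l \<Longrightarrow> k \<le> l \<Longrightarrow> A \<in> JJ n k" by (auto simp: JJ_def)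
lemma JJ_entry: "A \<in> JJ n k \<Longrightarrow> i < n \<Longrightarrow> j < n \<Longrightarrow> j < i + k \<Longrightarrow> A $$ (i,j) = 0" by (simp add: JJ_def)
lemma JJ_zero [simp]: "0\<^sub>m n n \<in> JJ n k" by (simp add: JJ_def)
lemma JJ_minus: "A \<in> JJ n k \<Longrightarrow> B \<in> JJ n k \<Longrightarrow> A - B \<in> JJ n k" by (auto simp: JJ_def)
lemma JJ_msum: "(\<And>s. s \<in> S \<Longrightarrow> f s \<in> JJ n k) \<Longrightarrow> msum n f S \<in> JJ n k"
  by (auto simp: JJ_def intro!: msum_UT sum.neutral)
lemma JJ_1: "A \<in> JJ n 1 \<longleftrightarrow> A \<in> UT n \<and> (\<forall>i<n. A $$ (i,i) = 0)"
  using UT_lower by (auto simp: JJ_def less_Suc_eq)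

lemma JJ_mult_entry:
  assumes "A \<in> JJ n k" "B \<in> JJ n l" "i < n" "j < n"
  shows "(A * B) $$ (i,j) = (\<Sum>s\<in>{s. i + k \<le> s \<and> s + l \<le> j}. A $$ (i,s) * B $$ (s,j))"
proof -
  have "(A * B) $$ (i,j) = (\<Sum>s\<in>{i..j}. A $$ (i,s) * B $$ (s,j))"
    by (rule UT_mult_entry[OF JJ_UT JJ_UT]) (use assms in auto)
  also have "\<dots> = (\<Sum>s\<in>{s. i + k \<le> s \<and> s + l \<le> j}. A $$ (i,s) * B $$ (s,j))"
  proof (rule sum.mono_neutral_right)
    show "\<forall>s\<in>{i..j} - {s. i + k \<le> s \<and> s + l \<le> j}. A $$ (i, s) * B $$ (s, j) = 0"
    proof
      fix s assume "s \<in> {i..j} - {s. i + k \<le> s \<and> s + l \<le> j}"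
      then have "s < n" "s < i + k \<or> j < s + l" using assms(4) by auto
      then have "A $$ (i,s) = 0 \<or> B $$ (s,j) = 0"
        using JJ_entry[OF assms(1,3), of s] JJ_entry[OF assms(2) _ assms(4), of s] by blast
      then show "A $$ (i,s) * B $$ (s,j) = 0" by auto
    qed
  qed auto
  finally show ?thesis .
qed

lemma JJ_mult:
  assumes "A \<in> JJ n k" "B \<in> JJ n l"
  shows "A * B \<in> JJ n (k + l)"
proof -
  have "(A * B) $$ (i,j) = 0" if "i < n" "j < n" "j < i + (k + l)" for i j
  proof -
    have "{s. i + k \<le> s \<and> s + l \<le> j} = {}" using that by auto
    then show ?thesis using JJ_mult_entry[OF assms that(1,2)] by (simp only: sum.empty)
  qed
  then show ?thesis using UT_mult[OF JJ_UT[OF assms(1)] JJ_UT[OF assms(2)]] unfolding JJ_def[of n "k + l"] by auto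
qed

lemma JJ_mult_corner:
  assumes "A \<in> JJ n k" "B \<in> JJ n l" "i + k + l < n"
  shows "(A * B) $$ (i, i + k + l) = A $$ (i, i + k) * B $$ (i + k, i + k + l)"
proof -
  have "{s. i + k \<le> s \<and> s + l \<le> i + k + l} = {i + k}" by auto
  then show ?thesis using JJ_mult_entry[OF assms(1,2), of i "i + k + l"] assms(3) by simp
qed

lemma JJ_eq_zero: "A \<in> JJ n k \<Longrightarrow> n \<le> k \<Longrightarrow> A = 0\<^sub>m n n"
  by (rule UT_eqI[of _ n]) (simp_all add: JJ_UT JJ_entry)

text \<open>
  For \<open>k \<le> l < n\<close> this is the ideal generated by the matrix unit at \<open>(k,l)\<close>.
\<close>

definition corner_ideal :: "nat \<Rightarrow> nat \<Rightarrow> nat \<Rightarrow> 'f :: field mat set" where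
  "corner_ideal n k l = {A \<in> UT n. \<forall>i<n. \<forall>j<n. A $$ (i,j) \<noteq> 0 \<longrightarrow> i \<le> k \<and> l \<le> j}"

lemma corner_ideal_UT: "A \<in> corner_ideal n k l \<Longrightarrow> A \<in> UT n" by (simp add: corner_ideal_def)

lemma corner_idealD: "A \<in> corner_ideal n k l \<Longrightarrow> i < n \<Longrightarrow> j < n \<Longrightarrow> A $$ (i,j) \<noteq> 0 \<Longrightarrow> i \<le> k \<and> l \<le> j"
  by (simp add: corner_ideal_def)

lemma corner_ideal_JJ: "A \<in> corner_ideal n k l \<Longrightarrow> A \<in> JJ n (l - k)"
proof -
  assume A: "A \<in> corner_ideal n k l"
  have "A $$ (i,j) = 0" if "i < n" "j < n" "j < i + (l - k)" for i j
  proof (rule ccontr)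
    assume nz: "A $$ (i,j) \<noteq> 0"
    then have "i \<le> k" "l \<le> j" using corner_idealD[OF A that(1,2)] by blast+
    moreover have "i \<le> j" using UT_lower[OF corner_ideal_UT[OF A], of j i] that nz by (meson not_le)
    ultimately show False using that(3) by arith
  qed
  then show "A \<in> JJ n (l - k)" using corner_ideal_UT[OF A] unfolding JJ_def by blast
qed

section \<open>Graded involutions on upper triangular matrices\<close>

lemma UT_minus_entry:
  "A \<in> UT n \<Longrightarrow> B \<in> UT n \<Longrightarrow> i < n \<Longrightarrow> j < n \<Longrightarrow> (A - B) $$ (i,j) = A $$ (i,j) - B $$ (i,j)"
  by (auto dest: UT_dims)

lemma UT_minus_self_add: "A \<in> UT n \<Longrightarrow> B \<in> UT n \<Longrightarrow> A = C + B \<Longrightarrow> C \<in> UT n \<Longrightarrow> C = A - B"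
  by (rule UT_eqI[of _ n]) (auto simp: UT_minus_entry)

locale graded_star_UT =
  fixes G :: "('g, 'r) monoid_scheme" and n :: nat
    and \<Gamma> :: "'g \<Rightarrow> 'f :: field mat set" and star :: "'f mat \<Rightarrow> 'f mat"
  assumes group_G: "group G"
    and infinite_field: "infinite (UNIV :: 'f set)"
    and n_pos: "n \<ge> 1"
    and grading_\<Gamma>: "grading G class_ring (ut_algebra n) \<Gamma>"
    and graded_star: "graded_involution G class_ring (ut_algebra n) \<Gamma> star"
begin

sublocale G: group G by (rule group_G)

lemma \<Gamma>_subspace: "g \<in> carrier G \<Longrightarrow> VectorSpace.subspace class_ring (\<Gamma> g) (ut_algebra n)"
  using grading_\<Gamma> by (simp add: grading_def)

lemma vectorspace_UT: "vectorspace class_ring (ut_algebra n :: ('f, 'f mat) module)"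
  using VectorSpace.subspace.vs[OF \<Gamma>_subspace[OF G.one_closed]] .

lemma finsum_UT:
  assumes "finite S" "\<And>s. s \<in> S \<Longrightarrow> f s \<in> UT n"
  shows "(\<Oplus>\<^bsub>(ut_algebra n :: ('f, 'f mat) module)\<^esub> s \<in> S. f s) = msum n f S"
proof -
  interpret U: vectorspace class_ring "ut_algebra n :: ('f, 'f mat) module" by (rule vectorspace_UT)
  show ?thesis using assms
  proof (induction S rule: finite_induct)
    case empty
    have "\<zero>\<^bsub>(ut_algebra n :: ('f, 'f mat) module)\<^esub> = 0\<^sub>m n n" by (simp add: ut_algebra_def)
    then show ?case by simp
  next
    case (insert s S)
    have c: "f \<in> S \<rightarrow> carrier (ut_algebra n)" "f s \<in> carrier (ut_algebra n)"
      using insert.prems by (auto simp: carrier_ut_algebra)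
    have "(\<Oplus>\<^bsub>(ut_algebra n :: ('f, 'f mat) module)\<^esub> s \<in> insert s S. f s) =
        f s + (\<Oplus>\<^bsub>(ut_algebra n :: ('f, 'f mat) module)\<^esub> s \<in> S. f s)"
      using U.finsum_insert[OF insert.hyps c] by (simp add: ut_algebra_def)
    also have "\<dots> = msum n f (insert s S)"
      using insert by (simp add: msum_insert)
    finally show ?case .
  qed
qed

lemma \<Gamma>_closed:
  assumes "g \<in> carrier G"
  shows \<Gamma>_UT: "x \<in> \<Gamma> g \<Longrightarrow> x \<in> UT n"
    and \<Gamma>_zero: "0\<^sub>m n n \<in> \<Gamma> g"
    and \<Gamma>_add: "x \<in> \<Gamma> g \<Longrightarrow> y \<in> \<Gamma> g \<Longrightarrow> x + y \<in> \<Gamma> g"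
    and \<Gamma>_smult: "x \<in> \<Gamma> g \<Longrightarrow> c \<cdot>\<^sub>m x \<in> \<Gamma> g"
proof -
  interpret S: submodule class_ring "\<Gamma> g" "ut_algebra n"
    using VectorSpace.subspace.submod[OF \<Gamma>_subspace[OF assms]] .
  show "x \<in> \<Gamma> g \<Longrightarrow> x \<in> UT n" using S.subset by (auto simp: carrier_ut_algebra)
  show "0\<^sub>m n n \<in> \<Gamma> g" using S.zero_closed by (simp add: ut_algebra_def)
  show "x \<in> \<Gamma> g \<Longrightarrow> y \<in> \<Gamma> g \<Longrightarrow> x + y \<in> \<Gamma> g" using S.m_closed[of x y] by (simp add: ut_algebra_def)
  show "x \<in> \<Gamma> g \<Longrightarrow> c \<cdot>\<^sub>m x \<in> \<Gamma> g" using S.smult_closed[of c x] by (simp add: ut_algebra_def)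
qed

lemma \<Gamma>_uminus:
  assumes "g \<in> carrier G" "x \<in> \<Gamma> g"
  shows "0\<^sub>m n n - x \<in> \<Gamma> g"
proof -
  have "0\<^sub>m n n - x = (- 1) \<cdot>\<^sub>m x"
    using \<Gamma>_UT[OF assms] by (intro eq_matI) auto
  then show ?thesis using \<Gamma>_smult[OF assms] by simp
qed

lemma \<Gamma>_mult: "g \<in> carrier G \<Longrightarrow> h \<in> carrier G \<Longrightarrow> x \<in> \<Gamma> g \<Longrightarrow> y \<in> \<Gamma> h \<Longrightarrow> x * y \<in> \<Gamma> (g \<otimes>\<^bsub>G\<^esub> h)"
  using grading_\<Gamma> by (auto simp: grading_def ut_algebra_def)

lemma star_hom: "star \<in> LinearCombinations.module_hom class_ring (ut_algebra n) (ut_algebra n)"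
  using graded_star by (simp add: graded_involution_def involution_def)

lemma star_UT [simp]: "A \<in> UT n \<Longrightarrow> star A \<in> UT n"
  using LinearCombinations.module_hom_closed[OF star_hom] by (auto simp: carrier_ut_algebra)

lemma star_add: "A \<in> UT n \<Longrightarrow> B \<in> UT n \<Longrightarrow> star (A + B) = star A + star B"
  using LinearCombinations.module_hom_add[OF star_hom, of A B] 
  by (simp add: carrier_ut_algebra) (simp add: ut_algebra_def)

lemma star_smult: "A \<in> UT n \<Longrightarrow> star (c \<cdot>\<^sub>m A) = c \<cdot>\<^sub>m star A"
  using LinearCombinations.module_hom_smult[OF star_hom, of c A] 
  by (simp add: carrier_ut_algebra) (simp add: ut_algebra_def)

lemma star_mult: "A \<in> UT n \<Longrightarrow> B \<in> UT n \<Longrightarrow> star (A * B) = star B * star A"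
  and star_star [simp]: "A \<in> UT n \<Longrightarrow> star (star A) = A"
  using graded_star unfolding graded_involution_def involution_def carrier_ut_algebra
  by (simp_all add: ut_algebra_def)

lemma star_\<Gamma>: "g \<in> carrier G \<Longrightarrow> x \<in> \<Gamma> g \<Longrightarrow> star x \<in> \<Gamma> g"
  using graded_star by (auto simp: graded_involution_def)

lemma star_additive: "UT_additive n star"
  by (simp add: UT_additive_def star_add)

lemma star_zero [simp]: "star (0\<^sub>m n n) = 0\<^sub>m n n"
  by (rule UT_additive_zero[OF star_additive])

lemma star_inj: "A \<in> UT n \<Longrightarrow> star A = 0\<^sub>m n n \<Longrightarrow> A = 0\<^sub>m n n"
  using star_star[of A] by simp

subsection \<open>Homogeneous components\<close>

definition is_decomposition :: "'f mat \<Rightarrow> ('g \<Rightarrow> 'f mat) \<Rightarrow> bool" where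
  "is_decomposition v c \<longleftrightarrow> c \<in> (\<Pi>\<^sub>E g \<in> carrier G. \<Gamma> g) \<and> finite {g \<in> carrier G. c g \<noteq> 0\<^sub>m n n} \<and>
     v = msum n c {g \<in> carrier G. c g \<noteq> 0\<^sub>m n n}"

lemma decomposition_unique:
  assumes "v \<in> UT n"
  shows "\<exists>!c. is_decomposition v c"
proof -
  have "is_decomposition v c \<longleftrightarrow> c \<in> (\<Pi>\<^sub>E g \<in> carrier G. \<Gamma> g) \<and>
        finite {g \<in> carrier G. c g \<noteq> \<zero>\<^bsub>(ut_algebra n :: ('f, 'f mat) module)\<^esub>} \<and>
        v = (\<Oplus>\<^bsub>(ut_algebra n :: ('f, 'f mat) module)\<^esub> g \<in> {g \<in> carrier G. c g \<noteq> \<zero>\<^bsub>(ut_algebra n :: ('f, 'f mat) module)\<^esub>}. c g)" for c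
  proof -
    have z: "\<zero>\<^bsub>(ut_algebra n :: ('f, 'f mat) module)\<^esub> = 0\<^sub>m n n" by (simp add: ut_algebra_def)
    show ?thesis
    proof (cases "c \<in> (\<Pi>\<^sub>E g \<in> carrier G. \<Gamma> g) \<and> finite {g \<in> carrier G. c g \<noteq> 0\<^sub>m n n}")
      case True
      have "c g \<in> UT n" if "g \<in> {g \<in> carrier G. c g \<noteq> 0\<^sub>m n n}" for g
        using that True \<Gamma>_UT[of g "c g"] PiE_mem[of c "carrier G" \<Gamma> g] by blast
      then have "(\<Oplus>\<^bsub>(ut_algebra n :: ('f, 'f mat) module)\<^esub> g \<in> {g \<in> carrier G. c g \<noteq> 0\<^sub>m n n}. c g) =
          msum n c {g \<in> carrier G. c g \<noteq> 0\<^sub>m n n}"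
        using True by (intro finsum_UT) auto
      then show ?thesis unfolding is_decomposition_def z by simp
    next
      case False
      then show ?thesis unfolding is_decomposition_def z by blast
    qed
  qed
  moreover have "\<exists>!c. c \<in> (\<Pi>\<^sub>E g \<in> carrier G. \<Gamma> g) \<and>
        finite {g \<in> carrier G. c g \<noteq> \<zero>\<^bsub>(ut_algebra n :: ('f, 'f mat) module)\<^esub>} \<and>
        v = (\<Oplus>\<^bsub>(ut_algebra n :: ('f, 'f mat) module)\<^esub> g \<in> {g \<in> carrier G. c g \<noteq> \<zero>\<^bsub>(ut_algebra n :: ('f, 'f mat) module)\<^esub>}. c g)"
    using grading_\<Gamma> assms unfolding grading_def carrier_ut_algebra by blast
  ultimately show ?thesis by simp
qed

definition component :: "'g \<Rightarrow> 'f mat \<Rightarrow> 'f mat" where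
  "component g v = (THE c. is_decomposition v c) g"

definition support :: "'f mat \<Rightarrow> 'g set" where
  "support v = {g \<in> carrier G. component g v \<noteq> 0\<^sub>m n n}"

lemma component_decomposition: "v \<in> UT n \<Longrightarrow> is_decomposition v (\<lambda>g. component g v)"
  using theI'[OF decomposition_unique, of v] by (simp add: component_def)

lemma
  assumes "v \<in> UT n"
  shows component_\<Gamma>: "g \<in> carrier G \<Longrightarrow> component g v \<in> \<Gamma> g"
    and finite_support: "finite (support v)"
    and sum_components: "v = msum n (\<lambda>g. component g v) (support v)"
  using component_decomposition[OF assms] unfolding is_decomposition_def support_def
  by (auto simp: PiE_iff)

lemma support_carrier: "g \<in> support v \<Longrightarrow> g \<in> carrier G" by (simp add: support_def)

lemma component_eqI:
  assumes v: "v \<in> UT n" and c: "\<And>g. g \<in> carrier G \<Longrightarrow> c g \<in> \<Gamma> g"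
    and S: "finite S" "S \<subseteq> carrier G" "\<And>g. g \<in> carrier G - S \<Longrightarrow> c g = 0\<^sub>m n n"
    and sum: "v = msum n c S" and g: "g \<in> carrier G"
  shows "component g v = c g"
proof -
  define c' where "c' = restrict c (carrier G)"
  have sub: "{g \<in> carrier G. c' g \<noteq> 0\<^sub>m n n} \<subseteq> S" using S(3) by (auto simp: c'_def)
  have "msum n c' {g \<in> carrier G. c' g \<noteq> 0\<^sub>m n n} = msum n c S"
  proof (rule eq_matI)
    fix i j assume ij: "i < dim_row (msum n c S)" "j < dim_col (msum n c S)"
    have "(\<Sum>s\<in>S. c s $$ (i,j)) = (\<Sum>s\<in>{g \<in> carrier G. c' g \<noteq> 0\<^sub>m n n}. c s $$ (i,j))"
      using S ij by (intro sum.mono_neutral_right sub) (auto simp: c'_def)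
    also have "\<dots> = (\<Sum>s\<in>{g \<in> carrier G. c' g \<noteq> 0\<^sub>m n n}. c' s $$ (i,j))"
      by (rule sum.cong) (auto simp: c'_def)
    finally show "msum n c' {g \<in> carrier G. c' g \<noteq> 0\<^sub>m n n} $$ (i,j) = msum n c S $$ (i,j)"
      using ij by simp
  qed auto
  then have "is_decomposition v c'"
    unfolding is_decomposition_def using finite_subset[OF sub S(1)] sum c by (auto simp: c'_def)
  then have "(THE c. is_decomposition v c) = c'"
    using decomposition_unique[OF v] by (intro the1_equality)
  then show ?thesis using g by (simp add: component_def c'_def)
qed

lemma component_homogeneous:
  assumes "h \<in> carrier G" "x \<in> \<Gamma> h" "g \<in> carrier G"
  shows "component g x = (if g = h then x else 0\<^sub>m n n)"
proof (rule component_eqI[where c = "\<lambda>g. if g = h then x else 0\<^sub>m n n" and S = "{h}"])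
  show "x \<in> UT n" using assms \<Gamma>_UT by blast
  then show "x = msum n (\<lambda>g. if g = h then x else 0\<^sub>m n n) {h}"
    by (intro eq_matI) auto
qed (use assms \<Gamma>_zero in auto)

lemma component_add:
  assumes "v \<in> UT n" "w \<in> UT n" "g \<in> carrier G"
  shows "component g (v + w) = component g v + component g w"
proof (rule component_eqI[where c = "\<lambda>g. component g v + component g w" and S = "support v \<union> support w"])
  let ?S = "support v \<union> support w"
  have U: "component g v \<in> UT n" "component g w \<in> UT n" if "g \<in> carrier G" for g
    using component_\<Gamma> assms that \<Gamma>_UT by blast+
  have ext: "u = msum n (\<lambda>g. component g u) ?S" if u: "u = v \<or> u = w" for u
  proof (rule eq_matI)
    fix i j assume "i < dim_row (msum n (\<lambda>g. component g u) ?S)" "j < dim_col (msum n (\<lambda>g. component g u) ?S)"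
    then have ij: "i < n" "j < n" by auto
    have uU: "u \<in> UT n" using u assms by auto
    have "u $$ (i,j) = msum n (\<lambda>g. component g u) (support u) $$ (i,j)"
      using sum_components[OF uU] by simp
    also have "\<dots> = (\<Sum>g\<in>support u. component g u $$ (i,j))" using ij by simp
    also have "\<dots> = (\<Sum>g\<in>?S. component g u $$ (i,j))"
      using u finite_support assms ij by (intro sum.mono_neutral_left) (auto simp: support_def)
    finally show "u $$ (i,j) = msum n (\<lambda>g. component g u) ?S $$ (i,j)" using ij by simp
  qed (use u assms in auto)
  show "v + w = msum n (\<lambda>g. component g v + component g w) ?S"
  proof (rule eq_matI)
    fix i j assume "i < dim_row (msum n (\<lambda>g. component g v + component g w) ?S)"
      "j < dim_col (msum n (\<lambda>g. component g v + component g w) ?S)"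
    then have ij: "i < n" "j < n" by auto
    have "v $$ (i,j) = (\<Sum>g\<in>?S. component g v $$ (i,j))" "w $$ (i,j) = (\<Sum>g\<in>?S. component g w $$ (i,j))"
      using arg_cong[OF ext[of v], of "\<lambda>M. M $$ (i,j)"] arg_cong[OF ext[of w], of "\<lambda>M. M $$ (i,j)"] ij by simp_all
    moreover have "(component g v + component g w) $$ (i,j) = component g v $$ (i,j) + component g w $$ (i,j)"
      if "g \<in> ?S" for g using U[of g] support_carrier that ij by auto
    ultimately show "(v + w) $$ (i,j) = msum n (\<lambda>g. component g v + component g w) ?S $$ (i,j)"
      using ij assms by (simp add: sum.distrib)
  qed (use assms in auto)
  show "\<And>g. g \<in> carrier G \<Longrightarrow> component g v + component g w \<in> \<Gamma> g"
    using component_\<Gamma> assms \<Gamma>_add by blast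
  show "component g v + component g w = 0\<^sub>m n n" if "g \<in> carrier G - ?S" for g
    using that by (auto simp: support_def)
qed (use assms finite_support support_carrier in auto)

lemma component_additive: "g \<in> carrier G \<Longrightarrow> UT_additive n (component g)"
  unfolding UT_additive_def using component_add component_\<Gamma> \<Gamma>_UT by blast

lemma component_mult_left:
  assumes h: "h \<in> carrier G" "x \<in> \<Gamma> h" and a: "a \<in> UT n" and g: "g \<in> carrier G"
  shows "component (h \<otimes>\<^bsub>G\<^esub> g) (x * a) = x * component g a"
proof -
  define c where "c = (\<lambda>k. x * component (inv\<^bsub>G\<^esub> h \<otimes>\<^bsub>G\<^esub> k) a)"
  have x: "x \<in> UT n" using h \<Gamma>_UT by blast
  have U: "component k a \<in> UT n" if "k \<in> carrier G" for k using component_\<Gamma>[OF a that] \<Gamma>_UT[OF that] by blast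
  have inv: "inv\<^bsub>G\<^esub> h \<otimes>\<^bsub>G\<^esub> (h \<otimes>\<^bsub>G\<^esub> k) = k" "h \<otimes>\<^bsub>G\<^esub> (inv\<^bsub>G\<^esub> h \<otimes>\<^bsub>G\<^esub> k) = k" if "k \<in> carrier G" for k
    using that h by (simp_all add: G.m_assoc[symmetric])
  have "component (h \<otimes>\<^bsub>G\<^esub> g) (x * a) = c (h \<otimes>\<^bsub>G\<^esub> g)"
  proof (rule component_eqI[where S = "(\<lambda>k. h \<otimes>\<^bsub>G\<^esub> k) ` support a"])
    show "c k \<in> \<Gamma> k" if k: "k \<in> carrier G" for k
    proof -
      have "inv\<^bsub>G\<^esub> h \<otimes>\<^bsub>G\<^esub> k \<in> carrier G" using h k by simp
      then show ?thesis unfolding c_def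
        using \<Gamma>_mult[OF h(1) _ h(2) component_\<Gamma>[OF a], of "inv\<^bsub>G\<^esub> h \<otimes>\<^bsub>G\<^esub> k"] inv(2)[OF k] by simp
    qed
    show "c k = 0\<^sub>m n n" if k: "k \<in> carrier G - (\<lambda>k. h \<otimes>\<^bsub>G\<^esub> k) ` support a" for k
    proof -
      have i: "inv\<^bsub>G\<^esub> h \<otimes>\<^bsub>G\<^esub> k \<in> carrier G" using h k by simp
      have "inv\<^bsub>G\<^esub> h \<otimes>\<^bsub>G\<^esub> k \<notin> support a" using k inv(2)[of k] by (metis DiffE image_eqI)
      then have "component (inv\<^bsub>G\<^esub> h \<otimes>\<^bsub>G\<^esub> k) a = 0\<^sub>m n n" using i by (simp add: support_def)
      then show ?thesis using UT_carrier[OF x] by (simp add: c_def)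
    qed
    have "x * a = x * msum n (\<lambda>k. component k a) (support a)" using sum_components[OF a] by simp
    also have "\<dots> = msum n (\<lambda>k. x * component k a) (support a)"
      using U support_carrier by (intro UT_additive_msum UT_additive_mult_left[OF x] finite_support[OF a]) blast
    also have "\<dots> = msum n c ((\<lambda>k. h \<otimes>\<^bsub>G\<^esub> k) ` support a)"
    proof -
      have "inj_on (\<lambda>k. h \<otimes>\<^bsub>G\<^esub> k) (support a)"
        by (rule inj_onI) (metis inv(1) support_carrier)
      then show ?thesis
        by (simp add: msum_def sum.reindex c_def inv support_carrier cong: sum.cong)
    qed
    finally show "x * a = msum n c ((\<lambda>k. h \<otimes>\<^bsub>G\<^esub> k) ` support a)" .
  qed (use h g a x finite_support support_carrier in auto)
  then show ?thesis using inv(1)[OF g] by (simp add: c_def)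
qed

lemma component_star:
  assumes a: "a \<in> UT n" and g: "g \<in> carrier G"
  shows "component g (star a) = star (component g a)"
proof (rule component_eqI[where S = "support a"])
  have "star a = star (msum n (\<lambda>k. component k a) (support a))" using sum_components[OF a] by simp
  also have "\<dots> = msum n (\<lambda>k. star (component k a)) (support a)"
    using component_\<Gamma>[OF a] \<Gamma>_UT support_carrier
    by (intro UT_additive_msum star_additive finite_support[OF a]) blast
  finally show "star a = msum n (\<lambda>k. star (component k a)) (support a)" .
  show "star (component k a) = 0\<^sub>m n n" if "k \<in> carrier G - support a" for k
    using that by (simp add: support_def)
qed (use a g star_\<Gamma> component_\<Gamma> finite_support support_carrier in auto)


subsection \<open>The Jacobson radical is graded\<close>

text \<open>
  The involution preserves degrees and reverses products: the nonzero element \<open>star (x * y)\<close> equals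
  \<open>star y * star x\<close>, so it has both degree \<open>h \<otimes>\<^bsub>G\<^esub> k\<close> and degree
  \<open>k \<otimes>\<^bsub>G\<^esub> h\<close>.
\<close>

lemma homogeneous_commute:
  assumes "h \<in> carrier G" "k \<in> carrier G" "x \<in> \<Gamma> h" "y \<in> \<Gamma> k" "x * y \<noteq> 0\<^sub>m n n"
  shows "h \<otimes>\<^bsub>G\<^esub> k = k \<otimes>\<^bsub>G\<^esub> h"
proof (rule ccontr)
  assume neq: "h \<otimes>\<^bsub>G\<^esub> k \<noteq> k \<otimes>\<^bsub>G\<^esub> h"
  have U: "x \<in> UT n" "y \<in> UT n" using assms \<Gamma>_UT by blast+
  have "star (x * y) \<in> \<Gamma> (h \<otimes>\<^bsub>G\<^esub> k)"
    using assms by (intro star_\<Gamma> \<Gamma>_mult) auto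
  moreover have "star (x * y) \<in> \<Gamma> (k \<otimes>\<^bsub>G\<^esub> h)"
    unfolding star_mult[OF U] using assms by (intro \<Gamma>_mult star_\<Gamma>) auto
  ultimately have "star (x * y) = 0\<^sub>m n n"
    using component_homogeneous[of "h \<otimes>\<^bsub>G\<^esub> k" "star (x * y)" "h \<otimes>\<^bsub>G\<^esub> k"]
      component_homogeneous[of "k \<otimes>\<^bsub>G\<^esub> h" "star (x * y)" "h \<otimes>\<^bsub>G\<^esub> k"] neq assms(1,2) by simp
  then show False using star_inj[of "x * y"] assms(5) U by simp
qed

text \<open>
  If both products are nonzero, they have the same degree; otherwise only one of them is left.
\<close>

lemma homogeneous_commutator:
  assumes h: "h \<in> carrier G" "x \<in> \<Gamma> h" and k: "k \<in> carrier G" "y \<in> \<Gamma> k"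
  shows "\<exists>g \<in> carrier G. x * y - y * x \<in> \<Gamma> g"
proof -
  have U: "x \<in> UT n" "y \<in> UT n" using assms \<Gamma>_UT by blast+
  have kh: "y * x \<in> \<Gamma> (k \<otimes>\<^bsub>G\<^esub> h)" "k \<otimes>\<^bsub>G\<^esub> h \<in> carrier G" using assms by (auto intro: \<Gamma>_mult)
  then have neg: "0\<^sub>m n n - y * x \<in> \<Gamma> (k \<otimes>\<^bsub>G\<^esub> h)" using \<Gamma>_uminus by blast
  show ?thesis
  proof (cases "x * y = 0\<^sub>m n n")
    case True
    then show ?thesis using neg kh(2) by auto
  next
    case False
    have "x * y \<in> \<Gamma> (k \<otimes>\<^bsub>G\<^esub> h)"
      using \<Gamma>_mult[OF h(1) k(1) h(2) k(2)] homogeneous_commute[OF h(1) k(1) h(2) k(2) False] by simp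
    moreover have "x * y - y * x = x * y + (0\<^sub>m n n - y * x)" using U by (intro eq_matI) auto
    ultimately show ?thesis using \<Gamma>_add[OF kh(2) _ neg] kh(2) by auto
  qed
qed

lemma commutator_JJ: 
  assumes "x \<in> UT n" "y \<in> UT n"
  shows "x * y - y * x \<in> JJ n 1"
proof -
  have U: "x * y \<in> UT n" "y * x \<in> UT n" using assms by simp_all
  have "(x * y - y * x) $$ (i,i) = 0" if "i < n" for i
    using UT_mult_diag[OF assms that] UT_mult_diag[OF assms(2,1) that] UT_minus_entry[OF U that that] 
    by (simp add: mult.commute)
  then show ?thesis using UT_minus[OF U] unfolding JJ_1 by blast
qed

text \<open>
  For a diagonal matrix \<open>d\<close> with pairwise different diagonal entries, the bracket of \<open>d\<close> and \<open>b\<close>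
  multiplies the entry of \<open>b\<close> at \<open>(i,j)\<close> by a nonzero difference whenever \<open>i \<noteq> j\<close>, so the equation
  can be solved for \<open>b\<close>. An infinite field provides such a \<open>d\<close> for every size.
\<close>

lemma JJ_1_commutator:
  fixes a :: "'f mat"
  assumes a: "a \<in> JJ n 1"
  shows "\<exists>d \<in> UT n. \<exists>b \<in> UT n. a = d * b - b * d"
proof -
  obtain f :: "nat \<Rightarrow> 'f" where f: "inj f" using infinite_countable_subset[OF infinite_field] by blast
  define d where "d = mat n n (\<lambda>(i,j). if i = j then f i else 0)"
  define b where "b = mat n n (\<lambda>(i,j). a $$ (i,j) / (f i - f j))"
  have d: "d \<in> UT n" by (auto simp: UT_def d_def)
  have b: "b \<in> UT n" using UT_lower[OF JJ_UT[OF a]] by (auto simp: UT_def b_def)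
  have "a = d * b - b * d"
  proof (rule UT_eqI[OF JJ_UT[OF a]])
    fix i j assume ij: "i \<le> j" "j < n"
    have "(d * b) $$ (i,j) = (\<Sum>s<n. d $$ (i,s) * b $$ (s,j))"
      by (rule mult_entry) (use ij d b UT_carrier in auto)
    also have "\<dots> = (\<Sum>s<n. if s = i then f i * b $$ (i,j) else 0)"
      using ij by (intro sum.cong) (auto simp: d_def)
    finally have 1: "(d * b) $$ (i,j) = f i * b $$ (i,j)" using ij by simp
    have "(b * d) $$ (i,j) = (\<Sum>s<n. b $$ (i,s) * d $$ (s,j))"
      by (rule mult_entry) (use ij d b UT_carrier in auto)
    also have "\<dots> = (\<Sum>s<n. if s = j then b $$ (i,j) * f j else 0)"
      using ij by (intro sum.cong) (auto simp: d_def)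
    finally have 2: "(b * d) $$ (i,j) = b $$ (i,j) * f j" using ij by simp
    have "(d * b - b * d) $$ (i,j) = (f i - f j) * b $$ (i,j)"
      using 1 2 ij UT_minus_entry[OF UT_mult[OF d b] UT_mult[OF b d], of i j] by (simp add: algebra_simps)
    also have "\<dots> = a $$ (i,j)"
    proof (cases "i = j")
      case True
      then show ?thesis using JJ_entry[OF a, of i j] ij by simp
    next
      case False
      then have "f i \<noteq> f j" using f by (meson injD)
      then show ?thesis using ij by (simp add: b_def)
    qed
    finally show "a $$ (i,j) = (d * b - b * d) $$ (i,j)" by simp
  qed (use d b in simp)
  then show ?thesis using d b by blast
qed

text \<open>
  Writing \<open>a\<close> as a commutator and expanding both arguments into homogeneous components turns \<open>a\<close> into a sum
  of commutators of homogeneous elements. Each of these is homogeneous and strictly triangular, and the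
  component of degree \<open>g\<close> collects those of degree \<open>g\<close>.
\<close>

lemma component_JJ_1:
  assumes a: "a \<in> JJ n 1" and g: "g \<in> carrier G"
  shows "component g a \<in> JJ n 1"
proof -
  obtain d b where db: "d \<in> UT n" "b \<in> UT n" "a = d * b - b * d" using JJ_1_commutator[OF a] by blast
  have U: "component h d \<in> UT n" "component h b \<in> UT n" if "h \<in> carrier G" for h
    using component_\<Gamma> db that \<Gamma>_UT by blast+
  have hom: "component g (component h d * component k b - component k b * component h d) \<in> JJ n 1"
    if hk: "h \<in> carrier G" "k \<in> carrier G" for h k
  proof -
    let ?z = "component h d * component k b - component k b * component h d"
    obtain l where "l \<in> carrier G" "?z \<in> \<Gamma> l"
      using homogeneous_commutator[OF hk(1) component_\<Gamma>[OF db(1) hk(1)] hk(2) component_\<Gamma>[OF db(2) hk(2)]] by blast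
    then have "component g ?z = ?z \<or> component g ?z = 0\<^sub>m n n"
      using component_homogeneous[of l ?z g] g by presburger
    then show ?thesis using commutator_JJ[OF U(1)[OF hk(1)] U(2)[OF hk(2)]] JJ_zero[of n 1] by metis
  qed
  have add1: "UT_additive n (\<lambda>x. component g (x * y - y * x))" if y: "y \<in> UT n" for y
    using UT_additive_minus[OF UT_additive_mult_right[OF y] UT_additive_mult_left[OF y]] component_additive[OF g]
    unfolding UT_additive_def by auto
  have add2: "UT_additive n (\<lambda>x. component g (y * x - x * y))" if y: "y \<in> UT n" for y
    using UT_additive_minus[OF UT_additive_mult_left[OF y] UT_additive_mult_right[OF y]] component_additive[OF g]
    unfolding UT_additive_def by auto
  have "component g (component h d * b - b * component h d) \<in> JJ n 1" if h: "h \<in> carrier G" for h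
  proof -
    let ?L = "\<lambda>x. component g (component h d * x - x * component h d)"
    have "?L b = ?L (msum n (\<lambda>k. component k b) (support b))" using sum_components[OF db(2)] by simp
    also have "\<dots> = msum n (\<lambda>k. ?L (component k b)) (support b)"
      by (rule UT_additive_msum[OF add2[OF U(1)[OF h]] finite_support[OF db(2)]]) (use U(2) support_carrier in blast)
    also have "\<dots> \<in> JJ n 1" by (rule JJ_msum) (use hom h support_carrier in blast)
    finally show ?thesis .
  qed note 1 = this
  let ?L = "\<lambda>x. component g (x * b - b * x)"
  have "?L d = ?L (msum n (\<lambda>k. component k d) (support d))" using sum_components[OF db(1)] by simp
  also have "\<dots> = msum n (\<lambda>k. ?L (component k d)) (support d)"
    by (rule UT_additive_msum[OF add1[OF db(2)] finite_support[OF db(1)]]) (use U(1) support_carrier in blast)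
  also have "\<dots> \<in> JJ n 1" by (rule JJ_msum) (use 1 support_carrier in blast)
  finally show ?thesis using db(3) by simp
qed

lemma star_JJ_1: "a \<in> JJ n 1 \<Longrightarrow> star a \<in> JJ n 1"
proof -
  assume "a \<in> JJ n 1"
  then obtain d b where db: "d \<in> UT n" "b \<in> UT n" "a = d * b - b * d" using JJ_1_commutator by blast
  have "star a = star (d * b) - star (b * d)"
  proof -
    have "star (d * b) = star (a + b * d)"
      using db by (intro arg_cong[of _ _ star] eq_matI) auto
    also have "\<dots> = star a + star (b * d)" using db by (intro star_add) auto
    finally show ?thesis using db by (intro UT_minus_self_add[of _ n]) auto
  qed
  also have "\<dots> = star b * star d - star d * star b" using db by (simp add: star_mult)
  also have "\<dots> \<in> JJ n 1" using db by (intro commutator_JJ) auto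
  finally show ?thesis .
qed

subsection \<open>Annihilator ideals\<close>

definition top_rows :: "nat \<Rightarrow> 'f mat set" where
  "top_rows k = {a \<in> UT n. \<forall>i<n. \<forall>j<n. k \<le> i \<longrightarrow> a $$ (i,j) = 0}"

definition last_cols :: "nat \<Rightarrow> 'f mat set" where
  "last_cols k = {a \<in> UT n. \<forall>i<n. \<forall>j<n. j < n - k \<longrightarrow> a $$ (i,j) = 0}"

text \<open>
  Thus \<open>top_rows k\<close> consists of the matrices annihilated by the \<open>k\<close>-th power of the radical from the left,
  and \<open>last_cols k\<close> of those annihilated from the right. In this description the two families are visibly
  compatible with the grading and exchanged by the involution, because the radical is graded and stable.
\<close>

lemma top_rows_Suc: "a \<in> top_rows (Suc k) \<longleftrightarrow> a \<in> UT n \<and> (\<forall>x \<in> JJ n 1. x * a \<in> top_rows k)"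
proof safe
  assume a: "a \<in> top_rows (Suc k)"
  then show "a \<in> UT n" by (simp add: top_rows_def)
  fix x :: "'f mat" assume x: "x \<in> JJ n 1"
  have "(x * a) $$ (i,j) = 0" if "i < n" "j < n" "k \<le> i" for i j
  proof -
    have "(x * a) $$ (i,j) = (\<Sum>s\<in>{s. i + 1 \<le> s \<and> s + 0 \<le> j}. x $$ (i,s) * a $$ (s,j))"
      by (rule JJ_mult_entry[OF x]) (use a that in \<open>auto simp: top_rows_def\<close>)
    also have "\<dots> = 0" by (rule sum.neutral) (use a that in \<open>auto simp: top_rows_def\<close>)
    finally show ?thesis .
  qed
  then show "x * a \<in> top_rows k" using a JJ_UT[OF x] by (auto simp: top_rows_def)
next
  assume a: "a \<in> UT n" "\<forall>x \<in> JJ n 1. x * a \<in> top_rows k"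
  have "a $$ (i,j) = 0" if "i < n" "j < n" "Suc k \<le> i" for i j
  proof -
    obtain i' where i': "i = Suc i'" using \<open>Suc k \<le> i\<close> by (cases i) auto
    have "(mat_unit n i' i :: 'f mat) \<in> JJ n 1" using i' that by (auto simp: JJ_def mat_unit_entry)
    then have "(mat_unit n i' i * a) $$ (i',j) = 0" using a that i' by (auto simp: top_rows_def)
    then show ?thesis using mat_unit_mult[OF UT_carrier[OF a(1)], of i i' j i'] that i' by simp
  qed
  then show "a \<in> top_rows (Suc k)" using a by (simp add: top_rows_def)
qed

lemma last_cols_Suc: "a \<in> last_cols (Suc k) \<longleftrightarrow> a \<in> UT n \<and> (\<forall>x \<in> JJ n 1. a * x \<in> last_cols k)"
proof safe
  assume a: "a \<in> last_cols (Suc k)"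
  then show "a \<in> UT n" by (simp add: last_cols_def)
  fix x :: "'f mat" assume x: "x \<in> JJ n 1"
  have "(a * x) $$ (i,j) = 0" if "i < n" "j < n" "j < n - k" for i j
  proof -
    have "(a * x) $$ (i,j) = (\<Sum>s\<in>{s. i + 0 \<le> s \<and> s + 1 \<le> j}. a $$ (i,s) * x $$ (s,j))"
      by (rule JJ_mult_entry[OF _ x]) (use a that in \<open>auto simp: last_cols_def\<close>)
    also have "\<dots> = 0" by (rule sum.neutral) (use a that in \<open>auto simp: last_cols_def\<close>)
    finally show ?thesis .
  qed
  then show "a * x \<in> last_cols k" using a JJ_UT[OF x] by (auto simp: last_cols_def)
next
  assume a: "a \<in> UT n" "\<forall>x \<in> JJ n 1. a * x \<in> last_cols k"
  have "a $$ (i,j) = 0" if "i < n" "j < n" "j < n - Suc k" for i j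
  proof -
    have j: "Suc j < n" "Suc j < n - k" using that by auto
    have "(mat_unit n j (Suc j) :: 'f mat) \<in> JJ n 1" using j that by (auto simp: JJ_def mat_unit_entry)
    then have "(a * mat_unit n j (Suc j)) $$ (i,Suc j) = 0" using a that j by (auto simp: last_cols_def)
    then show ?thesis using mult_mat_unit[OF UT_carrier[OF a(1)], of j i "Suc j" "Suc j"] that j by simp
  qed
  then show "a \<in> last_cols (Suc k)" using a by (simp add: last_cols_def)
qed

lemma top_rows_0: "a \<in> top_rows 0 \<longleftrightarrow> a = 0\<^sub>m n n" 
proof
  assume "a \<in> top_rows 0"
  then show "a = 0\<^sub>m n n" by (intro UT_eqI[of _ n]) (auto simp: top_rows_def)
qed (simp add: top_rows_def)

lemma last_cols_0: "a \<in> last_cols 0 \<longleftrightarrow> a = 0\<^sub>m n n"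
proof
  assume "a \<in> last_cols 0"
  then show "a = 0\<^sub>m n n" by (intro UT_eqI[of _ n]) (auto simp: last_cols_def)
qed (simp add: last_cols_def)

lemma star_top_rows: "a \<in> UT n \<Longrightarrow> star a \<in> last_cols k \<longleftrightarrow> a \<in> top_rows k"
proof (induction k arbitrary: a)
  case 0
  then show ?case using star_inj by (auto simp: top_rows_0 last_cols_0)
next
  case (Suc k)
  have "star a \<in> last_cols (Suc k) \<longleftrightarrow> (\<forall>x \<in> JJ n 1. star a * x \<in> last_cols k)"
    using Suc.prems by (simp add: last_cols_Suc)
  also have "\<dots> \<longleftrightarrow> (\<forall>x \<in> JJ n 1. star a * star x \<in> last_cols k)"
    using star_JJ_1 JJ_UT star_star by metis
  also have "\<dots> \<longleftrightarrow> (\<forall>x \<in> JJ n 1. x * a \<in> top_rows k)"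
  proof (rule ball_cong[OF refl])
    fix x :: "'f mat" assume "x \<in> JJ n 1"
    then have "x \<in> UT n" by (rule JJ_UT)
    then show "star a * star x \<in> last_cols k \<longleftrightarrow> x * a \<in> top_rows k"
      using Suc.IH[of "x * a"] Suc.prems by (simp add: star_mult)
  qed
  also have "\<dots> \<longleftrightarrow> a \<in> top_rows (Suc k)" using Suc.prems by (simp add: top_rows_Suc)
  finally show ?case .
qed

lemma star_last_cols: "a \<in> UT n \<Longrightarrow> star a \<in> top_rows k \<longleftrightarrow> a \<in> last_cols k"
  using star_top_rows[of "star a" k] by simp

lemma top_rows_msum: "(\<And>s. s \<in> S \<Longrightarrow> f s \<in> top_rows k) \<Longrightarrow> msum n f S \<in> top_rows k"
  by (auto simp: top_rows_def intro!: msum_UT sum.neutral)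

lemma component_top_rows: "a \<in> top_rows k \<Longrightarrow> g \<in> carrier G \<Longrightarrow> component g a \<in> top_rows k"
proof (induction k arbitrary: a g)
  case 0
  then show ?case using UT_additive_zero[OF component_additive] by (simp add: top_rows_0)
next
  case (Suc k)
  have a: "a \<in> UT n" "\<And>x. x \<in> JJ n 1 \<Longrightarrow> x * a \<in> top_rows k" using Suc.prems(1) by (simp_all add: top_rows_Suc)
  have c: "component g a \<in> UT n" using component_\<Gamma>[OF a(1) Suc.prems(2)] \<Gamma>_UT Suc.prems(2) by blast
  have "x * component g a \<in> top_rows k" if x: "x \<in> JJ n 1" for x
  proof -
    have xU: "x \<in> UT n" using x by (rule JJ_UT)
    have "component h x * component g a \<in> top_rows k" if h: "h \<in> carrier G" for h
      unfolding component_mult_left[OF h component_\<Gamma>[OF xU h] a(1) Suc.prems(2), symmetric]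
      using Suc.prems h by (intro Suc.IH a(2) component_JJ_1 x) auto
    then have "msum n (\<lambda>h. component h x * component g a) (support x) \<in> top_rows k"
      using support_carrier by (intro top_rows_msum) blast
    moreover have "x * component g a = msum n (\<lambda>h. component h x * component g a) (support x)"
    proof -
      have "x * component g a = msum n (\<lambda>h. component h x) (support x) * component g a"
        using sum_components[OF xU] by simp
      also have "\<dots> = msum n (\<lambda>h. component h x * component g a) (support x)"
        by (rule UT_additive_msum[OF UT_additive_mult_right[OF c] finite_support[OF xU]])
          (use component_\<Gamma>[OF xU] \<Gamma>_UT support_carrier in blast)
      finally show ?thesis .
    qed
    ultimately show ?thesis by simp
  qed
  then show ?case using c by (simp add: top_rows_Suc)
qed

lemma component_last_cols: 
  assumes "a \<in> last_cols k" "g \<in> carrier G" 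
  shows "component g a \<in> last_cols k"
proof -
  have a: "a \<in> UT n" using assms by (simp add: last_cols_def)
  have c: "component g a \<in> UT n" using component_\<Gamma>[OF a assms(2)] \<Gamma>_UT assms(2) by blast
  have "star a \<in> top_rows k" using star_last_cols[OF a] assms by simp
  then have "star (component g a) \<in> top_rows k"
    using component_top_rows[OF _ assms(2)] component_star[OF a assms(2)] by metis
  then show ?thesis using star_last_cols[OF c] by simp
qed

lemma corner_ideal_eq: 
  assumes "l \<le> n"
  shows "corner_ideal n k l = top_rows (Suc k) \<inter> last_cols (n - l)"
proof -
  have "n - (n - l) = l" using assms by simp
  moreover have "(\<forall>i<n. \<forall>j<n. a $$ (i,j) \<noteq> 0 \<longrightarrow> i \<le> k \<and> l \<le> j) \<longleftrightarrow>
      (\<forall>i<n. \<forall>j<n. Suc k \<le> i \<longrightarrow> a $$ (i,j) = 0) \<and> (\<forall>i<n. \<forall>j<n. j < l \<longrightarrow> a $$ (i,j) = 0)" for a :: "'f mat"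
  proof -
    have "(x \<noteq> 0 \<longrightarrow> i \<le> k \<and> l \<le> j) \<longleftrightarrow> (Suc k \<le> i \<longrightarrow> x = 0) \<and> (j < l \<longrightarrow> x = 0)" for x :: 'f and i j
      by (simp add: not_le[symmetric] Suc_le_eq) blast
    then show ?thesis by blast
  qed
  ultimately show ?thesis unfolding corner_ideal_def top_rows_def last_cols_def by simp blast
qed

lemma component_corner_ideal: "a \<in> corner_ideal n k l \<Longrightarrow> l \<le> n \<Longrightarrow> g \<in> carrier G \<Longrightarrow> component g a \<in> corner_ideal n k l"
  by (simp add: corner_ideal_eq component_top_rows component_last_cols)

text \<open>
  The corner ideals are intersections of the two kinds of annihilators, which the involution exchanges: the pair
  \<open>(k,l)\<close> is reflected at the antidiagonal.
\<close>

lemma star_corner_ideal: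
  assumes "a \<in> corner_ideal n k l" "k < n" "l < n"
  shows "star a \<in> corner_ideal n (n - 1 - l) (n - 1 - k)"
proof -
  have a: "a \<in> UT n" using assms corner_ideal_UT by blast
  have "a \<in> top_rows (Suc k)" "a \<in> last_cols (n - l)" using assms corner_ideal_eq[of l k] by auto
  then have "star a \<in> last_cols (Suc k)" "star a \<in> top_rows (n - l)"
    using star_top_rows[OF a] star_last_cols[OF a] by auto
  moreover have e: "Suc (n - 1 - l) = n - l" "n - (n - 1 - k) = Suc k" using assms by auto
  have "corner_ideal n (n - 1 - l) (n - 1 - k) = top_rows (n - l) \<inter> last_cols (Suc k)"
    using corner_ideal_eq[of "n - 1 - k" "n - 1 - l"] unfolding e by simp
  ultimately show ?thesis by blast
qed

end

section \<open>A homogeneous basis\<close>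

definition labels :: "nat \<Rightarrow> (nat \<times> nat) set" where
  "labels n = {(k,l). k \<le> l \<and> l < n}"

lemma finite_labels [simp]: "finite (labels n)"
  by (rule finite_subset[of _ "{..<n} \<times> {..<n}"]) (auto simp: labels_def)

lemma JJ_1D: "A \<in> JJ n (Suc 0) \<Longrightarrow> i < n \<Longrightarrow> A $$ (i,i) = 0"
  using JJ_1[of A n] by simp

lemma JJ_1I: "A \<in> UT n \<Longrightarrow> (\<And>i. i < n \<Longrightarrow> A $$ (i,i) = 0) \<Longrightarrow> A \<in> JJ n (Suc 0)"
  using JJ_1[of A n] by simp

lemma corner_ideal_smult: "A \<in> corner_ideal n k l \<Longrightarrow> c \<cdot>\<^sub>m A \<in> corner_ideal n k l"
  by (auto simp: corner_ideal_def)

lemma mat_unit_corner_ideal: "k \<le> l \<Longrightarrow> mat_unit n k l \<in> corner_ideal n k l"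
  by (auto simp: corner_ideal_def mat_unit_entry split: if_splits)

lemma corner_ideal_diag: "A \<in> corner_ideal n k k \<Longrightarrow> i < n \<Longrightarrow> i \<noteq> k \<Longrightarrow> A $$ (i,i) = 0"
  using corner_idealD[of A n k k i i] by force

lemma corner_ideal_superdiag: "A \<in> corner_ideal n k (Suc k) \<Longrightarrow> Suc i < n \<Longrightarrow> i \<noteq> k \<Longrightarrow> A $$ (i, Suc i) = 0"
  using corner_idealD[of A n k "Suc k" i "Suc i"] by force

lemma UT_diff_add: "A \<in> UT n \<Longrightarrow> B \<in> UT n \<Longrightarrow> A = (A - B) + B"
  by (rule UT_eqI[of _ n]) (auto simp: UT_minus_entry)

context graded_star_UT begin

text \<open>
  All homogeneous components of the matrix unit at \<open>(k,l)\<close> stay in its corner ideal, and they add up to a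
  matrix with entry 1 at \<open>(k,l)\<close>. One of them therefore has a nonzero entry there and can be rescaled.
\<close>

lemma homogeneous_corner_element:
  assumes "k \<le> l" "l < n"
  shows "\<exists>g \<in> carrier G. \<exists>b \<in> \<Gamma> g. b \<in> corner_ideal n k l \<and> b $$ (k,l) = 1"
proof -
  let ?e = "mat_unit n k l :: 'f mat"
  have e: "?e \<in> UT n" using assms by simp
  have "1 = msum n (\<lambda>g. component g ?e) (support ?e) $$ (k,l)"
    using sum_components[OF e] assms by (simp add: mat_unit_entry)
  also have "\<dots> = (\<Sum>g\<in>support ?e. component g ?e $$ (k,l))" using assms by simp
  finally have "(\<Sum>g\<in>support ?e. component g ?e $$ (k,l)) \<noteq> 0" by simp
  then obtain g where g: "g \<in> support ?e" "component g ?e $$ (k,l) \<noteq> 0"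
    using sum.not_neutral_contains_not_neutral by blast
  have gG: "g \<in> carrier G" using g support_carrier by blast
  define b where "b = inverse (component g ?e $$ (k,l)) \<cdot>\<^sub>m component g ?e"
  have c: "component g ?e \<in> corner_ideal n k l"
    using assms by (intro component_corner_ideal mat_unit_corner_ideal gG) auto
  have "b \<in> \<Gamma> g" unfolding b_def by (intro \<Gamma>_smult component_\<Gamma> gG e)
  moreover have "b \<in> corner_ideal n k l" unfolding b_def by (rule corner_ideal_smult[OF c])
  moreover have "b $$ (k,l) = 1" using g assms UT_dims[OF corner_ideal_UT[OF c]] by (simp add: b_def)
  ultimately show ?thesis using gG by blast
qed

definition basis_pair :: "nat \<times> nat \<Rightarrow> 'g \<times> 'f mat" where
  "basis_pair p = (SOME q. fst q \<in> carrier G \<and> snd q \<in> \<Gamma> (fst q) \<and>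
     snd q \<in> corner_ideal n (fst p) (snd p) \<and> snd q $$ p = 1)"

definition label_deg :: "nat \<times> nat \<Rightarrow> 'g" where "label_deg p = fst (basis_pair p)"
definition hbasis :: "nat \<times> nat \<Rightarrow> 'f mat" where "hbasis p = snd (basis_pair p)"

lemma
  assumes "p \<in> labels n"
  shows label_deg: "label_deg p \<in> carrier G" and hbasis_\<Gamma>: "hbasis p \<in> \<Gamma> (label_deg p)"
    and hbasis_corner: "hbasis p \<in> corner_ideal n (fst p) (snd p)"
    and hbasis_entry: "hbasis p $$ p = 1"
proof -
  obtain k l where p: "p = (k,l)" "k \<le> l" "l < n" using assms by (auto simp: labels_def)
  have "\<exists>q. fst q \<in> carrier G \<and> snd q \<in> \<Gamma> (fst q) \<and> snd q \<in> corner_ideal n (fst p) (snd p) \<and> snd q $$ p = 1"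
    using homogeneous_corner_element[OF p(2,3)] p(1) by force
  from someI_ex[OF this] show "label_deg p \<in> carrier G" "hbasis p \<in> \<Gamma> (label_deg p)"
    "hbasis p \<in> corner_ideal n (fst p) (snd p)" "hbasis p $$ p = 1"
    unfolding label_deg_def hbasis_def basis_pair_def by auto
qed

lemma hbasis_UT: "p \<in> labels n \<Longrightarrow> hbasis p \<in> UT n"
  using hbasis_corner corner_ideal_UT by blast

lemma hbasis_diag: "k < n \<Longrightarrow> i < n \<Longrightarrow> hbasis (k,k) $$ (i,i) = (if i = k then 1 else 0)"
  using hbasis_entry[of "(k,k)"] hbasis_corner[of "(k,k)"] corner_ideal_diag[of "hbasis (k,k)" n k i]
  by (auto simp: labels_def)

text \<open>
  If the degree \<open>h\<close> of the basis element \<open>b\<close> differed from its square, then \<open>b * b\<close> would be the component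
  of degree \<open>h \<otimes>\<^bsub>G\<^esub> h\<close> of the strictly triangular matrix \<open>b * b - b\<close>, hence strictly
  triangular itself, although its diagonal entry at \<open>(k,k)\<close> is 1.
\<close>

lemma label_deg_diag:
  assumes "k < n"
  shows "label_deg (k,k) = \<one>\<^bsub>G\<^esub>"
proof (rule ccontr)
  let ?b = "hbasis (k,k)" and ?h = "label_deg (k,k)"
  have k: "(k,k) \<in> labels n" using assms by (simp add: labels_def)
  have h: "?h \<in> carrier G" "?h \<otimes>\<^bsub>G\<^esub> ?h \<in> carrier G" using label_deg[OF k] by simp_all
  assume "?h \<noteq> \<one>\<^bsub>G\<^esub>"
  then have neq: "?h \<otimes>\<^bsub>G\<^esub> ?h \<noteq> ?h" using h by (metis G.r_cancel_one)
  have U: "?b \<in> UT n" "?b * ?b \<in> UT n" using hbasis_UT[OF k] by simp_all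
  have bb: "?b * ?b \<in> \<Gamma> (?h \<otimes>\<^bsub>G\<^esub> ?h)" using \<Gamma>_mult h hbasis_\<Gamma>[OF k] by blast
  define z where "z = ?b * ?b - ?b"
  have zU: "z \<in> UT n" unfolding z_def using U by simp
  have z: "z \<in> JJ n (Suc 0)"
  proof (rule JJ_1I[OF zU])
    fix i assume i: "i < n"
    show "z $$ (i,i) = 0"
      unfolding z_def UT_minus_entry[OF U(2,1) i i] UT_mult_diag[OF U(1) U(1) i] hbasis_diag[OF assms i] by simp
  qed
  have "?b * ?b = z + ?b" unfolding z_def by (rule UT_diff_add[OF U(2,1)])
  then have "component (?h \<otimes>\<^bsub>G\<^esub> ?h) (?b * ?b) = component (?h \<otimes>\<^bsub>G\<^esub> ?h) z + component (?h \<otimes>\<^bsub>G\<^esub> ?h) ?b"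
    using component_add[OF zU U(1) h(2)] by simp
  then have "?b * ?b = component (?h \<otimes>\<^bsub>G\<^esub> ?h) z + 0\<^sub>m n n"
    using component_homogeneous[OF h(2) bb h(2)] component_homogeneous[OF h(1) hbasis_\<Gamma>[OF k] h(2)] neq by simp
  moreover have cz: "component (?h \<otimes>\<^bsub>G\<^esub> ?h) z \<in> JJ n (Suc 0)" using component_JJ_1[of z] z h(2) by simp
  ultimately have "(?b * ?b) $$ (k,k) = 0" using assms JJ_1D[OF cz] by simp
  then show False using UT_mult_diag[OF U(1) U(1) assms] hbasis_diag[OF assms assms] by simp
qed

text \<open>
  One diagonal is removed at a time: on the diagonal of offset \<open>d\<close> only the basis elements with labels on that
  diagonal contribute, and there they agree with the matrix units. Their other entries lie on diagonals of larger
  offset and are left to the induction.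
\<close>

lemma JJ_expansion:
  fixes a :: "'f mat"
  assumes "a \<in> JJ n d"
  shows "\<exists>c. a = msum n (\<lambda>p. c p \<cdot>\<^sub>m hbasis p) (labels n)"
  using assms
proof (induction "n - d" arbitrary: d a)
  case 0
  then have "a = 0\<^sub>m n n" using JJ_eq_zero by auto
  moreover have "msum n (\<lambda>p. 0 \<cdot>\<^sub>m hbasis p) (labels n) = (0\<^sub>m n n :: 'f mat)"
    by (rule UT_eqI[of _ n]) (auto intro!: msum_UT sum.neutral simp: hbasis_UT UT_dims[OF hbasis_UT])
  ultimately show ?case by (intro exI[of _ "\<lambda>p. 0"]) simp
next
  case (Suc m)
  then have d: "d < n" by simp
  define c where "c = (\<lambda>p. if snd p = fst p + d then a $$ p else 0)"
  define s where "s = msum n (\<lambda>p. c p \<cdot>\<^sub>m hbasis p) (labels n)"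
  have sU: "s \<in> UT n" unfolding s_def by (rule msum_UT) (simp add: hbasis_UT)
  have aU: "a \<in> UT n" using Suc.prems by (rule JJ_UT)
  have entry: "s $$ (i,j) = a $$ (i,j)" if ij: "i < n" "j < n" "j < i + Suc d" for i j
  proof -
    have "s $$ (i,j) = (\<Sum>p\<in>labels n. c p * hbasis p $$ (i,j))"
      unfolding s_def using ij by (auto intro!: sum.cong simp: UT_dims[OF hbasis_UT])
    also have "\<dots> = (\<Sum>p\<in>labels n. if p = (i,j) then a $$ (i,j) else 0)"
    proof (rule sum.cong[OF refl])
      fix p assume p: "p \<in> labels n"
      obtain k l where kl: "p = (k,l)" by (cases p)
      show "c p * hbasis p $$ (i,j) = (if p = (i,j) then a $$ (i,j) else 0)"
      proof (cases "p = (i,j)")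
        case True
        then have "a $$ (i,j) = 0" if "j \<noteq> i + d"
          using JJ_entry[OF Suc.prems ij(1,2)] that ij(3) by simp
        then show ?thesis using True hbasis_entry[OF p] by (auto simp: c_def)
      next
        case False
        have "hbasis p $$ (i,j) = 0" if "l = k + d"
        proof (rule ccontr)
          assume "hbasis p $$ (i,j) \<noteq> 0"
          then have "i \<le> k \<and> l \<le> j" using corner_idealD[OF hbasis_corner[OF p] ij(1,2)] kl by simp
          then show False using ij(3) that False kl by auto
        qed
        then show ?thesis using False kl by (auto simp: c_def)
      qed
    qed
    also have "\<dots> = a $$ (i,j)"
    proof (cases "(i,j) \<in> labels n")
      case True
      then show ?thesis by simp
    next
      case False
      then have "a $$ (i,j) = 0" using UT_lower[OF aU, of j i] ij by (auto simp: labels_def)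
      then show ?thesis by simp
    qed
    finally show ?thesis .
  qed
  have as: "a - s \<in> JJ n (Suc d)"
    using aU sU entry UT_minus[OF aU sU] unfolding JJ_def by (auto simp: UT_minus_entry)
  have "m = n - Suc d" using Suc.hyps(2) by simp
  then obtain c' where c': "a - s = msum n (\<lambda>p. c' p \<cdot>\<^sub>m hbasis p) (labels n)"
    using Suc.hyps(1) as by blast
  have "a = (a - s) + s" by (rule UT_diff_add[OF aU sU])
  also have "\<dots> = msum n (\<lambda>p. (c' p + c p) \<cdot>\<^sub>m hbasis p) (labels n)"
    unfolding c' unfolding s_def
  proof (rule UT_eqI[of _ n])
    fix i j assume ij: "i \<le> j" "j < n"
    have e: "(x \<cdot>\<^sub>m hbasis p) $$ (i,j) = x * hbasis p $$ (i,j)" if "p \<in> labels n" for p x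
      using ij UT_dims[OF hbasis_UT[OF that]] by simp
    show "(msum n (\<lambda>p. c' p \<cdot>\<^sub>m hbasis p) (labels n) + msum n (\<lambda>p. c p \<cdot>\<^sub>m hbasis p) (labels n)) $$ (i,j) =
        msum n (\<lambda>p. (c' p + c p) \<cdot>\<^sub>m hbasis p) (labels n) $$ (i,j)"
      using ij by (simp add: e distrib_right sum.distrib cong: sum.cong)
  qed (intro UT_add msum_UT UT_smult hbasis_UT; assumption)+
  finally show ?case by (rule exI[of _ "\<lambda>p. c' p + c p"])
qed

text \<open>
  A graded substitution gives each variable a value in every degree, so a basis element is continued by zero to
  the degrees other than its own.
\<close>

definition homogeneous_unit :: "nat \<times> nat \<Rightarrow> 'g \<Rightarrow> 'f mat" where
  "homogeneous_unit p g = (if g = label_deg p then hbasis p else 0\<^sub>m n n)"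

lemma homogeneous_unit_\<Gamma>: "p \<in> labels n \<Longrightarrow> g \<in> carrier G \<Longrightarrow> homogeneous_unit p g \<in> \<Gamma> g"
  by (simp add: homogeneous_unit_def hbasis_\<Gamma> \<Gamma>_zero)

text \<open>
  The projection to degree \<open>g\<close> applied to an expansion of \<open>a\<close> keeps exactly the basis elements of
  degree \<open>g\<close>.
\<close>

lemma homogeneous_expansion:
  assumes g: "g \<in> carrier G" and a: "a \<in> \<Gamma> g"
  shows "\<exists>c. a = msum n (\<lambda>p. c p \<cdot>\<^sub>m homogeneous_unit p g) (labels n)"
proof -
  obtain c where c: "a = msum n (\<lambda>p. c p \<cdot>\<^sub>m hbasis p) (labels n)"
    using JJ_expansion[of a 0] \<Gamma>_UT[OF g a] by auto
  have "a = component g a" using component_homogeneous[OF g a g] by simp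
  also have "\<dots> = component g (msum n (\<lambda>p. c p \<cdot>\<^sub>m hbasis p) (labels n))" using c by simp
  also have "\<dots> = msum n (\<lambda>p. component g (c p \<cdot>\<^sub>m hbasis p)) (labels n)"
    by (rule UT_additive_msum[OF component_additive[OF g]]) (simp_all add: hbasis_UT)
  also have "\<dots> = msum n (\<lambda>p. c p \<cdot>\<^sub>m homogeneous_unit p g) (labels n)"
  proof (rule msum_cong[OF refl])
    fix p assume p: "p \<in> labels n"
    have "component g (c p \<cdot>\<^sub>m hbasis p) = (if g = label_deg p then c p \<cdot>\<^sub>m hbasis p else 0\<^sub>m n n)"
      by (rule component_homogeneous[OF label_deg[OF p] \<Gamma>_smult[OF label_deg[OF p] hbasis_\<Gamma>[OF p]] g])
    then show "component g (c p \<cdot>\<^sub>m hbasis p) = c p \<cdot>\<^sub>m homogeneous_unit p g"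
      by (auto simp: homogeneous_unit_def)
  qed
  finally show ?thesis by blast
qed

subsection \<open>Shape of the involution\<close>

text \<open>
  Multiplying \<open>x\<close> by the diagonal matrix units for \<open>l\<close> and \<open>Suc l\<close> from both sides isolates its entry at
  \<open>(l, Suc l)\<close>. The involution turns this product into one whose three factors lie in corner ideals that meet
  only at the reflected entry of \<open>star x\<close>; if that entry were zero, the product would vanish, and so would its
  preimage.
\<close>

lemma star_superdiag:
  assumes l: "Suc l < n" and x: "x \<in> corner_ideal n l (Suc l)" "x $$ (l, Suc l) \<noteq> 0"
  shows "star x $$ (n - 2 - l, Suc (n - 2 - l)) \<noteq> 0"
proof
  define k where "k = n - 2 - l"
  have k: "Suc k < n" "n - 1 - Suc l = k" "n - 1 - l = Suc k" using l by (auto simp: k_def)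
  assume "star x $$ (n - 2 - l, Suc (n - 2 - l)) = 0"
  then have y0: "star x $$ (k, Suc k) = 0" by (simp add: k_def)
  let ?e1 = "mat_unit n l l :: 'f mat" and ?e2 = "mat_unit n (Suc l) (Suc l) :: 'f mat"
  have xU: "x \<in> UT n" using x corner_ideal_UT by blast
  have U: "?e1 \<in> UT n" "?e2 \<in> UT n" "star ?e1 \<in> UT n" "star ?e2 \<in> UT n" "star x \<in> UT n" using xU by simp_all
  have yc: "star x \<in> corner_ideal n k (Suc k)"
    using star_corner_ideal[OF x(1)] l unfolding k(2,3) by (simp only: Suc_lessD)
  have f1: "star ?e1 \<in> corner_ideal n (Suc k) (Suc k)"
    using star_corner_ideal[OF mat_unit_corner_ideal[of l l n]] l unfolding k(2,3) by (simp only: Suc_lessD order_refl)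
  have f2: "star ?e2 \<in> corner_ideal n k k"
    using star_corner_ideal[OF mat_unit_corner_ideal[of "Suc l" "Suc l" n]] l unfolding k(2,3) by (simp only: order_refl)
  have yf: "(star x * star ?e1) $$ (s,j) = 0" if "s < n" "j < n" "k \<le> s" for s j
  proof -
    have "star x $$ (s,t) * star ?e1 $$ (t,j) = 0" if t: "t < n" for t
    proof (rule ccontr)
      assume "\<not> ?thesis"
      then have nz: "star x $$ (s,t) \<noteq> 0" "star ?e1 $$ (t,j) \<noteq> 0" by auto
      then have "s \<le> k" "Suc k \<le> t" "t \<le> Suc k"
        using corner_idealD[OF yc \<open>s < n\<close> t] corner_idealD[OF f1 t \<open>j < n\<close>] by auto
      then have "s = k" "t = Suc k" using \<open>k \<le> s\<close> by auto
      then show False using nz(1) y0 by simp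
    qed
    then show ?thesis
      unfolding mult_entry[OF UT_carrier[OF U(5)] UT_carrier[OF U(3)] that(1,2)] 
      by (intro sum.neutral ballI) (simp only: lessThan_iff)
  qed
  have "star ?e2 * (star x * star ?e1) = 0\<^sub>m n n"
  proof (rule UT_eqI[of _ n])
    fix i j assume ij: "i \<le> j" "j < n"
    have "star ?e2 $$ (i,s) * (star x * star ?e1) $$ (s,j) = 0" if s: "s < n" for s
    proof (cases "k \<le> s")
      case True
      then show ?thesis using yf[OF s ij(2)] by simp
    next
      case False
      then have "star ?e2 $$ (i,s) = 0" using corner_idealD[OF f2, of i s] ij s by linarith
      then show ?thesis by simp
    qed
    then have "(\<Sum>s<n. star ?e2 $$ (i,s) * (star x * star ?e1) $$ (s,j)) = 0"
      by (intro sum.neutral ballI) (simp only: lessThan_iff)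
    then show "(star ?e2 * (star x * star ?e1)) $$ (i,j) = 0\<^sub>m n n $$ (i,j)"
      using mult_entry[OF UT_carrier[OF U(4)] UT_carrier[OF UT_mult[OF U(5,3)]], of i j] ij
      by (simp del: index_mult_mat(1))
  qed (use U in simp_all)
  moreover have "star ?e2 * (star x * star ?e1) = star ((?e1 * x) * ?e2)"
    using U xU by (simp add: star_mult)
  ultimately have "(?e1 * x) * ?e2 = 0\<^sub>m n n"
    using star_inj[OF UT_mult[OF UT_mult[OF U(1) xU] U(2)]] by metis
  moreover have "((?e1 * x) * ?e2) $$ (l, Suc l) = (?e1 * x) $$ (l, Suc l)"
    using mult_mat_unit[OF UT_carrier[OF UT_mult[OF U(1) xU]] l Suc_lessD[OF l] l, of "Suc l"] by (simp only: if_True refl)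
  moreover have "(?e1 * x) $$ (l, Suc l) = x $$ (l, Suc l)"
    using mat_unit_mult[OF UT_carrier[OF xU] Suc_lessD[OF l] Suc_lessD[OF l] l, of l] by (simp only: if_True refl)
  moreover have "(0\<^sub>m n n :: 'f mat) $$ (l, Suc l) = 0" using l by simp
  ultimately show False using x(2) by metis
qed

text \<open>
  Homogeneous of degree one and idempotent modulo the radical, with diagonal entries 0 before position \<open>k\<close> and 1
  from there on. The difference of two consecutive diagonal entries is nonzero only at the step to \<open>k\<close>; this
  is how an evaluation of a commutator recognizes \<open>k\<close>.
\<close>

definition tail_idempotent :: "nat \<Rightarrow> 'f mat" where
  "tail_idempotent k = msum n (\<lambda>i. hbasis (i,i)) {k..<n}"

lemma tail_idempotent_UT [simp]: "tail_idempotent k \<in> UT n"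
  unfolding tail_idempotent_def by (rule msum_UT) (simp add: hbasis_UT labels_def)

lemma tail_idempotent_\<Gamma>: "tail_idempotent k \<in> \<Gamma> \<one>\<^bsub>G\<^esub>"
proof -
  have *: "msum n (\<lambda>i. hbasis (i,i)) S \<in> \<Gamma> \<one>\<^bsub>G\<^esub>" if "finite S" "S \<subseteq> {..<n}" for S
    using that
  proof (induction S rule: finite_induct)
    case empty
    then show ?case by (simp add: \<Gamma>_zero)
  next
    case (insert i S)
    then have i: "(i,i) \<in> labels n" "i < n" by (auto simp: labels_def)
    then have "hbasis (i,i) \<in> \<Gamma> \<one>\<^bsub>G\<^esub>" using hbasis_\<Gamma>[OF i(1)] label_deg_diag[OF i(2)] by simp
    then show ?case using insert i by (simp add: msum_insert hbasis_UT \<Gamma>_add)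
  qed
  show ?thesis unfolding tail_idempotent_def by (rule *) auto
qed

lemma tail_idempotent_diag:
  assumes "j < n"
  shows "tail_idempotent k $$ (j,j) = (if k \<le> j then 1 else 0)"
proof -
  have "tail_idempotent k $$ (j,j) = (\<Sum>i\<in>{k..<n}. if j = i then 1 else 0)"
    unfolding tail_idempotent_def msum_entry[OF assms assms] using assms by (intro sum.cong refl) (simp add: hbasis_diag)
  also have "\<dots> = (if k \<le> j then 1 else 0)" using assms by simp
  finally show ?thesis .
qed

end

section \<open>Multilinear polynomials\<close>

lemma poly_mapping_sum_singles:
  "p = (\<Sum>w\<in>Poly_Mapping.keys p. Poly_Mapping.single w (Poly_Mapping.lookup p w))"
  by (rule poly_mapping_eqI)
    (auto simp: lookup_sum lookup_single when_def in_keys_iff sum.delta)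

lemma map_times: "Poly_Mapping.map ((*) c) p = Poly_Mapping.single 0 c * p"
  for p :: "'x word \<Rightarrow>\<^sub>0 'f :: field"
  by (rule mult_map_scale_conv_mult)

lemma lookup_map_times: "Poly_Mapping.lookup (Poly_Mapping.map ((*) c) p) w = c * Poly_Mapping.lookup p w"
  for p :: "'x \<Rightarrow>\<^sub>0 'f :: field"
  by (auto simp: map.rep_eq when_def)

lemma keys_map_times: "Poly_Mapping.keys (Poly_Mapping.map ((*) c) p) \<subseteq> Poly_Mapping.keys p"
  for p :: "'x \<Rightarrow>\<^sub>0 'f :: field"
  by (auto simp: in_keys_iff lookup_map_times)

lemma single_map_times: "Poly_Mapping.single w c = Poly_Mapping.map ((*) c) (Poly_Mapping.single w 1)"
  for c :: "'f :: field"
  by simp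

text \<open>
  For \<open>S = {..<m}\<close> these are the words of the monomials that span the multilinear polynomials. An arbitrary
  set of indices makes products of polynomials in disjoint sets of variables multilinear again.
\<close>

definition multilinear_word :: "('g, 'r) monoid_scheme \<Rightarrow> nat set \<Rightarrow> 'g letter word \<Rightarrow> bool" where
  "multilinear_word G S w \<longleftrightarrow> distinct (map idx (letters w)) \<and> idx ` set (letters w) = S \<and>
     deg ` set (letters w) \<subseteq> carrier G"

definition multilinear_on :: "('g, 'r) monoid_scheme \<Rightarrow> nat set \<Rightarrow> ('g letter word \<Rightarrow>\<^sub>0 'f :: field) set" where
  "multilinear_on G S = {p. \<forall>w \<in> Poly_Mapping.keys p. multilinear_word G S w}"

lemma multilinear_on_carrier: "p \<in> multilinear_on G S \<Longrightarrow> p \<in> carrier (free_algebra G)"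
  by (fastforce simp: multilinear_on_def multilinear_word_def free_algebra_def)

lemma multilinear_on_zero: "0 \<in> multilinear_on G S"
  by (simp add: multilinear_on_def)

lemma multilinear_on_add: "p \<in> multilinear_on G S \<Longrightarrow> q \<in> multilinear_on G S \<Longrightarrow> p + q \<in> multilinear_on G S"
  using Poly_Mapping.keys_add[of p q] by (fastforce simp: multilinear_on_def)

lemma multilinear_on_minus: 
  "p \<in> multilinear_on G S \<Longrightarrow> q \<in> multilinear_on G S \<Longrightarrow> p - q \<in> multilinear_on G S"
proof -
  have "Poly_Mapping.keys (p - q) \<subseteq> Poly_Mapping.keys p \<union> Poly_Mapping.keys q"
    by (auto simp: in_keys_iff lookup_minus)
  then show "p \<in> multilinear_on G S \<Longrightarrow> q \<in> multilinear_on G S \<Longrightarrow> p - q \<in> multilinear_on G S"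
    by (fastforce simp: multilinear_on_def)
qed

lemma multilinear_on_smult: "p \<in> multilinear_on G S \<Longrightarrow> Poly_Mapping.map ((*) c) p \<in> multilinear_on G S"
  using keys_map_times[of c p] by (fastforce simp: multilinear_on_def)

lemma multilinear_on_mult:
  assumes "p \<in> multilinear_on G S" "q \<in> multilinear_on G T" "S \<inter> T = {}"
  shows "p * q \<in> multilinear_on G (S \<union> T)"
  unfolding multilinear_on_def
proof (intro CollectI ballI)
  fix w assume "w \<in> Poly_Mapping.keys (p * q)"
  then obtain u v where uv: "w = u + v" "u \<in> Poly_Mapping.keys p" "v \<in> Poly_Mapping.keys q"
    using Poly_Mapping.keys_mult[of p q] by blast
  then have "multilinear_word G S u" "multilinear_word G T v" using assms by (auto simp: multilinear_on_def)
  then show "multilinear_word G (S \<union> T) w"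
    using assms(3) uv(1) by (auto simp: multilinear_word_def plus_word_def image_Un)
qed

lemma multilinear_on_one: "1 \<in> multilinear_on G {}"
  by (simp add: multilinear_on_def multilinear_word_def zero_word_def)

lemma multilinear_on_letter:
  "deg x \<in> carrier G \<Longrightarrow> Poly_Mapping.single (Word [x]) 1 \<in> multilinear_on G {idx x}"
  by (simp add: multilinear_on_def multilinear_word_def)

lemma abelian_group_free_algebra:
  "abelian_group (free_algebra G :: ('f :: field, 'g letter word \<Rightarrow>\<^sub>0 'f) module)"
proof (rule abelian_groupI)
  fix p :: "'g letter word \<Rightarrow>\<^sub>0 'f" assume "p \<in> carrier (free_algebra G)"
  moreover have "- p + p = 0" by simp
  moreover have "Poly_Mapping.keys (- p) = Poly_Mapping.keys p" by (auto simp: in_keys_iff)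
  ultimately show "\<exists>q\<in>carrier (free_algebra G). q \<oplus>\<^bsub>free_algebra G\<^esub> p = \<zero>\<^bsub>free_algebra G\<^esub>"
    by (intro bexI[of _ "- p"]) (simp_all add: free_algebra_def)
next
  fix p q :: "'g letter word \<Rightarrow>\<^sub>0 'f" assume "p \<in> carrier (free_algebra G)" "q \<in> carrier (free_algebra G)"
  then show "p \<oplus>\<^bsub>free_algebra G\<^esub> q \<in> carrier (free_algebra G)"
    using Poly_Mapping.keys_add[of p q] by (fastforce simp: free_algebra_def)
qed (auto simp: free_algebra_def add.assoc add.commute)

lemma free_algebra_ops:
  "\<zero>\<^bsub>free_algebra G\<^esub> = 0" "p \<oplus>\<^bsub>free_algebra G\<^esub> q = p + q"
  "c \<odot>\<^bsub>free_algebra G\<^esub> p = Poly_Mapping.map ((*) c) p"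
  by (simp_all add: free_algebra_def)

lemma vectorspace_free_algebra: "vectorspace class_ring (free_algebra G :: ('f :: field, 'g letter word \<Rightarrow>\<^sub>0 'f) module)"
proof -
  have "Module.module class_ring (free_algebra G :: ('f :: field, 'g letter word \<Rightarrow>\<^sub>0 'f) module)"
  proof (rule moduleI)
    show "cring (class_ring :: 'f ring)" using class_field cring_def field_def domain_def by blast
    show "abelian_group (free_algebra G :: ('f :: field, 'g letter word \<Rightarrow>\<^sub>0 'f) module)" by (rule abelian_group_free_algebra)
    fix a b :: 'f and p q :: "'g letter word \<Rightarrow>\<^sub>0 'f"
    assume "p \<in> carrier (free_algebra G)"
    then show "a \<odot>\<^bsub>free_algebra G\<^esub> p \<in> carrier (free_algebra G)"
      using keys_map_times[of a p] by (fastforce simp: free_algebra_def)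
  qed (simp_all add: free_algebra_def map_times single_add distrib_left distrib_right mult_single mult.assoc[symmetric])
  then show ?thesis using class_field by (simp add: vectorspace_def)
qed

lemma submodule_multilinear_on:
  "submodule class_ring (multilinear_on G S) (free_algebra G :: ('f :: field, 'g letter word \<Rightarrow>\<^sub>0 'f) module)"
proof -
  interpret V: vectorspace class_ring "free_algebra G :: ('f :: field, 'g letter word \<Rightarrow>\<^sub>0 'f) module"
    by (rule vectorspace_free_algebra)
  show ?thesis
  proof
    show "multilinear_on G S \<subseteq> carrier (free_algebra G)" using multilinear_on_carrier by blast
  qed (simp_all add: free_algebra_def multilinear_on_zero multilinear_on_add multilinear_on_smult)
qed

lemma prod_list_single:
  "prod_list (map (\<lambda>k. Poly_Mapping.single (Word [f k]) (1 :: 'f :: field)) ks) = Poly_Mapping.single (Word (map f ks)) 1"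
proof (induction ks)
  case Nil
  have "Poly_Mapping.single (Word []) (1 :: 'f) = 1" unfolding zero_word_def[symmetric] by (rule single_one)
  then show ?case by simp
next
  case (Cons k ks)
  then show ?case by (simp add: mult_single plus_word_def)
qed

lemma multilinear_monomial_single:
  "multilinear_monomial m \<sigma> g \<delta> =
     Poly_Mapping.single (Word (map (\<lambda>k. Letter (\<sigma> k) (g k) (\<delta> k)) [0..<m])) (1 :: 'f :: field)"
proof -
  have "(if \<delta> k then free_star (gen (\<sigma> k) (g k)) else gen (\<sigma> k) (g k)) =
      Poly_Mapping.single (Word [Letter (\<sigma> k) (g k) (\<delta> k)]) (1 :: 'f)" for k
    by (simp add: free_star_def gen_def word_star_def letter_star_def)
  then show ?thesis unfolding multilinear_monomial_def by (simp only: prod_list_single)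
qed

lemma multilinear_word_normal_form:
  assumes w: "multilinear_word G {..<m} w"
  shows "\<exists>\<sigma> g \<delta>. \<sigma> permutes {..<m} \<and> (\<forall>k < m. g k \<in> carrier G) \<and>
           w = Word (map (\<lambda>k. Letter (\<sigma> k) (g k) (\<delta> k)) [0..<m])"
proof -
  let ?ls = "letters w"
  have d: "distinct (map idx ?ls)" and i: "idx ` set ?ls = {..<m}" and g: "deg ` set ?ls \<subseteq> carrier G"
    using w by (auto simp: multilinear_word_def)
  have len: "length ?ls = m"
    using distinct_card[OF d] i by simp
  define \<sigma> where "\<sigma> k = (if k < m then idx (?ls ! k) else k)" for k
  have "bij_betw \<sigma> {..<m} {..<m}"
  proof (rule bij_betwI')
    show "\<sigma> x = \<sigma> y \<longleftrightarrow> x = y" if "x \<in> {..<m}" "y \<in> {..<m}" for x y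
      using that d len nth_eq_iff_index_eq[OF d, of x y] by (simp add: \<sigma>_def)
    show "\<sigma> x \<in> {..<m}" if "x \<in> {..<m}" for x
      using that i len by (auto simp: \<sigma>_def)
    show "\<exists>x\<in>{..<m}. y = \<sigma> x" if "y \<in> {..<m}" for y
    proof -
      from that i obtain l where "l \<in> set ?ls" "y = idx l" by auto
      then obtain x where "x < m" "?ls ! x = l" using len by (auto simp: in_set_conv_nth)
      then show ?thesis using \<open>y = idx l\<close> by (auto simp: \<sigma>_def)
    qed
  qed
  then have "\<sigma> permutes {..<m}" by (rule bij_imp_permutes) (simp add: \<sigma>_def)
  moreover have "\<forall>k<m. deg (?ls ! k) \<in> carrier G" using g len by auto
  moreover have "?ls = map (\<lambda>k. Letter (\<sigma> k) (deg (?ls ! k)) (starred (?ls ! k))) [0..<m]"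
    by (rule nth_equalityI) (simp_all add: len \<sigma>_def)
  then have "w = Word (map (\<lambda>k. Letter (\<sigma> k) (deg (?ls ! k)) (starred (?ls ! k))) [0..<m])"
    by (metis word.collapse)
  ultimately show ?thesis
    by (intro exI[of _ \<sigma>] exI[of _ "\<lambda>k. deg (?ls ! k)"] exI[of _ "\<lambda>k. starred (?ls ! k)"] conjI)
qed

lemma multilinear_monomial_word:
  assumes "\<sigma> permutes {..<m}" "\<forall>k < m. g k \<in> carrier G"
  shows "multilinear_word G {..<m} (Word (map (\<lambda>k. Letter (\<sigma> k) (g k) (\<delta> k)) [0..<m]))"
proof -
  have "\<sigma> ` {..<m} = {..<m}" using permutes_image[OF assms(1)] .
  moreover have "inj_on \<sigma> {..<m}" using permutes_inj_on[OF assms(1)] .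
  ultimately show ?thesis
    using assms(2) by (auto simp: multilinear_word_def distinct_map o_def image_image atLeast0LessThan)
qed

lemma multilinear_space_eq: "multilinear_space G m = (multilinear_on G {..<m} :: ('g letter word \<Rightarrow>\<^sub>0 'f :: field) set)"
proof
  interpret V: vectorspace class_ring "free_algebra G :: ('f :: field, 'g letter word \<Rightarrow>\<^sub>0 'f) module"
    by (rule vectorspace_free_algebra)
  let ?M = "{multilinear_monomial m \<sigma> g \<delta> :: 'g letter word \<Rightarrow>\<^sub>0 'f | \<sigma> g \<delta>. \<sigma> permutes {..<m} \<and> (\<forall>k < m. g k \<in> carrier G)}"
  have sub: "?M \<subseteq> multilinear_on G {..<m}"
    using multilinear_monomial_word by (auto simp: multilinear_monomial_single multilinear_on_def)
  have "V.span ?M \<subseteq> multilinear_on G {..<m}" 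
    by (rule V.span_is_subset[OF sub submodule_multilinear_on])
  then show "multilinear_space G m \<subseteq> (multilinear_on G {..<m} :: ('g letter word \<Rightarrow>\<^sub>0 'f) set)" unfolding multilinear_space_def .
  have "?M \<subseteq> carrier (free_algebra G)" using sub multilinear_on_carrier by blast
  then interpret S: submodule class_ring "V.span ?M" "free_algebra G" 
    by (rule V.span_is_submodule)
  show "(multilinear_on G {..<m} :: ('g letter word \<Rightarrow>\<^sub>0 'f) set) \<subseteq> multilinear_space G m"
  proof
    fix p :: "'g letter word \<Rightarrow>\<^sub>0 'f" assume p: "p \<in> multilinear_on G {..<m}"
    have *: "(\<Sum>w\<in>T. Poly_Mapping.single w (Poly_Mapping.lookup p w)) \<in> V.span ?M"
      if "finite T" "T \<subseteq> Poly_Mapping.keys p" for T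
      using that
    proof (induction T rule: finite_induct)
      case empty
      then show ?case using S.zero_closed unfolding free_algebra_ops by simp
    next
      case (insert w T)
      have "multilinear_word G {..<m} w" using insert.prems p by (auto simp: multilinear_on_def)
      from multilinear_word_normal_form[OF this] have "Poly_Mapping.single w 1 \<in> ?M"
        by (auto simp: multilinear_monomial_single)
      then have s1: "Poly_Mapping.single w 1 \<in> V.span ?M"
        using V.in_own_span[OF \<open>?M \<subseteq> carrier (free_algebra G)\<close>] by blast
      have c: "Poly_Mapping.lookup p w \<in> carrier class_ring" by simp
      have 1: "Poly_Mapping.single w (Poly_Mapping.lookup p w) \<in> V.span ?M"
        using S.smult_closed[OF c s1] unfolding free_algebra_ops single_map_times[symmetric] .
      have "T \<subseteq> Poly_Mapping.keys p" using insert.prems by blast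
      then have 2: "(\<Sum>w\<in>T. Poly_Mapping.single w (Poly_Mapping.lookup p w)) \<in> V.span ?M"
        by (rule insert.IH)
      show ?case using S.m_closed[OF 1 2] unfolding free_algebra_ops sum.insert[OF insert.hyps] .
    qed
    show "p \<in> multilinear_space G m"
      unfolding multilinear_space_def
      by (subst poly_mapping_sum_singles[of p]) (rule *[OF finite_keys order_refl])
  qed
qed

section \<open>Evaluation at triangular matrices\<close>

context graded_star_UT begin

text \<open>
  Evaluation is additive and multiplicative for all triangular values; the grading enters only with
  \<open>graded_substitution\<close> below.
\<close>

definition UT_substitution :: "(nat \<Rightarrow> 'g \<Rightarrow> 'f mat) \<Rightarrow> bool" where
  "UT_substitution a \<longleftrightarrow> (\<forall>i. \<forall>g \<in> carrier G. a i g \<in> UT n)"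

abbreviation wval :: "(nat \<Rightarrow> 'g \<Rightarrow> 'f mat) \<Rightarrow> 'g letter word \<Rightarrow> 'f mat" where
  "wval a w \<equiv> word_value (ut_algebra n :: ('f, 'f mat) module) star a w"

abbreviation eval_at :: "(nat \<Rightarrow> 'g \<Rightarrow> 'f mat) \<Rightarrow> ('g letter word \<Rightarrow>\<^sub>0 'f) \<Rightarrow> 'f mat" where
  "eval_at a p \<equiv> free_value (ut_algebra n :: ('f, 'f mat) module) star a p"

lemma letter_value_UT: "UT_substitution a \<Longrightarrow> deg x \<in> carrier G \<Longrightarrow> letter_value star a x \<in> UT n"
  by (auto simp: letter_value_def UT_substitution_def)

lemma wval_Nil: "wval a (Word []) = 1\<^sub>m n"
  and wval_Cons: "wval a (Word (x # xs)) = letter_value star a x * wval a (Word xs)"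
  by (simp_all add: word_value_def ut_algebra_def)

lemma wval_UT:
  assumes a: "UT_substitution a"
  shows "deg ` set xs \<subseteq> carrier G \<Longrightarrow> wval a (Word xs) \<in> UT n"
  by (induction xs) (simp_all add: wval_Nil wval_Cons letter_value_UT[OF a])

lemma wval_append:
  assumes a: "UT_substitution a" and "deg ` set xs \<subseteq> carrier G" "deg ` set ys \<subseteq> carrier G"
  shows "wval a (Word (xs @ ys)) = wval a (Word xs) * wval a (Word ys)"
  using assms(2)
proof (induction xs)
  case Nil
  then show ?case using UT_carrier[OF wval_UT[OF a assms(3)]] by (simp add: wval_Nil)
next
  case (Cons x xs)
  then have U: "letter_value star a x \<in> UT n" "wval a (Word xs) \<in> UT n" "wval a (Word ys) \<in> UT n"
    using letter_value_UT[OF a] wval_UT[OF a] assms(3) by auto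
  show ?case
    using Cons assoc_mult_mat[OF U[THEN UT_carrier]] by (simp add: wval_Cons)
qed

lemma eval_at_msum:
  assumes a: "UT_substitution a" and p: "p \<in> carrier (free_algebra G)"
  shows "eval_at a p = msum n (\<lambda>w. Poly_Mapping.lookup p w \<cdot>\<^sub>m wval a w) (Poly_Mapping.keys p)"
proof -
  have "wval a w \<in> UT n" if "w \<in> Poly_Mapping.keys p" for w
    using wval_UT[OF a, of "letters w"] p that by (force simp: free_algebra_def)
  then have "(\<Oplus>\<^bsub>(ut_algebra n :: ('f, 'f mat) module)\<^esub> w \<in> Poly_Mapping.keys p. Poly_Mapping.lookup p w \<cdot>\<^sub>m wval a w) =
      msum n (\<lambda>w. Poly_Mapping.lookup p w \<cdot>\<^sub>m wval a w) (Poly_Mapping.keys p)"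
    by (intro finsum_UT) auto
  moreover have "smult (ut_algebra n :: ('f, 'f mat) module) = (\<cdot>\<^sub>m)" by (simp add: ut_algebra_def)
  ultimately show ?thesis by (simp only: free_value_def)
qed

lemma eval_at_UT:
  assumes a: "UT_substitution a" and p: "p \<in> carrier (free_algebra G)"
  shows "eval_at a p \<in> UT n"
  unfolding eval_at_msum[OF assms]
proof (rule msum_UT)
  fix w assume "w \<in> Poly_Mapping.keys p"
  then have "wval a w \<in> UT n"
    using wval_UT[OF a, of "letters w"] p by (force simp: free_algebra_def)
  then show "Poly_Mapping.lookup p w \<cdot>\<^sub>m wval a w \<in> UT n" by simp
qed

lemma eval_at_entry:
  assumes a: "UT_substitution a" and p: "p \<in> carrier (free_algebra G)" and ij: "i < n" "j < n"
  shows "eval_at a p $$ (i,j) = (\<Sum>w\<in>Poly_Mapping.keys p. Poly_Mapping.lookup p w * wval a w $$ (i,j))"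
  unfolding eval_at_msum[OF a p] msum_entry[OF ij]
proof (rule sum.cong[OF refl])
  fix w assume "w \<in> Poly_Mapping.keys p"
  then have "wval a w \<in> UT n"
    using wval_UT[OF a, of "letters w"] p by (force simp: free_algebra_def)
  then show "(Poly_Mapping.lookup p w \<cdot>\<^sub>m wval a w) $$ (i,j) = Poly_Mapping.lookup p w * wval a w $$ (i,j)"
    using ij by simp
qed

lemma free_algebra_closed:
  fixes p q :: "'g letter word \<Rightarrow>\<^sub>0 'f"
  assumes "p \<in> carrier (free_algebra G)" "q \<in> carrier (free_algebra G)"
  shows free_algebra_add: "p + q \<in> carrier (free_algebra G)"
    and free_algebra_minus: "p - q \<in> carrier (free_algebra G)"
    and free_algebra_mult: "p * q \<in> carrier (free_algebra G)"
    and free_algebra_smult: "Poly_Mapping.map ((*) c) p \<in> carrier (free_algebra G)"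
proof -
  have ok: "Poly_Mapping.keys r \<subseteq> {w. \<forall>x \<in> set (letters w). deg x \<in> carrier G} \<longleftrightarrow> r \<in> carrier (free_algebra G)" 
    for r :: "'g letter word \<Rightarrow>\<^sub>0 'f" by (auto simp: free_algebra_def)
  note pq = assms[folded ok]
  show "p + q \<in> carrier (free_algebra G)" using pq Poly_Mapping.keys_add[of p q] unfolding ok[symmetric] by blast
  have "Poly_Mapping.keys (p - q) \<subseteq> Poly_Mapping.keys p \<union> Poly_Mapping.keys q"
    by (auto simp: in_keys_iff lookup_minus)
  then show "p - q \<in> carrier (free_algebra G)" using pq unfolding ok[symmetric] by blast
  show "Poly_Mapping.map ((*) c) p \<in> carrier (free_algebra G)"
    using pq keys_map_times[of c p] unfolding ok[symmetric] by blast
  show "p * q \<in> carrier (free_algebra G)" unfolding ok[symmetric]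
  proof
    fix w assume "w \<in> Poly_Mapping.keys (p * q)"
    then obtain u v where "w = u + v" "u \<in> Poly_Mapping.keys p" "v \<in> Poly_Mapping.keys q"
      using Poly_Mapping.keys_mult[of p q] by blast
    then show "w \<in> {w. \<forall>x \<in> set (letters w). deg x \<in> carrier G}" using pq by (auto simp: plus_word_def)
  qed
qed

lemma eval_at_add:
  assumes a: "UT_substitution a" and p: "p \<in> carrier (free_algebra G)" and q: "q \<in> carrier (free_algebra G)"
  shows "eval_at a (p + q) = eval_at a p + eval_at a q"
proof (rule UT_eqI[of _ n])
  fix i j assume "i \<le> j" "j < n"
  then have ij: "i < n" "j < n" by auto
  have "eval_at a (p + q) $$ (i,j) = eval_at a p $$ (i,j) + eval_at a q $$ (i,j)"
    unfolding eval_at_entry[OF a free_algebra_add[OF p q] ij] eval_at_entry[OF a p ij] eval_at_entry[OF a q ij]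
    by (rule setsum_keys_plus_distrib) (simp_all add: distrib_right)
  then show "eval_at a (p + q) $$ (i,j) = (eval_at a p + eval_at a q) $$ (i,j)"
    using ij UT_dims[OF eval_at_UT[OF a q]] by simp
qed (use eval_at_UT[OF a] p q free_algebra_add[OF p q] in simp_all)

lemma eval_at_smult_entry:
  assumes a: "UT_substitution a" and p: "p \<in> carrier (free_algebra G)" and ij: "i < n" "j < n"
  shows "eval_at a (Poly_Mapping.map ((*) c) p) $$ (i,j) = c * eval_at a p $$ (i,j)"
proof -
  let ?q = "Poly_Mapping.map ((*) c) p"
  have "eval_at a ?q $$ (i,j) = (\<Sum>w\<in>Poly_Mapping.keys ?q. Poly_Mapping.lookup ?q w * wval a w $$ (i,j))"
    by (rule eval_at_entry[OF a free_algebra_smult[OF p p] ij])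
  also have "\<dots> = (\<Sum>w\<in>Poly_Mapping.keys p. Poly_Mapping.lookup ?q w * wval a w $$ (i,j))"
    using keys_map_times[of c p] by (intro sum.mono_neutral_left) (auto simp: in_keys_iff)
  also have "\<dots> = c * eval_at a p $$ (i,j)"
    unfolding eval_at_entry[OF a p ij] sum_distrib_left lookup_map_times by (intro sum.cong refl) (simp add: mult.assoc)
  finally show ?thesis .
qed

lemma eval_at_minus:
  assumes a: "UT_substitution a" and p: "p \<in> carrier (free_algebra G)" and q: "q \<in> carrier (free_algebra G)"
  shows "eval_at a (p - q) = eval_at a p - eval_at a q"
proof -
  have "eval_at a p = eval_at a (p - q) + eval_at a q"
    using eval_at_add[OF a free_algebra_minus[OF p q] q] by simp
  then show ?thesis
    using eval_at_UT[OF a] p q free_algebra_minus[OF p q] by (intro UT_minus_self_add[of _ n]) simp_all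
qed

lemma eval_at_zero_poly: "UT_substitution a \<Longrightarrow> eval_at a 0 = 0\<^sub>m n n"
  using eval_at_msum[of a 0] by (simp add: free_algebra_def)

lemma single_carrier: "deg ` set (letters w) \<subseteq> carrier G \<Longrightarrow> Poly_Mapping.single w c \<in> carrier (free_algebra G)"
  by (auto simp: free_algebra_def)

lemma eval_at_single: 
  assumes "UT_substitution a" "deg ` set (letters w) \<subseteq> carrier G"
  shows "eval_at a (Poly_Mapping.single w c) = c \<cdot>\<^sub>m wval a w"
proof -
  have U: "wval a w \<in> UT n" using wval_UT[OF assms(1), of "letters w"] assms(2) by simp
  show ?thesis
  proof (rule UT_eqI[OF eval_at_UT[OF assms(1) single_carrier[OF assms(2)]]])
    fix i j assume "i \<le> j" "j < n"
    then show "eval_at a (Poly_Mapping.single w c) $$ (i,j) = (c \<cdot>\<^sub>m wval a w) $$ (i,j)"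
      using eval_at_entry[OF assms(1) single_carrier[OF assms(2)], of i j c] U by simp
  qed (use U in simp)
qed

lemma eval_at_sum:
  assumes a: "UT_substitution a" and "finite T" "\<And>t. t \<in> T \<Longrightarrow> f t \<in> carrier (free_algebra G)"
  shows "(\<Sum>t\<in>T. f t) \<in> carrier (free_algebra G) \<and> eval_at a (\<Sum>t\<in>T. f t) = msum n (\<lambda>t. eval_at a (f t)) T"
  using assms(2,3)
proof (induction T rule: finite_induct)
  case empty
  then show ?case using eval_at_zero_poly[OF a] by (simp add: free_algebra_def)
next
  case (insert t T)
  then show ?case using eval_at_UT[OF a] by (simp add: eval_at_add[OF a] msum_insert free_algebra_add)
qed

text \<open>
  Both sides are bilinear in the coefficients, so the claim reduces to the concatenation of two words.
\<close>

lemma eval_at_mult: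
  assumes a: "UT_substitution a" and p: "p \<in> carrier (free_algebra G)" and q: "q \<in> carrier (free_algebra G)"
  shows "eval_at a (p * q) = eval_at a p * eval_at a q"
proof -
  have ok: "deg ` set (letters w) \<subseteq> carrier G" if "w \<in> Poly_Mapping.keys p \<or> w \<in> Poly_Mapping.keys q" for w
    using that p q by (force simp: free_algebra_def)
  have U: "wval a w \<in> UT n" if "w \<in> Poly_Mapping.keys p \<or> w \<in> Poly_Mapping.keys q" for w
    using wval_UT[OF a ok[OF that]] by simp
  let ?P = "Poly_Mapping.keys p \<times> Poly_Mapping.keys q"
  let ?f = "\<lambda>(u,v). Poly_Mapping.single (u + v) (Poly_Mapping.lookup p u * Poly_Mapping.lookup q v)"
  have "p * q = (\<Sum>u\<in>Poly_Mapping.keys p. Poly_Mapping.single u (Poly_Mapping.lookup p u)) *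
      (\<Sum>v\<in>Poly_Mapping.keys q. Poly_Mapping.single v (Poly_Mapping.lookup q v))"
    using poly_mapping_sum_singles[of p] poly_mapping_sum_singles[of q] by simp
  also have "\<dots> = (\<Sum>t\<in>?P. ?f t)"
    by (simp add: sum_product mult_single sum.cartesian_product split_def)
  finally have pq: "p * q = (\<Sum>t\<in>?P. ?f t)" .
  have okf: "deg ` set (letters (u + v)) \<subseteq> carrier G" if "u \<in> Poly_Mapping.keys p" "v \<in> Poly_Mapping.keys q" for u v
    using ok[of u] ok[of v] that by (simp add: plus_word_def image_Un)
  have f: "?f t \<in> carrier (free_algebra G)" if t: "t \<in> ?P" for t
  proof -
    obtain u v where uv: "t = (u,v)" "u \<in> Poly_Mapping.keys p" "v \<in> Poly_Mapping.keys q" using t by blast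
    show ?thesis unfolding uv(1) using single_carrier[OF okf[OF uv(2,3)]] by simp
  qed
  have W: "wval a (u + v) = wval a u * wval a v" if "u \<in> Poly_Mapping.keys p" "v \<in> Poly_Mapping.keys q" for u v
  proof -
    have "wval a (Word (letters u @ letters v)) = wval a (Word (letters u)) * wval a (Word (letters v))"
      by (rule wval_append[OF a ok ok]) (use that in blast)+
    then show ?thesis by (simp only: plus_word_def word.collapse)
  qed
  have E: "eval_at a (p * q) = msum n (\<lambda>t. eval_at a (?f t)) ?P"
    unfolding pq using eval_at_sum[OF a _ f, of ?P] by simp
  show ?thesis
  proof (rule UT_eqI[OF eval_at_UT[OF a free_algebra_mult[OF p q]] UT_mult[OF eval_at_UT[OF a p] eval_at_UT[OF a q]]])
    fix i j assume "i \<le> j" "j < n"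
    then have ij: "i < n" "j < n" by auto
    have "eval_at a (p * q) $$ (i,j) = (\<Sum>(u,v)\<in>?P. Poly_Mapping.lookup p u * Poly_Mapping.lookup q v *
        (\<Sum>s<n. wval a u $$ (i,s) * wval a v $$ (s,j)))"
      unfolding E msum_entry[OF ij]
    proof (rule sum.cong[OF refl], clarify)
      fix u v assume uv: "u \<in> Poly_Mapping.keys p" "v \<in> Poly_Mapping.keys q"
      have c: "wval a u \<in> carrier_mat n n" "wval a v \<in> carrier_mat n n" using U uv UT_carrier by blast+
      show "eval_at a (Poly_Mapping.single (u + v) (Poly_Mapping.lookup p u * Poly_Mapping.lookup q v)) $$ (i,j) =
          Poly_Mapping.lookup p u * Poly_Mapping.lookup q v * (\<Sum>s<n. wval a u $$ (i,s) * wval a v $$ (s,j))"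
        unfolding eval_at_single[OF a okf[OF uv]] W[OF uv] mult_entry[OF c ij, symmetric]
        using c ij by (simp del: index_mult_mat(1))
    qed
    also have "\<dots> = (\<Sum>u\<in>Poly_Mapping.keys p. \<Sum>v\<in>Poly_Mapping.keys q. \<Sum>s<n.
        (Poly_Mapping.lookup p u * wval a u $$ (i,s)) * (Poly_Mapping.lookup q v * wval a v $$ (s,j)))"
      unfolding sum.cartesian_product[symmetric] sum_distrib_left by (intro sum.cong refl) (simp add: mult_ac)
    also have "\<dots> = (\<Sum>u\<in>Poly_Mapping.keys p. \<Sum>s<n. \<Sum>v\<in>Poly_Mapping.keys q.
        (Poly_Mapping.lookup p u * wval a u $$ (i,s)) * (Poly_Mapping.lookup q v * wval a v $$ (s,j)))"
      by (intro sum.cong refl sum.swap)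
    also have "\<dots> = (\<Sum>s<n. \<Sum>u\<in>Poly_Mapping.keys p. \<Sum>v\<in>Poly_Mapping.keys q.
        (Poly_Mapping.lookup p u * wval a u $$ (i,s)) * (Poly_Mapping.lookup q v * wval a v $$ (s,j)))"
      by (rule sum.swap)
    also have "\<dots> = (\<Sum>s<n. eval_at a p $$ (i,s) * eval_at a q $$ (s,j))"
      by (intro sum.cong refl) (simp add: eval_at_entry[OF a p] eval_at_entry[OF a q] ij sum_product)
    also have "\<dots> = (eval_at a p * eval_at a q) $$ (i,j)"
      by (rule mult_entry[OF UT_carrier[OF eval_at_UT[OF a p]] UT_carrier[OF eval_at_UT[OF a q]] ij, symmetric])
    finally show "eval_at a (p * q) $$ (i,j) = (eval_at a p * eval_at a q) $$ (i,j)" .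
  qed
qed

definition graded_substitution :: "(nat \<Rightarrow> 'g \<Rightarrow> 'f mat) \<Rightarrow> bool" where
  "graded_substitution a \<longleftrightarrow> (\<forall>i. \<forall>g \<in> carrier G. a i g \<in> \<Gamma> g)"

lemma graded_substitution_UT: "graded_substitution a \<Longrightarrow> UT_substitution a"
  by (meson graded_substitution_def UT_substitution_def \<Gamma>_UT)

lemma wval_cong:
  "(\<And>x. x \<in> set xs \<Longrightarrow> a (idx x) (deg x) = b (idx x) (deg x)) \<Longrightarrow> wval a (Word xs) = wval b (Word xs)"
  by (induction xs) (simp_all add: wval_Nil wval_Cons letter_value_def)

text \<open>
  Exactly one letter of the word has index \<open>q\<close>, so the value of the word is linear in the value of that
  variable.
\<close>

lemma wval_multilinear:
  assumes a: "UT_substitution a" and L: "finite L"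
    and s: "\<And>l g. l \<in> L \<Longrightarrow> g \<in> carrier G \<Longrightarrow> s l g \<in> UT n"
    and w: "multilinear_word G S w" and q: "q \<in> S"
    and aq: "\<And>g. g \<in> carrier G \<Longrightarrow> a q g = msum n (\<lambda>l. c l \<cdot>\<^sub>m s l g) L"
  shows "wval a w = msum n (\<lambda>l. c l \<cdot>\<^sub>m wval (a(q := s l)) w) L"
proof -
  have d: "distinct (map idx (letters w))" and i: "idx ` set (letters w) = S" and g: "deg ` set (letters w) \<subseteq> carrier G"
    using w by (auto simp: multilinear_word_def)
  obtain x where x: "x \<in> set (letters w)" "idx x = q" using q i by blast
  obtain us vs where uv: "letters w = us @ x # vs" using split_list[OF x(1)] by blast
  have nq: "idx y \<noteq> q" if "y \<in> set us \<or> y \<in> set vs" for y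
    using d that unfolding uv by (auto simp: x(2)[symmetric] rev_image_eqI)
  have degs: "deg ` set us \<subseteq> carrier G" "deg x \<in> carrier G" "deg ` set vs \<subseteq> carrier G"
    using g unfolding uv by auto
  have wW: "w = Word (us @ x # vs)" using uv by (metis word.collapse)
  let ?U = "wval a (Word us)" and ?V = "wval a (Word vs)"
  let ?a = "\<lambda>l. a(q := s l)"
  have UV: "?U \<in> UT n" "?V \<in> UT n" using wval_UT[OF a] degs by blast+
  have al: "UT_substitution (?a l)" if "l \<in> L" for l using a s that by (auto simp: UT_substitution_def)
  have split: "wval b w = wval b (Word us) * (letter_value star b x * wval b (Word vs))" if "UT_substitution b" for b
    unfolding wW using wval_append[OF that degs(1), of "x # vs"] degs by (simp add: wval_Cons)
  have same: "wval (?a l) (Word us) = ?U" "wval (?a l) (Word vs) = ?V" for l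
    using nq by (auto intro!: wval_cong)
  have lU: "letter_value star (?a l) x \<in> UT n" if "l \<in> L" for l
    using letter_value_UT[OF al[OF that] degs(2)] .
  have lv: "letter_value star a x = msum n (\<lambda>l. c l \<cdot>\<^sub>m letter_value star (?a l) x) L"
  proof (cases "starred x")
    case False
    then show ?thesis using aq[OF degs(2)] by (simp add: letter_value_def x(2))
  next
    case True
    have "letter_value star a x = star (msum n (\<lambda>l. c l \<cdot>\<^sub>m s l (deg x)) L)"
      using True aq[OF degs(2)] by (simp add: letter_value_def x(2))
    also have "\<dots> = msum n (\<lambda>l. star (c l \<cdot>\<^sub>m s l (deg x))) L"
      using s degs by (intro UT_additive_msum star_additive L) simp
    also have "\<dots> = msum n (\<lambda>l. c l \<cdot>\<^sub>m letter_value star (?a l) x) L"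
      using True s degs by (intro msum_cong refl) (simp add: letter_value_def x(2) star_smult)
    finally show ?thesis .
  qed
  have add: "UT_additive n (\<lambda>M. ?U * (M * ?V))"
    using UT_additive_mult_left[OF UV(1)] UT_additive_mult_right[OF UV(2)] unfolding UT_additive_def by simp
  have "wval a w = ?U * (msum n (\<lambda>l. c l \<cdot>\<^sub>m letter_value star (?a l) x) L * ?V)"
    using split[OF a] lv by simp
  also have "\<dots> = msum n (\<lambda>l. ?U * ((c l \<cdot>\<^sub>m letter_value star (?a l) x) * ?V)) L"
    using lU by (intro UT_additive_msum[OF add L]) simp
  also have "\<dots> = msum n (\<lambda>l. c l \<cdot>\<^sub>m wval (?a l) w) L"
  proof (rule msum_cong[OF refl])
    fix l assume l: "l \<in> L"
    note C = UT_carrier[OF UV(1)] UT_carrier[OF lU[OF l]] UT_carrier[OF UV(2)]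
    have "?U * ((c l \<cdot>\<^sub>m letter_value star (?a l) x) * ?V) = c l \<cdot>\<^sub>m (?U * (letter_value star (?a l) x * ?V))"
      unfolding mult_smult_assoc_mat[OF C(2,3)] by (rule mult_smult_distrib[OF C(1) mult_carrier_mat[OF C(2,3)]])
    also have "\<dots> = c l \<cdot>\<^sub>m wval (?a l) w" using split[OF al[OF l]] same by simp
    finally show "?U * ((c l \<cdot>\<^sub>m letter_value star (?a l) x) * ?V) = c l \<cdot>\<^sub>m wval (?a l) w" .
  qed
  finally show ?thesis .
qed

lemma multilinear_word_degs: "multilinear_word G S w \<Longrightarrow> deg ` set (letters w) \<subseteq> carrier G"
  by (simp add: multilinear_word_def)

lemma eval_at_multilinear:
  assumes a: "UT_substitution a" and L: "finite L"
    and s: "\<And>l g. l \<in> L \<Longrightarrow> g \<in> carrier G \<Longrightarrow> s l g \<in> UT n"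
    and p: "p \<in> multilinear_on G S" and q: "q \<in> S"
    and aq: "\<And>g. g \<in> carrier G \<Longrightarrow> a q g = msum n (\<lambda>l. c l \<cdot>\<^sub>m s l g) L"
    and ij: "i < n" "j < n"
  shows "eval_at a p $$ (i,j) = (\<Sum>l\<in>L. c l * eval_at (a(q := s l)) p $$ (i,j))"
proof -
  have pc: "p \<in> carrier (free_algebra G)" by (rule multilinear_on_carrier[OF p])
  have al: "UT_substitution (a(q := s l))" if "l \<in> L" for l using a s that by (auto simp: UT_substitution_def)
  have wm: "multilinear_word G S w" if "w \<in> Poly_Mapping.keys p" for w using p that by (auto simp: multilinear_on_def)
  have e: "wval a w $$ (i,j) = (\<Sum>l\<in>L. c l * wval (a(q := s l)) w $$ (i,j))" if w: "w \<in> Poly_Mapping.keys p" for w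
  proof -
    have "wval a w = msum n (\<lambda>l. c l \<cdot>\<^sub>m wval (a(q := s l)) w) L"
      by (rule wval_multilinear[OF a L _ wm[OF w] q]) (simp_all add: s aq)
    then have "wval a w $$ (i,j) = (\<Sum>l\<in>L. (c l \<cdot>\<^sub>m wval (a(q := s l)) w) $$ (i,j))"
      using ij by simp
    also have "\<dots> = (\<Sum>l\<in>L. c l * wval (a(q := s l)) w $$ (i,j))"
    proof (rule sum.cong[OF refl])
      fix l assume l: "l \<in> L"
      have "wval (a(q := s l)) w \<in> UT n"
        using wval_UT[OF al[OF l] multilinear_word_degs[OF wm[OF w]]] by simp
      then show "(c l \<cdot>\<^sub>m wval (a(q := s l)) w) $$ (i,j) = c l * wval (a(q := s l)) w $$ (i,j)" using ij by simp
    qed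
    finally show ?thesis .
  qed
  have "eval_at a p $$ (i,j) = (\<Sum>w\<in>Poly_Mapping.keys p. \<Sum>l\<in>L. Poly_Mapping.lookup p w * (c l * wval (a(q := s l)) w $$ (i,j)))"
    unfolding eval_at_entry[OF a pc ij] by (intro sum.cong refl) (simp add: e sum_distrib_left)
  also have "\<dots> = (\<Sum>l\<in>L. \<Sum>w\<in>Poly_Mapping.keys p. Poly_Mapping.lookup p w * (c l * wval (a(q := s l)) w $$ (i,j)))"
    by (rule sum.swap)
  also have "\<dots> = (\<Sum>l\<in>L. c l * eval_at (a(q := s l)) p $$ (i,j))"
    by (intro sum.cong refl) (simp add: eval_at_entry[OF al pc ij] sum_distrib_left mult_ac)
  finally show ?thesis .
qed

lemma eval_at_cong:
  assumes a: "UT_substitution a" and b: "UT_substitution b" and p: "p \<in> multilinear_on G S"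
    and ab: "\<And>i g. i \<in> S \<Longrightarrow> g \<in> carrier G \<Longrightarrow> a i g = b i g"
  shows "eval_at a p = eval_at b p"
  unfolding eval_at_msum[OF a multilinear_on_carrier[OF p]] eval_at_msum[OF b multilinear_on_carrier[OF p]]
proof (rule msum_cong[OF refl])
  fix w assume "w \<in> Poly_Mapping.keys p"
  then have w: "multilinear_word G S w" using p by (auto simp: multilinear_on_def)
  have "wval a (Word (letters w)) = wval b (Word (letters w))"
  proof (rule wval_cong)
    fix x assume "x \<in> set (letters w)"
    then show "a (idx x) (deg x) = b (idx x) (deg x)" using w ab by (auto simp: multilinear_word_def)
  qed
  then show "Poly_Mapping.lookup p w \<cdot>\<^sub>m wval a w = Poly_Mapping.lookup p w \<cdot>\<^sub>m wval b w" by simp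
qed

definition basis_substitution :: "(nat \<Rightarrow> nat \<times> nat) \<Rightarrow> nat \<Rightarrow> 'g \<Rightarrow> 'f mat" where
  "basis_substitution t i g = (if t i \<in> labels n then homogeneous_unit (t i) g else 0\<^sub>m n n)"

lemma basis_substitution_graded: "graded_substitution (basis_substitution t)"
  by (simp add: graded_substitution_def basis_substitution_def homogeneous_unit_\<Gamma> \<Gamma>_zero)

lemma homogeneous_expansion_all:
  assumes a: "\<And>g. g \<in> carrier G \<Longrightarrow> a g \<in> \<Gamma> g"
  shows "\<exists>c. \<forall>g \<in> carrier G. a g = msum n (\<lambda>p. c p \<cdot>\<^sub>m homogeneous_unit p g) (labels n)"
proof -
  have "\<forall>g. \<exists>c. g \<in> carrier G \<longrightarrow> a g = msum n (\<lambda>p. c p \<cdot>\<^sub>m homogeneous_unit p g) (labels n)"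
    using homogeneous_expansion a by metis
  then obtain c where c: "\<And>g. g \<in> carrier G \<Longrightarrow> a g = msum n (\<lambda>p. c g p \<cdot>\<^sub>m homogeneous_unit p g) (labels n)"
    by metis
  have "a g = msum n (\<lambda>p. c (label_deg p) p \<cdot>\<^sub>m homogeneous_unit p g) (labels n)" if g: "g \<in> carrier G" for g
    unfolding c[OF g] by (intro msum_cong refl) (auto simp: homogeneous_unit_def)
  then show ?thesis by (intro exI[of _ "\<lambda>p. c (label_deg p) p"] ballI)
qed

text \<open>
  The values of the variables are expanded in the homogeneous basis one variable after the other, which is
  possible because \<open>p\<close> is linear in each of them.
\<close>

lemma vanishing_on_basis:
  assumes p: "p \<in> multilinear_on G {..<m}"
    and basis: "\<And>t. t \<in> {..<m} \<rightarrow>\<^sub>E labels n \<Longrightarrow> eval_at (basis_substitution t) p = 0\<^sub>m n n"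
    and a: "graded_substitution a"
  shows "eval_at a p = 0\<^sub>m n n"
proof -
  have "eval_at a p = 0\<^sub>m n n" if "q \<le> m" "graded_substitution a"
    "\<And>i. q \<le> i \<Longrightarrow> i < m \<Longrightarrow> \<exists>l \<in> labels n. \<forall>g \<in> carrier G. a i g = homogeneous_unit l g" for q a
    using that
  proof (induction q arbitrary: a)
    case 0
    then obtain t where t: "\<And>i. i < m \<Longrightarrow> t i \<in> labels n \<and> (\<forall>g \<in> carrier G. a i g = homogeneous_unit (t i) g)"
      by (metis zero_le)
    define t' where "t' = restrict t {..<m}"
    have t': "t' \<in> {..<m} \<rightarrow>\<^sub>E labels n" using t by (auto simp: t'_def)
    have "eval_at a p = eval_at (basis_substitution t') p"
      by (rule eval_at_cong[OF _ _ p])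
        (use t 0 graded_substitution_UT basis_substitution_graded in \<open>auto simp: basis_substitution_def t'_def\<close>)
    then show ?case using basis[OF t'] by simp
  next
    case (Suc q)
    have q: "q \<in> {..<m}" using Suc.prems by simp
    have aU: "UT_substitution a" by (rule graded_substitution_UT[OF Suc.prems(2)])
    obtain c where c: "\<And>g. g \<in> carrier G \<Longrightarrow> a q g = msum n (\<lambda>l. c l \<cdot>\<^sub>m homogeneous_unit l g) (labels n)"
      using homogeneous_expansion_all[of "a q"] Suc.prems(2) by (auto simp: graded_substitution_def)
    have hU: "homogeneous_unit l g \<in> UT n" if "l \<in> labels n" "g \<in> carrier G" for l g
      using homogeneous_unit_\<Gamma>[OF that] \<Gamma>_UT[OF that(2)] by blast
    have z: "eval_at (a(q := homogeneous_unit l)) p = 0\<^sub>m n n" if l: "l \<in> labels n" for l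
    proof (rule Suc.IH)
      show "graded_substitution (a(q := homogeneous_unit l))"
        using Suc.prems(2) l by (auto simp: graded_substitution_def homogeneous_unit_\<Gamma>)
      show "\<exists>l' \<in> labels n. \<forall>g \<in> carrier G. (a(q := homogeneous_unit l)) i g = homogeneous_unit l' g"
        if "q \<le> i" "i < m" for i
        using Suc.prems(3)[of i] l that by (cases "i = q") auto
    qed (use Suc.prems in simp)
    show ?case
    proof (rule UT_eqI[OF eval_at_UT[OF aU multilinear_on_carrier[OF p]]])
      fix i j assume "i \<le> j" "j < n"
      then have ij: "i < n" "j < n" by auto
      show "eval_at a p $$ (i,j) = 0\<^sub>m n n $$ (i,j)"
        using eval_at_multilinear[OF aU finite_labels hU p q c ij] z ij by simp
    qed simp
  qed
  from this[of m a] a show ?thesis by auto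
qed

lemma ut_zero: "\<zero>\<^bsub>(ut_algebra n :: ('f, 'f mat) module)\<^esub> = 0\<^sub>m n n"
  by (simp add: ut_algebra_def)

definition multilinear_module :: "nat \<Rightarrow> ('f, 'g letter word \<Rightarrow>\<^sub>0 'f) module" where
  "multilinear_module m = (free_algebra G)\<lparr>carrier := multilinear_space G m\<rparr>"

lemma vectorspace_multilinear_module: "vectorspace class_ring (multilinear_module m)"
proof -
  interpret V: vectorspace class_ring "free_algebra G :: ('f, 'g letter word \<Rightarrow>\<^sub>0 'f) module"
    by (rule vectorspace_free_algebra)
  show ?thesis
    unfolding multilinear_module_def vectorspace_def multilinear_space_eq
    using V.submodule_is_module[OF submodule_multilinear_on] class_field by blast
qed

lemma multilinear_module_carrier: "carrier (multilinear_module m) = multilinear_on G {..<m}"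
  by (simp add: multilinear_module_def multilinear_space_eq)

lemma eval_at_functional:
  assumes a: "UT_substitution a" and ij: "i < n" "j < n"
  shows "linear_functional (multilinear_module m) (\<lambda>p. eval_at a p $$ (i,j))"
  unfolding linear_functional_def
proof (intro conjI ballI allI)
  fix p q c assume "p \<in> carrier (multilinear_module m)" "q \<in> carrier (multilinear_module m)"
  then have pq: "p \<in> carrier (free_algebra G)" "q \<in> carrier (free_algebra G)"
    using multilinear_on_carrier unfolding multilinear_module_carrier by blast+
  have "p \<oplus>\<^bsub>multilinear_module m\<^esub> q = p + q" by (simp add: multilinear_module_def free_algebra_def)
  then show "eval_at a (p \<oplus>\<^bsub>multilinear_module m\<^esub> q) $$ (i,j) = eval_at a p $$ (i,j) + eval_at a q $$ (i,j)"
    using eval_at_add[OF a pq] eval_at_UT[OF a pq(1)] eval_at_UT[OF a pq(2)] ij by simp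
next
  fix c p assume "p \<in> carrier (multilinear_module m)"
  then have p: "p \<in> carrier (free_algebra G)"
    using multilinear_on_carrier unfolding multilinear_module_carrier by blast
  have "c \<odot>\<^bsub>multilinear_module m\<^esub> p = Poly_Mapping.map ((*) c) p" by (simp add: multilinear_module_def free_algebra_def)
  then show "eval_at a (c \<odot>\<^bsub>multilinear_module m\<^esub> p) $$ (i,j) = c * eval_at a p $$ (i,j)"
    using eval_at_smult_entry[OF a p ij] by simp
qed

lemma identities_iff:
  assumes p: "p \<in> multilinear_on G {..<m}"
  shows "p \<in> star_identities G (ut_algebra n) \<Gamma> star \<longleftrightarrow>
    (\<forall>t \<in> {..<m} \<rightarrow>\<^sub>E labels n. eval_at (basis_substitution t) p = 0\<^sub>m n n)"
proof
  assume "p \<in> star_identities G (ut_algebra n) \<Gamma> star"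
  then show "\<forall>t \<in> {..<m} \<rightarrow>\<^sub>E labels n. eval_at (basis_substitution t) p = 0\<^sub>m n n"
    using basis_substitution_graded unfolding star_identities_def graded_substitution_def ut_zero by blast
next
  assume "\<forall>t \<in> {..<m} \<rightarrow>\<^sub>E labels n. eval_at (basis_substitution t) p = 0\<^sub>m n n"
  then show "p \<in> star_identities G (ut_algebra n) \<Gamma> star"
    using vanishing_on_basis[OF p] multilinear_on_carrier[OF p]
    unfolding star_identities_def graded_substitution_def ut_zero by blast
qed

text \<open>
  By \<open>identities_iff\<close>, the multilinear identities are the common kernel of the entries of the evaluations at
  tuples of basis elements, and the functionals outside \<open>N\<close> vanish altogether. The second part is the dual
  count: polynomials told apart by the corner entries of graded evaluations are independent modulo identities.
\<close>

lemma star_codim_bounds: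
  assumes N: "finite N" "N \<subseteq> ({..<m} \<rightarrow>\<^sub>E labels n) \<times> {..<n} \<times> {..<n}"
    and out: "\<And>t i j p. t \<in> {..<m} \<rightarrow>\<^sub>E labels n \<Longrightarrow> i < n \<Longrightarrow> j < n \<Longrightarrow> (t,i,j) \<notin> N \<Longrightarrow>
       p \<in> multilinear_on G {..<m} \<Longrightarrow> eval_at (basis_substitution t) p $$ (i,j) = 0"
  shows "star_codim G (ut_algebra n) \<Gamma> star m \<le> card N"
    and "\<lbrakk>finite T; \<And>t. t \<in> T \<Longrightarrow> f t \<in> multilinear_on G {..<m};
       \<And>t. t \<in> T \<Longrightarrow> graded_substitution (b t);
       \<And>s t. s \<in> T \<Longrightarrow> t \<in> T \<Longrightarrow> eval_at (b t) (f s) $$ (0, n - 1) \<noteq> 0 \<longleftrightarrow> s = t\<rbrakk>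
      \<Longrightarrow> card T \<le> star_codim G (ut_algebra n) \<Gamma> star m"
proof -
  let ?W = "multilinear_space G m \<inter> star_identities G (ut_algebra n) \<Gamma> star"
  let ?\<phi> = "\<lambda>(t,i,j) p. eval_at (basis_substitution t) p $$ (i,j)"
  let ?\<Phi> = "?\<phi> ` N"
  have lin: "linear_functional (multilinear_module m) \<phi>" if "\<phi> \<in> ?\<Phi>" for \<phi>
  proof -
    from that obtain t i j where "\<phi> = (\<lambda>p. eval_at (basis_substitution t) p $$ (i,j))" "i < n" "j < n"
      using N(2) by fastforce
    then show ?thesis
      using eval_at_functional[OF graded_substitution_UT[OF basis_substitution_graded]] by blast
  qed
  have W: "?W = {p \<in> carrier (multilinear_module m). \<forall>\<phi>\<in>?\<Phi>. \<phi> p = 0}"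
  proof -
    have "p \<in> star_identities G (ut_algebra n) \<Gamma> star \<longleftrightarrow> (\<forall>\<phi>\<in>?\<Phi>. \<phi> p = 0)" if p: "p \<in> multilinear_on G {..<m}" for p
    proof
      assume "p \<in> star_identities G (ut_algebra n) \<Gamma> star"
      then have *: "eval_at (basis_substitution t) p = 0\<^sub>m n n" if "t \<in> {..<m} \<rightarrow>\<^sub>E labels n" for t
        using identities_iff[OF p] that by blast
      show "\<forall>\<phi>\<in>?\<Phi>. \<phi> p = 0"
      proof
        fix \<phi> assume "\<phi> \<in> ?\<Phi>"
        then obtain t i j where tij: "(t,i,j) \<in> N" "\<phi> = (\<lambda>p. eval_at (basis_substitution t) p $$ (i,j))" by auto
        then have "t \<in> {..<m} \<rightarrow>\<^sub>E labels n" "i < n" "j < n" using N(2) by auto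
        then show "\<phi> p = 0" using * tij(2) by simp
      qed
    next
      assume z: "\<forall>\<phi>\<in>?\<Phi>. \<phi> p = 0"
      show "p \<in> star_identities G (ut_algebra n) \<Gamma> star"
        unfolding identities_iff[OF p]
      proof
        fix t assume t: "t \<in> {..<m} \<rightarrow>\<^sub>E labels n"
        have U: "eval_at (basis_substitution t) p \<in> UT n"
          by (rule eval_at_UT[OF graded_substitution_UT[OF basis_substitution_graded] multilinear_on_carrier[OF p]])
        show "eval_at (basis_substitution t) p = 0\<^sub>m n n"
        proof (rule UT_eqI[OF U UT_zero])
          fix i j assume "i \<le> j" "j < n"
          then have ij: "i < n" "j < n" by auto
          have "eval_at (basis_substitution t) p $$ (i,j) = 0"
          proof (cases "(t,i,j) \<in> N")
            case True
            then have "?\<phi> (t,i,j) p = 0" using z by blast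
            then show ?thesis by simp
          next
            case False
            then show ?thesis using out[OF t ij _ p] by blast
          qed
          then show "eval_at (basis_substitution t) p $$ (i,j) = 0\<^sub>m n n $$ (i,j)" using ij by simp
        qed
      qed
    qed
    then show ?thesis unfolding multilinear_module_carrier multilinear_space_eq by blast
  qed
  have codim: "star_codim G (ut_algebra n) \<Gamma> star m =
      vectorspace.dim (class_ring :: 'f ring) (quotient_space (multilinear_module m) ?W)"
    by (simp only: star_codim_def multilinear_module_def)
  note bounds = dim_quotient_bounds[OF vectorspace_multilinear_module lin W finite_imageI[OF N(1)]]
  have "vectorspace.dim (class_ring :: 'f ring) (quotient_space (multilinear_module m) ?W) \<le> card ?\<Phi>"
    by (rule bounds(1))
  then show "star_codim G (ut_algebra n) \<Gamma> star m \<le> card N"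
    unfolding codim using card_image_le[OF N(1), of ?\<phi>] by linarith
  show "card T \<le> star_codim G (ut_algebra n) \<Gamma> star m"
    if T: "finite T" "\<And>t. t \<in> T \<Longrightarrow> f t \<in> multilinear_on G {..<m}"
       "\<And>t. t \<in> T \<Longrightarrow> graded_substitution (b t)"
       "\<And>s t. s \<in> T \<Longrightarrow> t \<in> T \<Longrightarrow> eval_at (b t) (f s) $$ (0, n - 1) \<noteq> 0 \<longleftrightarrow> s = t"
    unfolding codim
  proof (rule bounds(2)[where f = f and \<psi> = "\<lambda>t p. eval_at (b t) p $$ (0, n - 1)"])
    have n0: "0 < n" "n - 1 < n" using n_pos by auto
    show "linear_functional (multilinear_module m) (\<lambda>p. eval_at (b t) p $$ (0, n - 1))" if "t \<in> T" for t
      by (rule eval_at_functional[OF graded_substitution_UT[OF T(3)[OF that]] n0])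
    show "f t \<in> carrier (multilinear_module m)" if "t \<in> T" for t
      using T(2)[OF that] by (simp only: multilinear_module_carrier)
    show "eval_at (b t) w $$ (0, n - 1) = 0" if t: "t \<in> T" and w: "w \<in> ?W" for t w
    proof -
      have "eval_at (b t) w = 0\<^sub>m n n"
        using w T(3)[OF t] unfolding star_identities_def graded_substitution_def ut_zero by blast
      then show ?thesis using n0 by simp
    qed
  qed (use T in blast)+
qed

end

section \<open>Nonvanishing evaluations and the upper bound\<close>

text \<open>
  A tuple \<open>t\<close> of labels substitutes the basis element with label \<open>t k\<close> for the variable with index \<open>k\<close>;
  its steps are the variables that receive a strictly triangular element.
\<close>

definition steps :: "nat \<Rightarrow> (nat \<Rightarrow> nat \<times> nat) \<Rightarrow> nat set" where
  "steps m t = {k. k < m \<and> fst (t k) < snd (t k)}"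

text \<open>
  The involution moves the superdiagonal position \<open>l\<close> to \<open>n - 2 - l\<close>. A set of superdiagonal values is
  balanced if, with \<open>N = n - 1\<close>, starring a suitable subset of the variables makes them run through all
  superdiagonal positions, so that they can be multiplied to reach the corner.
\<close>

definition balanced :: "nat \<Rightarrow> 'k set \<Rightarrow> ('k \<Rightarrow> nat) \<Rightarrow> bool" where
  "balanced N K \<tau> \<longleftrightarrow> (\<exists>\<delta>. bij_betw (\<lambda>k. if \<delta> k then N - 1 - \<tau> k else \<tau> k) K {..<N})"

text \<open>
  The tuples that determine the asymptotics; by \<open>nonvanishing_tuple\<close> below, all others that matter are
  deficient, and there are fewer of those by a factor of order \<open>m\<close>.
\<close>

definition leading :: "nat \<Rightarrow> nat \<Rightarrow> (nat \<Rightarrow> nat \<times> nat) set" where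
  "leading n m = {t \<in> {..<m} \<rightarrow>\<^sub>E labels n. card (steps m t) = n - 1 \<and>
     (\<forall>k \<in> steps m t. snd (t k) = Suc (fst (t k))) \<and> balanced (n - 1) (steps m t) (fst \<circ> t)}"

definition deficient :: "nat \<Rightarrow> nat \<Rightarrow> (nat \<Rightarrow> nat \<times> nat) set" where
  "deficient n m = {t \<in> {..<m} \<rightarrow>\<^sub>E labels n. card (steps m t) < n - 1}"

lemma finite_steps [simp]: "finite (steps m t)" by (simp add: steps_def)

text \<open>
  The integer intervals from \<open>p k\<close> to \<open>q k\<close> do not overlap and lie between \<open>i\<close> and \<open>j\<close>, so there are at
  most \<open>n - 1\<close> of them; if this bound is attained, they are the unit intervals that tile \<open>{0..n - 1}\<close>.
\<close>

lemma disjoint_steps: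
  fixes p q :: "'k \<Rightarrow> nat"
  assumes "finite K" and j: "j < n"
    and pq: "\<And>k. k \<in> K \<Longrightarrow> i \<le> p k \<and> p k < q k \<and> q k \<le> j"
    and dis: "\<And>k k'. k \<in> K \<Longrightarrow> k' \<in> K \<Longrightarrow> k \<noteq> k' \<Longrightarrow> q k \<le> p k' \<or> q k' \<le> p k"
  shows "card K \<le> n - 1"
    and "i \<le> j \<Longrightarrow> card K = n - 1 \<Longrightarrow> i = 0 \<and> j = n - 1 \<and> bij_betw p K {..<n - 1} \<and> (\<forall>k \<in> K. q k = Suc (p k))"
proof -
  have inj: "inj_on p K"
  proof (rule inj_onI)
    fix k k' assume k: "k \<in> K" "k' \<in> K" "p k = p k'"
    show "k = k'"
    proof (rule ccontr)
      assume "k \<noteq> k'"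
      then show False using dis[OF k(1,2)] pq[OF k(1)] pq[OF k(2)] k(3) by linarith
    qed
  qed
  have img: "p ` K \<subseteq> {i..<j}"
  proof
    fix y assume "y \<in> p ` K"
    then obtain k where "k \<in> K" "y = p k" by blast
    then show "y \<in> {i..<j}" using pq[of k] by simp
  qed
  have card: "card K \<le> j - i"
    using card_mono[OF _ img] card_image[OF inj] by simp
  then show "card K \<le> n - 1" using j by linarith
  assume ij: "i \<le> j" and K: "card K = n - 1"
  have e: "i = 0" "j = n - 1"
  proof -
    have "n - 1 \<le> j - i" using card K by simp
    then show "i = 0" "j = n - 1" using j ij by linarith+
  qed
  have img': "p ` K = {..<n - 1}"
    using card_subset_eq[OF _ img] card_image[OF inj] K unfolding e by (simp add: atLeast0LessThan)
  have "q k = Suc (p k)" if k: "k \<in> K" for k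
  proof (rule ccontr)
    assume "q k \<noteq> Suc (p k)"
    then have less: "Suc (p k) < q k" "q k \<le> n - 1" using pq[OF k] e by linarith+
    then have "Suc (p k) \<in> p ` K" unfolding img' by simp
    then obtain k' where k': "k' \<in> K" "p k' = Suc (p k)" by (metis imageE)
    have "k \<noteq> k'" using k'(2) by auto
    then show False using dis[OF k k'(1)] pq[OF k'(1)] k'(2) less by linarith
  qed
  then show "i = 0 \<and> j = n - 1 \<and> bij_betw p K {..<n - 1} \<and> (\<forall>k \<in> K. q k = Suc (p k))"
    using e inj img' by (simp add: bij_betw_def)
qed

lemma sorted_wrt_cases:
  "sorted_wrt R xs \<Longrightarrow> x \<in> set xs \<Longrightarrow> y \<in> set xs \<Longrightarrow> x \<noteq> y \<Longrightarrow> R x y \<or> R y x"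
  by (induction xs) auto

context graded_star_UT begin

text \<open>
  The corner ideal in which the value of a letter lies: the label of its variable, reflected at the antidiagonal
  if the letter is starred.
\<close>

definition position :: "(nat \<Rightarrow> nat \<times> nat) \<Rightarrow> 'g letter \<Rightarrow> nat \<times> nat" where
  "position t x = (let (k,l) = t (idx x) in if starred x then (n - 1 - l, n - 1 - k) else (k,l))"

lemma zero_corner_ideal: "0\<^sub>m n n \<in> corner_ideal n k l"
  by (simp add: corner_ideal_def)

lemma letter_value_corner:
  assumes "t (idx x) \<in> labels n"
  shows "letter_value star (basis_substitution t) x \<in> corner_ideal n (fst (position t x)) (snd (position t x))"
proof -
  obtain k l where kl: "t (idx x) = (k,l)" "k \<le> l" "l < n" using assms by (auto simp: labels_def)
  have b: "basis_substitution t (idx x) (deg x) \<in> corner_ideal n k l"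
    using hbasis_corner[OF assms] assms kl(1)
    by (simp add: basis_substitution_def homogeneous_unit_def zero_corner_ideal)
  show ?thesis
  proof (cases "starred x")
    case True
    have "star (basis_substitution t (idx x) (deg x)) \<in> corner_ideal n (n - 1 - l) (n - 1 - k)"
      by (rule star_corner_ideal[OF b]) (use kl in auto)
    then show ?thesis using True kl by (simp add: letter_value_def position_def)
  next
    case False
    then show ?thesis using b kl by (simp add: letter_value_def position_def)
  qed
qed

text \<open>
  A nonzero entry of the product comes from a path from \<open>i\<close> to \<open>j\<close> that never moves left, and a factor from
  the corner ideal of \<open>(k,l)\<close> can only be passed from a row up to \<open>k\<close> to a column from \<open>l\<close> on.
\<close>

lemma nonzero_word_chain:
  assumes t: "\<And>x. x \<in> set xs \<Longrightarrow> t (idx x) \<in> labels n" and d: "deg ` set xs \<subseteq> carrier G"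
    and nz: "wval (basis_substitution t) (Word xs) $$ (i,j) \<noteq> 0" and ij: "i < n" "j < n"
  shows "i \<le> j \<and> sorted_wrt (\<lambda>x y. snd (position t x) \<le> fst (position t y)) xs \<and>
    (\<forall>x \<in> set xs. i \<le> fst (position t x) \<and> snd (position t x) \<le> j)"
  using t d nz ij
proof (induction xs arbitrary: i)
  case Nil
  then show ?case by (auto simp: wval_Nil split: if_splits)
next
  case (Cons x xs)
  let ?a = "basis_substitution t"
  have aU: "UT_substitution ?a" by (rule graded_substitution_UT[OF basis_substitution_graded])
  have U: "letter_value star ?a x \<in> UT n" "wval ?a (Word xs) \<in> UT n"
    using letter_value_UT[OF aU, of x] wval_UT[OF aU, of xs] Cons.prems(2) by auto
  have "(\<Sum>s<n. letter_value star ?a x $$ (i,s) * wval ?a (Word xs) $$ (s,j)) \<noteq> 0"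
    using Cons.prems(3) mult_entry[OF U[THEN UT_carrier] Cons.prems(4,5)] unfolding wval_Cons by metis
  then obtain s where "s < n" and "letter_value star ?a x $$ (i,s) * wval ?a (Word xs) $$ (s,j) \<noteq> 0"
    by (metis (no_types, lifting) sum.not_neutral_contains_not_neutral lessThan_iff)
  then have s: "s < n" "letter_value star ?a x $$ (i,s) \<noteq> 0" "wval ?a (Word xs) $$ (s,j) \<noteq> 0" by auto
  have "t (idx x) \<in> labels n" using Cons.prems(1) by simp
  from corner_idealD[OF letter_value_corner[of t x, OF this] Cons.prems(4) s(1,2)]
  have 1: "i \<le> fst (position t x)" "snd (position t x) \<le> s" by auto
  have IH: "s \<le> j \<and> sorted_wrt (\<lambda>x y. snd (position t x) \<le> fst (position t y)) xs \<and>
    (\<forall>x \<in> set xs. s \<le> fst (position t x) \<and> snd (position t x) \<le> j)"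
    by (rule Cons.IH) (use Cons.prems s in auto)
  have le: "i \<le> s" using UT_lower[OF U(1), of s i] s(2) Cons.prems(4) by (meson not_le)
  show ?case using 1 IH le by (auto intro: order_trans)
qed

text \<open>
  The steps along a word with a nonzero entry at \<open>(i,j)\<close> occupy disjoint intervals between \<open>i\<close> and \<open>j\<close>. If
  there are \<open>n - 1\<close> of them, they must be the unit intervals, each exactly once, and the entry must be the
  corner; the stars of the word then witness that the tuple is balanced.
\<close>

lemma nonvanishing_tuple:
  assumes t: "t \<in> {..<m} \<rightarrow>\<^sub>E labels n" and p: "p \<in> multilinear_on G {..<m}" and ij: "i < n" "j < n"
    and nz: "eval_at (basis_substitution t) p $$ (i,j) \<noteq> 0"
  shows "t \<in> deficient n m \<or> t \<in> leading n m \<and> i = 0 \<and> j = n - 1"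
proof -
  have aU: "UT_substitution (basis_substitution t)" by (rule graded_substitution_UT[OF basis_substitution_graded])
  have "\<exists>w \<in> Poly_Mapping.keys p. wval (basis_substitution t) w $$ (i,j) \<noteq> 0"
  proof (rule ccontr)
    assume "\<not> ?thesis"
    then have "eval_at (basis_substitution t) p $$ (i,j) = 0"
      unfolding eval_at_entry[OF aU multilinear_on_carrier[OF p] ij] by (intro sum.neutral) auto
    then show False using nz by simp
  qed
  then obtain w where w: "w \<in> Poly_Mapping.keys p" "wval (basis_substitution t) w $$ (i,j) \<noteq> 0" by blast
  define xs where "xs = letters w"
  have wx: "w = Word xs" by (simp add: xs_def)
  have ml: "multilinear_word G {..<m} w" using p w(1) by (auto simp: multilinear_on_def)
  then have d: "distinct (map idx xs)" and idx: "idx ` set xs = {..<m}" and dg: "deg ` set xs \<subseteq> carrier G"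
    by (auto simp: multilinear_word_def xs_def)
  have tl: "t k \<in> labels n" if "k < m" for k using t that by auto
  have tx: "t (idx x) \<in> labels n" if "x \<in> set xs" for x using tl idx that by blast
  from nonzero_word_chain[OF tx dg w(2)[unfolded wx] ij]
  have chain: "i \<le> j" "sorted_wrt (\<lambda>x y. snd (position t x) \<le> fst (position t y)) xs"
    "\<And>x. x \<in> set xs \<Longrightarrow> i \<le> fst (position t x) \<and> snd (position t x) \<le> j" by auto
  have "\<forall>k\<in>{..<m}. \<exists>x. x \<in> set xs \<and> idx x = k" using idx by (metis imageE)
  then obtain X where X: "\<And>k. k < m \<Longrightarrow> X k \<in> set xs \<and> idx (X k) = k"
    using bchoice[of "{..<m}" "\<lambda>k x. x \<in> set xs \<and> idx x = k"] by auto
  let ?K = "steps m t"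
  define p' q' where "p' k = fst (position t (X k))" and "q' k = snd (position t (X k))" for k
  have pos: "p' k = (if starred (X k) then n - 1 - snd (t k) else fst (t k))"
    "q' k = (if starred (X k) then n - 1 - fst (t k) else snd (t k))" if "k < m" for k
    using X[OF that] by (simp_all add: p'_def q'_def position_def split: prod.split)
  have tk: "k < m" "fst (t k) < snd (t k)" "snd (t k) < n" if "k \<in> ?K" for k
    using that tl[of k] by (auto simp: steps_def labels_def split: prod.splits)
  have in1: "i \<le> p' k \<and> p' k < q' k \<and> q' k \<le> j" if k: "k \<in> ?K" for k
  proof -
    have "p' k < q' k" using tk[OF k] pos[OF tk(1)[OF k]] by auto
    then show ?thesis using chain(3)[of "X k"] X[OF tk(1)[OF k]] by (simp add: p'_def q'_def)
  qed
  have in2: "q' k \<le> p' k' \<or> q' k' \<le> p' k" if k: "k \<in> ?K" "k' \<in> ?K" "k \<noteq> k'" for k k'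
  proof -
    have x: "X k \<in> set xs" "X k' \<in> set xs" "X k \<noteq> X k'"
      using X[OF tk(1)[OF k(1)]] X[OF tk(1)[OF k(2)]] k(3) by metis+
    show ?thesis using sorted_wrt_cases[OF chain(2) x] by (simp add: p'_def q'_def)
  qed
  have "card ?K \<le> n - 1"
    by (rule disjoint_steps(1)[where p = p' and q = q', OF finite_steps ij(2)]) (rule in1 in2, assumption+)+
  then consider "card ?K < n - 1" | "card ?K = n - 1" by linarith
  then show ?thesis
  proof cases
    case 1
    then show ?thesis using t by (simp add: deficient_def)
  next
    case 2
    have *: "i = 0 \<and> j = n - 1 \<and> bij_betw p' ?K {..<n - 1} \<and> (\<forall>k \<in> ?K. q' k = Suc (p' k))"
      by (rule disjoint_steps(2)[where p = p' and q = q', OF finite_steps ij(2) _ _ chain(1) 2])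
        (rule in1 in2, assumption+)+
    have S: "snd (t k) = Suc (fst (t k))" if k: "k \<in> ?K" for k
    proof -
      have "q' k = Suc (p' k)" using * k by blast
      then show ?thesis using pos[OF tk(1)[OF k]] tk(2,3)[OF k] by (auto split: if_splits)
    qed
    have bij: "bij_betw p' ?K {..<n - 1}" using * by blast
    have eq: "p' k = (if starred (X k) then n - 1 - 1 - (fst \<circ> t) k else (fst \<circ> t) k)" if k: "k \<in> ?K" for k
      using pos(1)[OF tk(1)[OF k]] S[OF k] by simp
    have "bij_betw (\<lambda>k. if starred (X k) then n - 1 - 1 - (fst \<circ> t) k else (fst \<circ> t) k) ?K {..<n - 1}"
      by (rule iffD1[OF bij_betw_cong bij]) (rule eq)
    then have "balanced (n - 1) ?K (fst \<circ> t)" unfolding balanced_def by (rule exI[of _ "\<lambda>k. starred (X k)"])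
    then have "t \<in> leading n m" using t 2 S unfolding leading_def by blast
    then show ?thesis using * by blast
  qed
qed

lemma finite_tuples: "finite ({..<m :: nat} \<rightarrow>\<^sub>E labels n)"
  by (rule finite_PiE) simp_all

text \<open>
  By \<open>nonvanishing_tuple\<close>, a leading tuple contributes a single functional, the corner entry, and a deficient
  tuple at most all entries.
\<close>

lemma star_codim_bounds_leading:
  shows "star_codim G (ut_algebra n) \<Gamma> star m \<le> card (leading n m) + n * n * card (deficient n m)"
    and "\<lbrakk>finite T; \<And>t. t \<in> T \<Longrightarrow> f t \<in> multilinear_on G {..<m};
       \<And>t. t \<in> T \<Longrightarrow> graded_substitution (b t);
       \<And>s t. s \<in> T \<Longrightarrow> t \<in> T \<Longrightarrow> eval_at (b t) (f s) $$ (0, n - 1) \<noteq> 0 \<longleftrightarrow> s = t\<rbrakk>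
      \<Longrightarrow> card T \<le> star_codim G (ut_algebra n) \<Gamma> star m"
proof -
  let ?N = "leading n m \<times> {(0 :: nat, n - 1)} \<union> deficient n m \<times> {..<n} \<times> {..<n}"
  have fl: "finite (leading n m)" and fd: "finite (deficient n m)"
    by (rule finite_subset[OF _ finite_tuples[of m]]; auto simp: leading_def deficient_def)+
  have N: "finite ?N" using fl fd by blast
  have sub: "?N \<subseteq> ({..<m} \<rightarrow>\<^sub>E labels n) \<times> {..<n} \<times> {..<n}"
    using n_pos by (auto simp: leading_def deficient_def)
  have out: "eval_at (basis_substitution t) p $$ (i,j) = 0"
    if "t \<in> {..<m} \<rightarrow>\<^sub>E labels n" "i < n" "j < n" "(t,i,j) \<notin> ?N" "p \<in> multilinear_on G {..<m}" for t i j p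
    using nonvanishing_tuple[OF that(1,5,2,3)] that(2-4) by blast
  have "star_codim G (ut_algebra n) \<Gamma> star m \<le> card ?N"
    by (rule star_codim_bounds(1)[OF N sub]) (rule out, assumption+)
  also have "\<dots> \<le> card (leading n m \<times> {(0 :: nat, n - 1)}) + card (deficient n m \<times> {..<n} \<times> {..<n})"
    by (rule card_Un_le)
  also have "\<dots> = card (leading n m) + n * n * card (deficient n m)"
    by (simp add: card_cartesian_product mult_ac)
  finally show "star_codim G (ut_algebra n) \<Gamma> star m \<le> card (leading n m) + n * n * card (deficient n m)" .
  show "card T \<le> star_codim G (ut_algebra n) \<Gamma> star m"
    if "finite T" "\<And>t. t \<in> T \<Longrightarrow> f t \<in> multilinear_on G {..<m}"
       "\<And>t. t \<in> T \<Longrightarrow> graded_substitution (b t)"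
       "\<And>s t. s \<in> T \<Longrightarrow> t \<in> T \<Longrightarrow> eval_at (b t) (f s) $$ (0, n - 1) \<noteq> 0 \<longleftrightarrow> s = t"
    by (rule star_codim_bounds(2)[OF N sub, of T f b]) ((rule out, assumption+) | (use that in blast))+
qed

end

section \<open>Separating polynomials and the lower bound\<close>

lemma one_smult_mat: "1 \<cdot>\<^sub>m A = (A :: 'f :: field mat)"
  by (rule eq_matI) auto

definition mprod :: "nat \<Rightarrow> ('i \<Rightarrow> 'f :: field mat) \<Rightarrow> 'i list \<Rightarrow> 'f mat" where
  "mprod n v xs = foldr (\<lambda>i M. v i * M) xs (1\<^sub>m n)"

definition mcomm :: "('i \<Rightarrow> 'f :: field mat) \<Rightarrow> 'f mat \<Rightarrow> 'i list \<Rightarrow> 'f mat" where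
  "mcomm v c ys = foldl (\<lambda>c i. c * v i - v i * c) c ys"

lemma mprod_simps: "mprod n v [] = 1\<^sub>m n" "mprod n v (x # xs) = v x * mprod n v xs"
  by (simp_all add: mprod_def)

lemma mcomm_simps: "mcomm v c [] = c" "mcomm v c (y # ys) = mcomm v (c * v y - v y * c) ys"
  by (simp_all add: mcomm_def)

lemma mprod_JJ: "(\<And>i. i \<in> set xs \<Longrightarrow> v i \<in> JJ n (e i)) \<Longrightarrow> mprod n v xs \<in> JJ n (sum_list (map e xs))"
  by (induction xs) (auto simp: mprod_simps intro: JJ_mult)

lemma mprod_UT: "(\<And>i. i \<in> set xs \<Longrightarrow> v i \<in> UT n) \<Longrightarrow> mprod n v xs \<in> UT n"
  by (induction xs) (auto simp: mprod_simps)

lemma mprod_diag: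
  "(\<And>i. i \<in> set xs \<Longrightarrow> v i \<in> UT n) \<Longrightarrow> j < n \<Longrightarrow> mprod n v xs $$ (j,j) = prod_list (map (\<lambda>i. v i $$ (j,j)) xs)"
proof (induction xs)
  case (Cons x xs)
  have U: "v x \<in> UT n" "mprod n v xs \<in> UT n" using Cons.prems mprod_UT[of xs v n] by auto
  have "mprod n v (x # xs) $$ (j,j) = v x $$ (j,j) * mprod n v xs $$ (j,j)"
    unfolding mprod_simps by (rule UT_mult_diag[OF U Cons.prems(2)])
  then show ?case using Cons by simp
qed (simp add: mprod_simps)

lemma mprod_superdiag:
  assumes "\<And>l. l + 1 < n \<Longrightarrow> C l \<in> JJ n (Suc 0)" "a < n"
  shows "mprod n C [a..<n - 1] \<in> JJ n (n - 1 - a) \<and>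
    mprod n C [a..<n - 1] $$ (a, n - 1) = prod_list (map (\<lambda>l. C l $$ (l, Suc l)) [a..<n - 1])"
  using assms(2)
proof (induction "n - 1 - a" arbitrary: a)
  case 0
  then have "a = n - 1" by simp
  then show ?case using 0 by (simp add: mprod_simps)
next
  case (Suc d)
  then have a: "a < n - 1" "Suc a < n" "d = n - 1 - Suc a" "n - 1 - a = Suc d" by auto
  have IH: "mprod n C [Suc a..<n - 1] \<in> JJ n d"
    "mprod n C [Suc a..<n - 1] $$ (Suc a, n - 1) = prod_list (map (\<lambda>l. C l $$ (l, Suc l)) [Suc a..<n - 1])"
    using Suc.hyps(1)[OF a(3,2)] a(3) by auto
  have Ca: "C a \<in> JJ n (Suc 0)" using assms(1) a by simp
  have up: "[a..<n - 1] = a # [Suc a..<n - 1]" using a(1) by (rule upt_conv_Cons)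
  have e: "a + Suc 0 + d = n - 1" using a by linarith
  have "C a * mprod n C [Suc a..<n - 1] \<in> JJ n (Suc 0 + d)" by (rule JJ_mult[OF Ca IH(1)])
  moreover have "(C a * mprod n C [Suc a..<n - 1]) $$ (a, n - 1) =
      C a $$ (a, Suc a) * mprod n C [Suc a..<n - 1] $$ (Suc a, n - 1)"
    using JJ_mult_corner[OF Ca IH(1), of a] e a by simp
  ultimately show ?case unfolding up mprod_simps using IH(2) a(4) by simp
qed

lemma mcomm_JJ:
  "c \<in> JJ n k \<Longrightarrow> (\<And>i. i \<in> set ys \<Longrightarrow> v i \<in> JJ n (e i)) \<Longrightarrow> mcomm v c ys \<in> JJ n (k + sum_list (map e ys))"
proof (induction ys arbitrary: c k)
  case (Cons y ys)
  have "c * v y \<in> JJ n (k + e y)" "v y * c \<in> JJ n (e y + k)" using Cons.prems by (auto intro: JJ_mult)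
  then have "c * v y - v y * c \<in> JJ n (k + e y)" by (simp add: JJ_minus add.commute)
  from Cons.IH[OF this] show ?case using Cons.prems(2) by (simp add: mcomm_simps add.assoc)
qed (simp add: mcomm_simps)

text \<open>
  Modulo the square of the radical, a bracket with a triangular matrix multiplies the superdiagonal entry of a
  strictly triangular one by a difference of consecutive diagonal entries.
\<close>

lemma mcomm_superdiag:
  "c \<in> JJ n (Suc 0) \<Longrightarrow> (\<And>i. i \<in> set ys \<Longrightarrow> v i \<in> UT n) \<Longrightarrow> Suc l < n \<Longrightarrow>
   mcomm v c ys $$ (l, Suc l) = c $$ (l, Suc l) * prod_list (map (\<lambda>i. v i $$ (Suc l, Suc l) - v i $$ (l,l)) ys)"
proof (induction ys arbitrary: c)
  case (Cons y ys)
  have y: "v y \<in> JJ n 0" using Cons.prems by simp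
  have J: "c * v y \<in> JJ n (Suc 0)" "v y * c \<in> JJ n (Suc 0)"
    using JJ_mult[OF Cons.prems(1) y] JJ_mult[OF y Cons.prems(1)] by simp_all
  have "(c * v y - v y * c) $$ (l, Suc l) = (c * v y) $$ (l, Suc l) - (v y * c) $$ (l, Suc l)"
    by (rule UT_minus_entry[OF JJ_UT[OF J(1)] JJ_UT[OF J(2)]]) (use Cons.prems(3) in auto)
  also have "(c * v y) $$ (l, Suc l) = c $$ (l, Suc l) * v y $$ (Suc l, Suc l)"
    using JJ_mult_corner[OF Cons.prems(1) y, of l] Cons.prems(3) by (simp del: index_mult_mat(1))
  also have "(v y * c) $$ (l, Suc l) = v y $$ (l,l) * c $$ (l, Suc l)"
    using JJ_mult_corner[OF y Cons.prems(1), of l] Cons.prems(3) by (simp del: index_mult_mat(1))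
  finally have "(c * v y - v y * c) $$ (l, Suc l) = c $$ (l, Suc l) * (v y $$ (Suc l, Suc l) - v y $$ (l,l))"
    by (simp add: algebra_simps)
  moreover have "mcomm v (c * v y - v y * c) ys $$ (l, Suc l) =
      (c * v y - v y * c) $$ (l, Suc l) * prod_list (map (\<lambda>i. v i $$ (Suc l, Suc l) - v i $$ (l,l)) ys)"
    by (rule Cons.IH[OF JJ_minus[OF J]]) (use Cons.prems in auto)
  ultimately show ?case by (simp add: mcomm_simps mult.assoc)
qed (simp add: mcomm_simps)

lemma prod_list_map_nonzero: "prod_list (map g xs) \<noteq> (0 :: 'f :: field) \<longleftrightarrow> (\<forall>i \<in> set xs. g i \<noteq> 0)"
  by (auto simp: prod_list_zero_iff)

text \<open>
  The values of the following polynomials are \<open>mprod\<close> and \<open>mcomm\<close> of the values of their arguments.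
\<close>

definition pprod :: "('i \<Rightarrow> 'g letter word \<Rightarrow>\<^sub>0 'f :: field) \<Rightarrow> 'i list \<Rightarrow> 'g letter word \<Rightarrow>\<^sub>0 'f" where
  "pprod x xs = foldr (\<lambda>i p. x i * p) xs 1"

definition pcomm :: "('i \<Rightarrow> 'g letter word \<Rightarrow>\<^sub>0 'f :: field) \<Rightarrow> ('g letter word \<Rightarrow>\<^sub>0 'f) \<Rightarrow> 'i list \<Rightarrow> 'g letter word \<Rightarrow>\<^sub>0 'f" where
  "pcomm x c ys = foldl (\<lambda>c i. c * x i - x i * c) c ys"

lemma pprod_multilinear:
  "(\<And>i. i \<in> set xs \<Longrightarrow> x i \<in> multilinear_on G (S i)) \<Longrightarrow> distinct xs \<Longrightarrow>
   (\<And>i j. i \<in> set xs \<Longrightarrow> j \<in> set xs \<Longrightarrow> i \<noteq> j \<Longrightarrow> S i \<inter> S j = {}) \<Longrightarrow>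
   pprod x xs \<in> multilinear_on G (\<Union>i\<in>set xs. S i)"
proof (induction xs)
  case Nil
  then show ?case by (simp add: pprod_def multilinear_on_one)
next
  case (Cons y ys)
  have "x y * pprod x ys \<in> multilinear_on G (S y \<union> (\<Union>i\<in>set ys. S i))"
  proof (rule multilinear_on_mult)
    show "S y \<inter> (\<Union>i\<in>set ys. S i) = {}" using Cons.prems(2,3) by fastforce
    show "pprod x ys \<in> multilinear_on G (\<Union>i\<in>set ys. S i)" by (rule Cons.IH) (use Cons.prems in auto)
  qed (use Cons.prems in auto)
  then show ?case by (simp add: pprod_def)
qed

lemma pcomm_multilinear:
  "c \<in> multilinear_on G S \<Longrightarrow> (\<And>i. i \<in> set ys \<Longrightarrow> x i \<in> multilinear_on G {i}) \<Longrightarrow> distinct ys \<Longrightarrow>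
   S \<inter> set ys = {} \<Longrightarrow> pcomm x c ys \<in> multilinear_on G (S \<union> set ys)"
proof (induction ys arbitrary: c S)
  case Nil
  then show ?case by (simp add: pcomm_def)
next
  case (Cons y ys)
  have y: "x y \<in> multilinear_on G {y}" "S \<inter> {y} = {}" "{y} \<inter> S = {}" using Cons.prems by auto
  have "c * x y \<in> multilinear_on G (S \<union> {y})" by (rule multilinear_on_mult[OF Cons.prems(1) y(1,2)])
  moreover have "x y * c \<in> multilinear_on G (S \<union> {y})"
    using multilinear_on_mult[OF y(1) Cons.prems(1) y(3)] by (simp add: Un_commute)
  ultimately have "c * x y - x y * c \<in> multilinear_on G (S \<union> {y})" by (rule multilinear_on_minus)
  then have "pcomm x (c * x y - x y * c) ys \<in> multilinear_on G ((S \<union> {y}) \<union> set ys)"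
    by (rule Cons.IH) (use Cons.prems in auto)
  then show ?case by (simp add: pcomm_def)
qed

context graded_star_UT begin

lemma eval_at_letter:
  assumes a: "UT_substitution a" and d: "deg x \<in> carrier G"
  shows "eval_at a (Poly_Mapping.single (Word [x]) 1) = letter_value star a x"
proof -
  have U: "letter_value star a x \<in> UT n" by (rule letter_value_UT[OF a d])
  have "eval_at a (Poly_Mapping.single (Word [x]) 1) = 1 \<cdot>\<^sub>m wval a (Word [x])"
    by (rule eval_at_single[OF a]) (use d in simp)
  then show ?thesis using UT_carrier[OF U] by (simp add: wval_Cons wval_Nil one_smult_mat)
qed

lemma eval_at_one:
  assumes a: "UT_substitution a"
  shows "eval_at a 1 = 1\<^sub>m n"
proof -
  have "eval_at a (Poly_Mapping.single (Word []) 1) = 1 \<cdot>\<^sub>m wval a (Word [])"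
    by (rule eval_at_single[OF a]) simp
  moreover have "(Poly_Mapping.single (Word []) 1 :: 'g letter word \<Rightarrow>\<^sub>0 'f) = 1" unfolding zero_word_def[symmetric] by (rule single_one)
  ultimately show ?thesis by (simp add: wval_Nil one_smult_mat)
qed

lemma one_carrier: "(1 :: 'g letter word \<Rightarrow>\<^sub>0 'f) \<in> carrier (free_algebra G)"
  by (rule multilinear_on_carrier[OF multilinear_on_one])

lemma eval_at_pprod:
  assumes a: "UT_substitution a"
  shows "(\<And>i. i \<in> set xs \<Longrightarrow> x i \<in> carrier (free_algebra G)) \<Longrightarrow>
    pprod x xs \<in> carrier (free_algebra G) \<and> eval_at a (pprod x xs) = mprod n (\<lambda>i. eval_at a (x i)) xs"
proof (induction xs)
  case Nil
  show ?case using eval_at_one[OF a] one_carrier by (simp add: pprod_def mprod_def)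
next
  case (Cons y ys)
  have y: "x y \<in> carrier (free_algebra G)" and IH: "pprod x ys \<in> carrier (free_algebra G)"
    "eval_at a (pprod x ys) = mprod n (\<lambda>i. eval_at a (x i)) ys"
    using Cons by auto
  have "pprod x (y # ys) = x y * pprod x ys" by (simp add: pprod_def)
  then show ?case using eval_at_mult[OF a y IH(1)] free_algebra_mult[OF y IH(1)] IH(2) by (simp add: mprod_simps)
qed

lemma eval_at_pcomm:
  assumes a: "UT_substitution a"
  shows "c \<in> carrier (free_algebra G) \<Longrightarrow> (\<And>i. i \<in> set ys \<Longrightarrow> x i \<in> carrier (free_algebra G)) \<Longrightarrow>
    pcomm x c ys \<in> carrier (free_algebra G) \<and> eval_at a (pcomm x c ys) = mcomm (\<lambda>i. eval_at a (x i)) (eval_at a c) ys"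
proof (induction ys arbitrary: c)
  case Nil
  then show ?case by (simp add: pcomm_def mcomm_def)
next
  case (Cons y ys)
  have y: "x y \<in> carrier (free_algebra G)" using Cons.prems by auto
  note m = free_algebra_mult[OF Cons.prems(1) y] free_algebra_mult[OF y Cons.prems(1)]
  have "pcomm x c (y # ys) = pcomm x (c * x y - x y * c) ys" by (simp add: pcomm_def)
  moreover have "eval_at a (c * x y - x y * c) = eval_at a c * eval_at a (x y) - eval_at a (x y) * eval_at a c"
    using eval_at_minus[OF a m] eval_at_mult[OF a Cons.prems(1) y] eval_at_mult[OF a y Cons.prems(1)] by simp
  ultimately show ?case using Cons.IH[OF free_algebra_minus[OF m]] Cons.prems(2) by (simp add: mcomm_simps)
qed


text \<open>
  The diagonal of \<open>hbasis (k,k)\<close> jumps twice, so a difference of consecutive diagonal entries would not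
  determine \<open>k\<close>; that of \<open>tail_idempotent k\<close> jumps only once.
\<close>

definition witness :: "nat \<times> nat \<Rightarrow> 'f mat" where
  "witness p = (if fst p = snd p then tail_idempotent (fst p) else hbasis p)"

definition witness_substitution :: "(nat \<Rightarrow> nat \<times> nat) \<Rightarrow> nat \<Rightarrow> 'g \<Rightarrow> 'f mat" where
  "witness_substitution t i g = (if t i \<in> labels n \<and> g = label_deg (t i) then witness (t i) else 0\<^sub>m n n)"

lemma witness_\<Gamma>: 
  assumes "p \<in> labels n"
  shows "witness p \<in> \<Gamma> (label_deg p)"
proof (cases "fst p = snd p")
  case True
  then obtain k where k: "p = (k,k)" "k < n" using assms by (auto simp: labels_def)
  then show ?thesis using tail_idempotent_\<Gamma>[of k] by (simp add: witness_def label_deg_diag)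
next
  case False
  then show ?thesis using hbasis_\<Gamma>[OF assms] by (simp add: witness_def)
qed

lemma witness_substitution_graded: "graded_substitution (witness_substitution t)"
  unfolding graded_substitution_def witness_substitution_def
  by (intro allI ballI) (simp add: witness_\<Gamma> \<Gamma>_zero)

end

text \<open>
  No step occurs among the first \<open>r\<close> variables, but every diagonal label except \<open>(0,0)\<close> does. For fixed \<open>r\<close>,
  the proportion of the leading tuples without this property has, as \<open>m\<close> grows, a bound that tends to 0 as
  \<open>r\<close> grows.
\<close>

definition separable :: "nat \<Rightarrow> nat \<Rightarrow> nat \<Rightarrow> (nat \<Rightarrow> nat \<times> nat) set" where
  "separable n m r = {t \<in> leading n m. steps m t \<subseteq> {r..<m} \<and>
     (\<forall>l < n - 1. \<exists>i. i < r \<and> i < m \<and> t i = (Suc l, Suc l))}"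

context graded_star_UT begin

lemma witness_letter_diag:
  assumes "t' i = (k,k)" "k < n" "label_deg (t i) = \<one>\<^bsub>G\<^esub>"
  shows "letter_value star (witness_substitution t') (Letter i (label_deg (t i)) False) = tail_idempotent k"
  using assms label_deg_diag[OF assms(2)]
  by (simp add: letter_value_def witness_substitution_def witness_def labels_def)

lemma witness_letter_step:
  assumes "t' i = (a, Suc a)" "Suc a < n"
  shows "letter_value star (witness_substitution t') (Letter i g \<delta>) \<in>
     (if \<delta> then corner_ideal n (n - 1 - Suc a) (n - 1 - a) else corner_ideal n a (Suc a))"
proof -
  have lab: "(a, Suc a) \<in> labels n" using assms by (simp add: labels_def)
  have "hbasis (a, Suc a) \<in> corner_ideal n a (Suc a)" using hbasis_corner[OF lab] by simp
  then have y: "witness_substitution t' i g \<in> corner_ideal n a (Suc a)"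
    using assms by (simp add: witness_substitution_def witness_def zero_corner_ideal)
  show ?thesis
  proof (cases \<delta>)
    case True
    have "star (witness_substitution t' i g) \<in> corner_ideal n (n - 1 - Suc a) (n - 1 - a)"
      by (rule star_corner_ideal[OF y]) (use assms in auto)
    then show ?thesis using True by (simp only: letter_value_def letter.sel if_True)
  next
    case False
    then show ?thesis using y by (simp only: letter_value_def letter.sel if_False)
  qed
qed

lemma witness_letter_step_JJ:
  assumes "t' i = (a, Suc a)" "Suc a < n"
  shows "letter_value star (witness_substitution t') (Letter i g \<delta>) \<in> JJ n (Suc 0)"
proof -
  have "n - 1 - a - (n - 1 - Suc a) = Suc 0" "Suc a - a = Suc 0" using assms(2) by auto
  then show ?thesis
    using witness_letter_step[of t' i a, OF assms, of g \<delta>] corner_ideal_JJ[of _ n a "Suc a"]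
      corner_ideal_JJ[of _ n "n - 1 - Suc a" "n - 1 - a"] by (metis (full_types))
qed

lemma witness_letter_step_entry:
  assumes a: "t' i = (a, Suc a)" "Suc a < n" and b: "t i = (b, Suc b)" "Suc b < n"
    and l: "(if \<delta> then n - 1 - 1 - b else b) = l"
  shows "letter_value star (witness_substitution t') (Letter i (label_deg (t i)) \<delta>) $$ (l, Suc l) \<noteq> 0 \<longleftrightarrow> a = b"
proof -
  let ?v = "letter_value star (witness_substitution t') (Letter i (label_deg (t i)) \<delta>)"
  have ln: "Suc l < n" using l b by (auto split: if_splits)
  have 1: "?v $$ (l, Suc l) = 0" if "a \<noteq> b"
  proof (cases \<delta>)
    case True
    have e: "n - 1 - a = Suc (n - 1 - Suc a)" using a by auto
    have "?v \<in> corner_ideal n (n - 1 - Suc a) (Suc (n - 1 - Suc a))"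
      using witness_letter_step[of t' i a, OF a, of "label_deg (t i)" \<delta>] True unfolding e by simp
    moreover have "l \<noteq> n - 1 - Suc a" using l True that a b by auto
    ultimately show ?thesis using corner_ideal_superdiag ln by blast
  next
    case False
    then have "?v \<in> corner_ideal n a (Suc a)" "l \<noteq> a"
      using witness_letter_step[of t' i a, OF a, of "label_deg (t i)" \<delta>] l that by auto
    then show ?thesis using corner_ideal_superdiag ln by blast
  qed
  have 2: "?v $$ (l, Suc l) \<noteq> 0" if "a = b"
  proof -
    have lab: "(b, Suc b) \<in> labels n" using b by (simp add: labels_def)
    have y: "witness_substitution t' i (label_deg (t i)) = hbasis (b, Suc b)"
      using a b that lab by (simp add: witness_substitution_def witness_def)
    have c: "hbasis (b, Suc b) \<in> corner_ideal n b (Suc b)" "hbasis (b, Suc b) $$ (b, Suc b) \<noteq> 0"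
      using hbasis_corner[OF lab] hbasis_entry[OF lab] by simp_all
    show ?thesis
    proof (cases \<delta>)
      case True
      then have "l = n - 2 - b" using l by simp
      then show ?thesis using star_superdiag[OF b(2) c] True y by (simp only: letter_value_def letter.sel if_True not_False_eq_True)
    next
      case False
      then have "l = b" using l by simp
      then show ?thesis using c(2) False y by (simp only: letter_value_def letter.sel if_False not_False_eq_True)
    qed
  qed
  show ?thesis using 1 2 by blast
qed

text \<open>
  The polynomial is the product of the variables with label \<open>(0,0)\<close> and, for \<open>l = 0, \<dots>, n - 2\<close>, of the
  iterated commutators that start with the variable whose step leads from \<open>l\<close> to \<open>Suc l\<close>, possibly starred,
  and continue with all the variables with label \<open>(Suc l, Suc l)\<close>, beginning with one among the first \<open>r\<close>.
  At the witnesses of another separable tuple, the latter is still not a step, so each of the \<open>n - 1\<close>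
  commutators lies in the radical. A nonzero corner entry leaves no room for any further strictly triangular
  factor, hence the two tuples have the same steps; the corner entry is then a product of superdiagonal entries
  and of differences of diagonal entries, and these are nonzero only if all labels agree.
\<close>

lemma separating_polynomial:
  assumes t: "t \<in> separable n m r"
  shows "\<exists>f \<in> multilinear_on G {..<m}. \<forall>t' \<in> separable n m r.
     eval_at (witness_substitution t') f $$ (0, n - 1) \<noteq> 0 \<longleftrightarrow> t = t'"
proof -
  let ?K = "steps m t"
  have lead: "s \<in> {..<m} \<rightarrow>\<^sub>E labels n" "card (steps m s) = n - 1"
    "\<And>k. k \<in> steps m s \<Longrightarrow> snd (s k) = Suc (fst (s k))" "balanced (n - 1) (steps m s) (fst \<circ> s)"
    "steps m s \<subseteq> {r..<m}" "\<And>l. l < n - 1 \<Longrightarrow> \<exists>i. i < r \<and> i < m \<and> s i = (Suc l, Suc l)"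
    if "s \<in> separable n m r" for s
    using that by (auto simp: separable_def leading_def)
  have lab: "s i \<in> labels n" if "s \<in> separable n m r" "i < m" for s i using lead(1)[OF that(1)] that(2) by auto
  have step: "\<exists>a. s i = (a, Suc a) \<and> Suc a < n" if "s \<in> separable n m r" "i \<in> steps m s" for s i
  proof -
    have "s i \<in> labels n" using lab[OF that(1)] that(2) by (simp add: steps_def)
    then show ?thesis using lead(3)[OF that] by (cases "s i") (auto simp: labels_def)
  qed
  have diag: "\<exists>k. s i = (k,k) \<and> k < n" if "s \<in> separable n m r" "i < m" "i \<notin> steps m s" for s i
    using lab[OF that(1,2)] that(2,3) by (cases "s i") (auto simp: labels_def steps_def)
  obtain \<delta> where bij: "bij_betw (\<lambda>k. if \<delta> k then n - 1 - 1 - (fst \<circ> t) k else (fst \<circ> t) k) ?K {..<n - 1}"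
    using lead(4)[OF t] unfolding balanced_def by blast
  define \<phi> where "\<phi> k = (if \<delta> k then n - 1 - 1 - fst (t k) else fst (t k))" for k
  have "\<phi> = (\<lambda>k. if \<delta> k then n - 1 - 1 - (fst \<circ> t) k else (fst \<circ> t) k)" by (rule ext) (simp add: \<phi>_def)
  then have bij\<phi>: "bij_betw \<phi> ?K {..<n - 1}" using bij by (simp only:)
  (* h l is the variable that makes the step from l to Suc l once it is starred according to \<delta>. *)
  define h where "h = inv_into ?K \<phi>"
  have bijh: "bij_betw h {..<n - 1} ?K" unfolding h_def by (rule bij_betw_inv_into[OF bij\<phi>])
  have h: "h l \<in> ?K" "\<phi> (h l) = l" if "l < n - 1" for l
    using bij_betwE[OF bijh] bij_betw_inv_into_right[OF bij\<phi>, of l] that by (auto simp: h_def)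
  define grp where "grp l = {i. i < m \<and> t i = (Suc l, Suc l)}" for l
  define S0 where "S0 = {i. i < m \<and> t i = (0,0)}"
  have fin: "finite (grp l)" "finite S0" for l by (auto simp: grp_def S0_def)
  have notK: "i \<notin> ?K" if "i \<in> grp l \<or> i \<in> S0" for i l using that by (auto simp: grp_def S0_def steps_def)
  have "\<forall>l\<in>{..<n - 1}. \<exists>i. i < r \<and> i < m \<and> t i = (Suc l, Suc l)" using lead(6)[OF t] by simp
  then obtain z where "\<forall>l\<in>{..<n - 1}. z l < r \<and> z l < m \<and> t (z l) = (Suc l, Suc l)"
    using bchoice[of "{..<n - 1}" "\<lambda>l i. i < r \<and> i < m \<and> t i = (Suc l, Suc l)"] by blast
  then have z: "\<And>l. l < n - 1 \<Longrightarrow> z l < r \<and> z l < m \<and> t (z l) = (Suc l, Suc l)" by blast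
  (* z l comes first, so that the innermost bracket already lies in the radical. *)
  define ys where "ys l = z l # sorted_list_of_set (grp l - {z l})" for l
  have ys: "set (ys l) = grp l" "distinct (ys l)" if "l < n - 1" for l
    using z[OF that] fin by (auto simp: ys_def grp_def)
  define s0 where "s0 = sorted_list_of_set S0"
  have s0: "set s0 = S0" "distinct s0" using fin by (simp_all add: s0_def)
  define \<delta>' where "\<delta>' k = (k \<in> ?K \<and> \<delta> k)" for k
  define ltr where "ltr i = Letter i (label_deg (t i)) (\<delta>' i)" for i
  define x :: "nat \<Rightarrow> 'g letter word \<Rightarrow>\<^sub>0 'f" where "x i = Poly_Mapping.single (Word [ltr i]) 1" for i
  have degG: "deg (ltr i) \<in> carrier G" if "i < m" for i
    using label_deg[OF lab[OF t that]] by (simp add: ltr_def)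
  have x: "x i \<in> multilinear_on G {i}" if "i < m" for i
    using multilinear_on_letter[OF degG[OF that]] by (simp add: x_def ltr_def)
  have hm: "h l < m" if "l < n - 1" for l using h(1)[OF that] by (simp add: steps_def)
  define c where "c l = pcomm x (x (h l)) (ys l)" for l
  have c: "c l \<in> multilinear_on G ({h l} \<union> grp l)" if l: "l < n - 1" for l
    unfolding c_def ys(1)[OF l, symmetric]
  proof (rule pcomm_multilinear[OF x[OF hm[OF l]] _ ys(2)[OF l]])
    show "{h l} \<inter> set (ys l) = {}" using notK h(1)[OF l] ys(1)[OF l] by blast
    show "x i \<in> multilinear_on G {i}" if "i \<in> set (ys l)" for i
      using x that ys(1)[OF l] by (simp add: grp_def)
  qed
  have p0: "pprod x s0 \<in> multilinear_on G S0"
  proof -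
    have "pprod x s0 \<in> multilinear_on G (\<Union>i\<in>set s0. {i})"
      by (rule pprod_multilinear[OF _ s0(2)]) (use x s0(1) in \<open>auto simp: S0_def\<close>)
    then show ?thesis using s0(1) by simp
  qed
  have p1: "pprod c [0..<n - 1] \<in> multilinear_on G (\<Union>l\<in>{..<n - 1}. {h l} \<union> grp l)"
  proof -
    have "pprod c [0..<n - 1] \<in> multilinear_on G (\<Union>l\<in>set [0..<n - 1]. {h l} \<union> grp l)"
    proof (rule pprod_multilinear)
      show "({h i} \<union> grp i) \<inter> ({h j} \<union> grp j) = {}" if ij: "i \<in> set [0..<n - 1]" "j \<in> set [0..<n - 1]" "i \<noteq> j" for i j
      proof -
        have ij': "i < n - 1" "j < n - 1" using ij by auto
        have "h i \<noteq> h j" using h(2)[OF ij'(1)] h(2)[OF ij'(2)] ij(3) by metis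
        moreover have "h i \<notin> grp j" "h j \<notin> grp i" using notK h(1)[OF ij'(1)] h(1)[OF ij'(2)] by blast+
        moreover have "grp i \<inter> grp j = {}" using ij(3) by (auto simp: grp_def)
        ultimately show ?thesis by blast
      qed
    qed (use c in auto)
    then show ?thesis by (simp add: atLeast0LessThan)
  qed
  define f where "f = pprod x s0 * pprod c [0..<n - 1]"
  have hK: "h ` {..<n - 1} = ?K" using bijh by (simp add: bij_betw_def)
  have cover: "S0 \<union> (\<Union>l\<in>{..<n - 1}. {h l} \<union> grp l) = {..<m}"
  proof
    show "S0 \<union> (\<Union>l\<in>{..<n - 1}. {h l} \<union> grp l) \<subseteq> {..<m}" using hm by (auto simp: S0_def grp_def)
    show "{..<m} \<subseteq> S0 \<union> (\<Union>l\<in>{..<n - 1}. {h l} \<union> grp l)"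
    proof
      fix i assume "i \<in> {..<m}"
      then have i: "i < m" by simp
      show "i \<in> S0 \<union> (\<Union>l\<in>{..<n - 1}. {h l} \<union> grp l)"
      proof (cases "i \<in> ?K")
        case True
        then show ?thesis using hK by blast
      next
        case False
        obtain k where k: "t i = (k,k)" "k < n" using diag[OF t i False] by blast
        show ?thesis
        proof (cases k)
          case 0
          then show ?thesis using i k by (simp add: S0_def)
        next
          case (Suc l)
          then have "l \<in> {..<n - 1}" "i \<in> grp l" using i k by (auto simp: grp_def)
          then show ?thesis by blast
        qed
      qed
    qed
  qed
  have fM: "f \<in> multilinear_on G {..<m}"
  proof -
    have "S0 \<inter> (\<Union>l\<in>{..<n - 1}. {h l} \<union> grp l) = {}"
      using notK hK by (auto simp: S0_def grp_def)
    from multilinear_on_mult[OF p0 p1 this] show ?thesis unfolding f_def cover .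
  qed
  have "eval_at (witness_substitution t') f $$ (0, n - 1) \<noteq> 0 \<longleftrightarrow> t = t'" if t': "t' \<in> separable n m r" for t'
  proof -
    let ?a = "witness_substitution t'"
    have a: "UT_substitution ?a" by (rule graded_substitution_UT[OF witness_substitution_graded])
    define v where "v i = letter_value star ?a (ltr i)" for i
    have vx: "eval_at ?a (x i) = v i" if "i < m" for i
      unfolding x_def v_def by (rule eval_at_letter[OF a degG[OF that]])
    have xc: "x i \<in> carrier (free_algebra G)" if "i < m" for i by (rule multilinear_on_carrier[OF x[OF that]])
    define C where "C l = mcomm v (v (h l)) (ys l)" for l
    have mcomm_cong: "mcomm w u zs = mcomm v u zs" if "\<And>i. i \<in> set zs \<Longrightarrow> w i = v i" for w u and zs :: "nat list"
      using that by (induction zs arbitrary: u) (simp_all add: mcomm_simps)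
    have mprod_cong: "mprod n w zs = mprod n w' zs" if "\<And>i. i \<in> set zs \<Longrightarrow> w i = w' i" for w w' :: "nat \<Rightarrow> 'f mat" and zs
      using that by (induction zs) (simp_all add: mprod_simps)
    have ysm: "i < m" if "l < n - 1" "i \<in> set (ys l)" for i l using that ys(1)[OF that(1)] by (simp add: grp_def)
    have cC: "c l \<in> carrier (free_algebra G) \<and> eval_at ?a (c l) = C l" if l: "l < n - 1" for l
    proof -
      have "c l \<in> carrier (free_algebra G) \<and> eval_at ?a (c l) = mcomm (\<lambda>i. eval_at ?a (x i)) (eval_at ?a (x (h l))) (ys l)"
        unfolding c_def by (rule eval_at_pcomm[OF a xc[OF hm[OF l]]]) (rule xc, rule ysm[OF l])
      moreover have "mcomm (\<lambda>i. eval_at ?a (x i)) (eval_at ?a (x (h l))) (ys l) = C l"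
        unfolding C_def vx[OF hm[OF l]] by (rule mcomm_cong) (rule vx, rule ysm[OF l])
      ultimately show ?thesis by simp
    qed
    have s0m: "i < m" if "i \<in> set s0" for i using that s0(1) by (simp add: S0_def)
    have E0: "pprod x s0 \<in> carrier (free_algebra G) \<and> eval_at ?a (pprod x s0) = mprod n v s0"
    proof -
      have "pprod x s0 \<in> carrier (free_algebra G) \<and> eval_at ?a (pprod x s0) = mprod n (\<lambda>i. eval_at ?a (x i)) s0"
        by (rule eval_at_pprod[OF a]) (rule xc, rule s0m)
      moreover have "mprod n (\<lambda>i. eval_at ?a (x i)) s0 = mprod n v s0" by (rule mprod_cong) (rule vx, rule s0m)
      ultimately show ?thesis by simp
    qed
    have E1: "pprod c [0..<n - 1] \<in> carrier (free_algebra G) \<and> eval_at ?a (pprod c [0..<n - 1]) = mprod n C [0..<n - 1]"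
    proof -
      have "pprod c [0..<n - 1] \<in> carrier (free_algebra G) \<and>
          eval_at ?a (pprod c [0..<n - 1]) = mprod n (\<lambda>l. eval_at ?a (c l)) [0..<n - 1]"
        by (rule eval_at_pprod[OF a]) (use cC in auto)
      moreover have "mprod n (\<lambda>l. eval_at ?a (c l)) [0..<n - 1] = mprod n C [0..<n - 1]"
        by (rule mprod_cong) (use cC in auto)
      ultimately show ?thesis by simp
    qed
    have Ef: "eval_at ?a f = mprod n v s0 * mprod n C [0..<n - 1]"
      unfolding f_def using eval_at_mult[OF a conjunct1[OF E0] conjunct1[OF E1]] E0 E1 by simp
    have vU: "v i \<in> UT n" if "i < m" for i unfolding v_def by (rule letter_value_UT[OF a degG[OF that]])
    have n0: "0 < n" "n - 1 < n" using n_pos by auto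
    (* e i is the power of the radical in which v i is known to lie; adding these exponents over all
       factors of f gives n - 1 for the commutators plus the number of steps of t' outside K. *)
    define e :: "nat \<Rightarrow> nat" where "e i = (if i \<in> steps m t' then 1 else 0)" for i
    have vJ: "v i \<in> JJ n (e i)" if i: "i < m" for i
    proof (cases "i \<in> steps m t'")
      case True
      obtain a' where "t' i = (a', Suc a')" "Suc a' < n" using step[OF t' True] by blast
      then show ?thesis using True witness_letter_step_JJ unfolding v_def ltr_def by (simp add: e_def)
    next
      case False
      then show ?thesis using vU[OF i] by (simp add: e_def)
    qed
    have CJ: "C l \<in> JJ n (Suc (sum_list (map e (ys l))))" if l: "l < n - 1" for l
    proof -
      have "z l \<notin> steps m t'" using z[OF l] lead(5)[OF t'] by auto
      then have ez: "e (z l) = 0" by (simp add: e_def)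
      have zm: "z l < m" using z[OF l] by blast
      have "v (h l) * v (z l) - v (z l) * v (h l) \<in> JJ n 1"
        by (rule commutator_JJ[OF vU[OF hm[OF l]] vU[OF zm]])
      then have "mcomm v (v (h l) * v (z l) - v (z l) * v (h l)) (sorted_list_of_set (grp l - {z l})) \<in>
          JJ n (1 + sum_list (map e (sorted_list_of_set (grp l - {z l}))))"
        by (rule mcomm_JJ) (rule vJ, use fin in \<open>simp add: grp_def\<close>)
      then show ?thesis using ez by (simp add: C_def ys_def mcomm_simps)
    qed
    have same_steps: "steps m t' = ?K" if nz: "eval_at ?a f $$ (0, n - 1) \<noteq> 0"
    proof -
      have "mprod n v s0 \<in> JJ n (sum_list (map e s0))" by (rule mprod_JJ) (rule vJ, rule s0m)
      moreover have "mprod n C [0..<n - 1] \<in> JJ n (sum_list (map (\<lambda>l. Suc (sum_list (map e (ys l)))) [0..<n - 1]))"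
        by (rule mprod_JJ) (rule CJ, simp)
      ultimately have "eval_at ?a f \<in> JJ n (sum_list (map e s0) + sum_list (map (\<lambda>l. Suc (sum_list (map e (ys l)))) [0..<n - 1]))"
        unfolding Ef by (rule JJ_mult)
      then have le: "sum_list (map e s0) + sum_list (map (\<lambda>l. Suc (sum_list (map e (ys l)))) [0..<n - 1]) \<le> n - 1"
        using JJ_entry[OF _ n0] nz by (metis add_0 not_le)
      have "sum_list (map (\<lambda>l. Suc (sum_list (map e (ys l)))) [0..<n - 1]) =
          (n - 1) + (\<Sum>l<n - 1. sum_list (map e (ys l)))"
        by (simp only: interv_sum_list_conv_sum_set_nat set_upt Suc_eq_plus1 sum.distrib atLeast0LessThan) simp
      then have zero: "sum_list (map e s0) = 0" "(\<Sum>l<n - 1. sum_list (map e (ys l))) = 0" using le by linarith+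
      have e0: "e i = 0" if "i \<in> S0 \<or> (\<exists>l<n - 1. i \<in> grp l)" for i
        using that
      proof
        assume "i \<in> S0"
        then show ?thesis using zero(1) s0(1) by auto
      next
        assume "\<exists>l<n - 1. i \<in> grp l"
        then obtain l where l: "l < n - 1" "i \<in> set (ys l)" using ys(1) by blast
        then have "sum_list (map e (ys l)) = 0" using zero(2) by simp
        then show ?thesis using l(2) by auto
      qed
      have "steps m t' \<subseteq> ?K"
      proof
        fix i assume i: "i \<in> steps m t'"
        then have "i \<in> {..<m}" "e i \<noteq> 0" by (auto simp: steps_def e_def)
        then have iS: "i \<in> S0 \<union> (\<Union>l\<in>{..<n - 1}. {h l} \<union> grp l)" and ei: "e i \<noteq> 0" unfolding cover by auto
        have "i \<notin> S0" "\<not> (\<exists>l<n - 1. i \<in> grp l)" using e0[of i] ei by blast+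
        then have "i \<in> h ` {..<n - 1}" using iS by auto
        then show "i \<in> ?K" using hK by simp
      qed
      then show ?thesis using lead(2)[OF t] lead(2)[OF t'] by (intro card_subset_eq) auto
    qed
    (* With equal steps, the corner entry is the product of the entries at (0,0) of the first factors
       and of the superdiagonal entries of the commutators, which are known from mcomm_superdiag. *)
    have entry: "eval_at ?a f $$ (0, n - 1) \<noteq> 0 \<longleftrightarrow> (\<forall>i \<in> S0. v i $$ (0,0) \<noteq> 0) \<and>
        (\<forall>l < n - 1. v (h l) $$ (l, Suc l) \<noteq> 0 \<and> (\<forall>i \<in> grp l. v i $$ (Suc l, Suc l) - v i $$ (l,l) \<noteq> 0))"
      if K: "steps m t' = ?K"
    proof -
      have hJ: "v (h l) \<in> JJ n (Suc 0)" if l: "l < n - 1" for l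
        using vJ[OF hm[OF l]] h(1)[OF l] K by (simp add: e_def)
      have CJ1: "C l \<in> JJ n (Suc 0)" if "l + 1 < n" for l
        using CJ[of l] that JJ_antimono[of "C l" n "Suc (sum_list (map e (ys l)))" "Suc 0"] by simp
      have J0: "mprod n v s0 \<in> JJ n 0" using mprod_UT[of s0 v n] vU s0m by simp
      have J1: "mprod n C [0..<n - 1] \<in> JJ n (n - 1)"
        using mprod_superdiag[of n C 0] CJ1 n0(1) by simp
      have d1: "mprod n C [0..<n - 1] $$ (0, n - 1) = prod_list (map (\<lambda>l. C l $$ (l, Suc l)) [0..<n - 1])"
        using mprod_superdiag[of n C 0] CJ1 n0(1) by simp
      have e1: "eval_at ?a f $$ (0, n - 1) = mprod n v s0 $$ (0,0) * mprod n C [0..<n - 1] $$ (0, n - 1)"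
        unfolding Ef using JJ_mult_corner[OF J0 J1, of 0] n0 by (simp del: index_mult_mat(1))
      have e2: "mprod n v s0 $$ (0,0) = prod_list (map (\<lambda>i. v i $$ (0,0)) s0)"
        by (rule mprod_diag[OF vU n0(1)]) (rule s0m)
      have e3: "C l $$ (l, Suc l) = v (h l) $$ (l, Suc l) * prod_list (map (\<lambda>i. v i $$ (Suc l, Suc l) - v i $$ (l,l)) (ys l))"
        if l: "l < n - 1" for l
        unfolding C_def by (rule mcomm_superdiag[OF hJ[OF l]]) (use l vU ysm[OF l] in auto)
      have e4: "C l $$ (l, Suc l) \<noteq> 0 \<longleftrightarrow> v (h l) $$ (l, Suc l) \<noteq> 0 \<and>
          (\<forall>i \<in> grp l. v i $$ (Suc l, Suc l) - v i $$ (l,l) \<noteq> 0)" if l: "l < n - 1" for l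
        unfolding e3[OF l] mult_eq_0_iff de_Morgan_disj prod_list_map_nonzero ys(1)[OF l] ..
      have "eval_at ?a f $$ (0, n - 1) \<noteq> 0 \<longleftrightarrow> (\<forall>i \<in> S0. v i $$ (0,0) \<noteq> 0) \<and> (\<forall>l \<in> set [0..<n - 1]. C l $$ (l, Suc l) \<noteq> 0)"
        unfolding e1 e2 d1 mult_eq_0_iff de_Morgan_disj prod_list_map_nonzero s0(1) ..
      also have "(\<forall>l \<in> set [0..<n - 1]. C l $$ (l, Suc l) \<noteq> 0) \<longleftrightarrow> (\<forall>l < n - 1. C l $$ (l, Suc l) \<noteq> 0)" by auto
      also have "(\<forall>l < n - 1. C l $$ (l, Suc l) \<noteq> 0) \<longleftrightarrow> (\<forall>l < n - 1. v (h l) $$ (l, Suc l) \<noteq> 0 \<and>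
          (\<forall>i \<in> grp l. v i $$ (Suc l, Suc l) - v i $$ (l,l) \<noteq> 0))"
        by (intro all_cong1 imp_cong refl) (rule e4)
      finally show ?thesis .
    qed
    have vdiag: "\<exists>k<n. t' i = (k,k) \<and> v i = tail_idempotent k" if i: "i < m" "i \<notin> ?K" and K: "steps m t' = ?K" for i
    proof -
      obtain k where k: "t' i = (k,k)" "k < n" using diag[OF t' i(1)] i(2) K by blast
      obtain k0 where k0: "t i = (k0,k0)" "k0 < n" using diag[OF t i] by blast
      have "label_deg (t i) = \<one>\<^bsub>G\<^esub>" using label_deg_diag[OF k0(2)] k0(1) by simp
      then have "v i = tail_idempotent k"
        unfolding v_def ltr_def using witness_letter_diag[of t' i k t] k i(2) by (simp add: \<delta>'_def)
      then show ?thesis using k by blast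
    qed
    have vstep: "v (h l) $$ (l, Suc l) \<noteq> 0 \<longleftrightarrow> t' (h l) = t (h l)" if l: "l < n - 1" and K: "steps m t' = ?K" for l
    proof -
      obtain a' where a': "t' (h l) = (a', Suc a')" "Suc a' < n" using step[OF t'] h(1)[OF l] K by blast
      obtain b where b: "t (h l) = (b, Suc b)" "Suc b < n" using step[OF t h(1)[OF l]] by blast
      have "(if \<delta>' (h l) then n - 1 - 1 - b else b) = l"
        using h[OF l] b by (cases "\<delta> (h l)") (simp_all add: \<phi>_def \<delta>'_def)
      from witness_letter_step_entry[of t' "h l" a' t b "\<delta>' (h l)" l, OF a' b this] show ?thesis
        unfolding v_def ltr_def using a' b by simp
    qed
    show ?thesis
    proof
      assume nz: "eval_at ?a f $$ (0, n - 1) \<noteq> 0"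
      note K = same_steps[OF nz]
      note en = iffD1[OF entry[OF K] nz]
      have "t i = t' i" if i: "i < m" for i
      proof (cases "i \<in> ?K")
        case True
        then obtain l where "l < n - 1" "i = h l" using hK by auto
        then show ?thesis using vstep[OF _ K] en by metis
      next
        case False
        obtain k where k: "k < n" "t' i = (k,k)" "v i = tail_idempotent k" using vdiag[OF i False K] by blast
        have "i \<in> S0 \<union> (\<Union>l\<in>{..<n - 1}. {h l} \<union> grp l)" unfolding cover using i by simp
        then consider "i \<in> S0" | l where "l < n - 1" "i \<in> grp l" using False hK by blast
        then show ?thesis
        proof cases
          case 1
          then have "tail_idempotent k $$ (0,0) \<noteq> 0" using en k(3) by metis
          then have "k = 0" using tail_idempotent_diag[OF n0(1), of k] by (simp split: if_splits)
          then show ?thesis using 1 k(2) by (simp add: S0_def)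
        next
          case (2 l)
          then have ln: "Suc l < n" "l < n" by auto
          have "tail_idempotent k $$ (Suc l, Suc l) - tail_idempotent k $$ (l,l) \<noteq> 0" using en 2 k(3) by metis
          then have "k = Suc l" using tail_idempotent_diag[OF ln(1), of k] tail_idempotent_diag[OF ln(2), of k]
            by (simp split: if_splits)
          then show ?thesis using 2 k(2) by (simp add: grp_def)
        qed
      qed
      then show "t = t'" using lead(1)[OF t] lead(1)[OF t'] by (intro PiE_ext) auto
    next
      assume eq: "t = t'"
      then have K: "steps m t' = ?K" by simp
      have "v i $$ (0,0) \<noteq> 0" if i: "i \<in> S0" for i
      proof -
        have "i < m" "i \<notin> ?K" using i notK by (auto simp: S0_def)
        then obtain k where "k < n" "t' i = (k,k)" "v i = tail_idempotent k" using vdiag K by blast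
        then show ?thesis using i eq tail_idempotent_diag[OF n0(1), of k] by (simp add: S0_def)
      qed
      moreover have "v i $$ (Suc l, Suc l) - v i $$ (l,l) \<noteq> 0" if i: "l < n - 1" "i \<in> grp l" for i l
      proof -
        have "i < m" "i \<notin> ?K" using i notK by (auto simp: grp_def)
        then obtain k where "k < n" "t' i = (k,k)" "v i = tail_idempotent k" using vdiag K by blast
        moreover have "Suc l < n" "l < n" using i by auto
        ultimately show ?thesis
          using i(2) eq tail_idempotent_diag[of "Suc l" k] tail_idempotent_diag[of l k] by (simp add: grp_def)
      qed
      moreover have "v (h l) $$ (l, Suc l) \<noteq> 0" if "l < n - 1" for l using vstep[OF that K] eq by simp
      ultimately show "eval_at ?a f $$ (0, n - 1) \<noteq> 0" using entry[OF K] by blast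
    qed
  qed
  then show ?thesis using fM by blast
qed

lemma card_separable_le_codim: "card (separable n m r) \<le> star_codim G (ut_algebra n) \<Gamma> star m"
proof -
  have "\<forall>t\<in>separable n m r. \<exists>f. f \<in> multilinear_on G {..<m} \<and> (\<forall>t' \<in> separable n m r.
     eval_at (witness_substitution t') f $$ (0, n - 1) \<noteq> 0 \<longleftrightarrow> t = t')"
    using separating_polynomial unfolding Bex_def by (rule ballI)
  from bchoice[OF this] obtain F where F: "\<forall>t\<in>separable n m r. F t \<in> multilinear_on G {..<m} \<and> (\<forall>t' \<in> separable n m r.
     eval_at (witness_substitution t') (F t) $$ (0, n - 1) \<noteq> 0 \<longleftrightarrow> t = t')" ..
  have fin: "finite (separable n m r)"
    by (rule finite_subset[OF _ finite_tuples[of m]]) (auto simp: separable_def leading_def)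
  show ?thesis
  proof (rule star_codim_bounds_leading(2)[of _ F m witness_substitution, OF fin])
    show "F t \<in> multilinear_on G {..<m}" if "t \<in> separable n m r" for t
      using bspec[OF F that] by (rule conjunct1)
    show "graded_substitution (witness_substitution t)" for t by (rule witness_substitution_graded)
    show "eval_at (witness_substitution t) (F s) $$ (0, n - 1) \<noteq> 0 \<longleftrightarrow> s = t"
      if "s \<in> separable n m r" "t \<in> separable n m r" for s t
      by (rule bspec[OF conjunct2[OF bspec[OF F that(1)]] that(2)])
  qed
qed

end

section \<open>Counting tuples of labels\<close>

text \<open>
  For \<open>f\<close> an involution of \<open>C\<close>: the maps that become bijective when \<open>f\<close> is applied to some of their values.
  For the reflection of \<open>{..<N}\<close> these are the balanced maps.
\<close>

definition balanced_maps :: "('c \<Rightarrow> 'c) \<Rightarrow> 'c set \<Rightarrow> 'k set \<Rightarrow> ('k \<Rightarrow> 'c) set" where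
  "balanced_maps f C K = {\<tau> \<in> K \<rightarrow>\<^sub>E C. \<exists>\<delta>. bij_betw (\<lambda>k. if \<delta> k then f (\<tau> k) else \<tau> k) K C}"

text \<open>
  When \<open>C\<close> splits into two \<open>f\<close>-invariant parts, a map is determined by the set of points that it sends into
  the first part and by its restrictions to this set and its complement.
\<close>

lemma balanced_maps_split:
  assumes K: "finite K" and D: "C = D \<union> C'" "D \<inter> C' = {}" and f: "f ` D \<subseteq> D" "f ` C' \<subseteq> C'"
  shows "bij_betw (\<lambda>\<tau>. let E = {k \<in> K. \<tau> k \<in> D} in (E, restrict \<tau> E, restrict \<tau> (K - E)))
     (balanced_maps f C K)
     (SIGMA E : {E. E \<subseteq> K \<and> card E = card D}. balanced_maps f D E \<times> balanced_maps f C' (K - E))"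
proof -
  let ?F = "\<lambda>\<tau>. let E = {k \<in> K. \<tau> k \<in> D} in (E, restrict \<tau> E, restrict \<tau> (K - E))"
  let ?H = "\<lambda>(E, \<alpha>, \<beta>). restrict (\<lambda>k. if k \<in> E then \<alpha> k else \<beta> k) K"
  let ?T = "SIGMA E : {E. E \<subseteq> K \<and> card E = card D}. balanced_maps f D E \<times> balanced_maps f C' (K - E)"
  show ?thesis
  proof (rule bij_betw_byWitness[where f' = ?H])
    show "?F ` balanced_maps f C K \<subseteq> ?T"
    proof
      fix y assume "y \<in> ?F ` balanced_maps f C K"
      then obtain \<tau> where \<tau>: "\<tau> \<in> balanced_maps f C K" "y = ?F \<tau>" by blast
      then obtain \<delta> where t: "\<tau> \<in> K \<rightarrow>\<^sub>E C" and b: "bij_betw (\<lambda>k. if \<delta> k then f (\<tau> k) else \<tau> k) K C"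
        unfolding balanced_maps_def by blast
      define g where "g k = (if \<delta> k then f (\<tau> k) else \<tau> k)" for k
      have bg: "bij_betw g K C" using b unfolding g_def .
      define E where "E = {k \<in> K. \<tau> k \<in> D}"
      have gD: "g k \<in> D \<longleftrightarrow> \<tau> k \<in> D" if k: "k \<in> K" for k
      proof -
        have "\<tau> k \<in> D \<or> \<tau> k \<in> C'" using t k D(1) by auto
        then show ?thesis using f D(2) unfolding g_def by auto
      qed
      have EK: "E \<subseteq> K" by (auto simp: E_def)
      have gE: "g ` E = D"
      proof
        show "g ` E \<subseteq> D" using gD by (auto simp: E_def)
        show "D \<subseteq> g ` E"
        proof
          fix d assume d: "d \<in> D"
          then have "d \<in> g ` K" using bg D(1) by (auto simp: bij_betw_def)
          then obtain k where "k \<in> K" "d = g k" by blast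
          then show "d \<in> g ` E" using gD d by (auto simp: E_def)
        qed
      qed
      have gE': "g ` (K - E) = C'"
      proof
        show "g ` (K - E) \<subseteq> C'" using gD bij_betwE[OF bg] D(1) by (auto simp: E_def)
        show "C' \<subseteq> g ` (K - E)"
        proof
          fix d assume d: "d \<in> C'"
          then have "d \<in> g ` K" using bg D(1) by (auto simp: bij_betw_def)
          then obtain k where k: "k \<in> K" "d = g k" by blast
          then have "k \<notin> E" using gD d D(2) by (auto simp: E_def)
          then show "d \<in> g ` (K - E)" using k by blast
        qed
      qed
      have inj: "inj_on g K" using bg by (simp add: bij_betw_def)
      have b1: "bij_betw g E D" using gE inj_on_subset[OF inj EK] by (simp add: bij_betw_def)
      have b2: "bij_betw g (K - E) C'" using gE' inj_on_subset[OF inj, of "K - E"] by (simp add: bij_betw_def)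
      have "bij_betw (\<lambda>k. if \<delta> k then f (restrict \<tau> E k) else restrict \<tau> E k) E D"
        by (rule iffD1[OF bij_betw_cong b1]) (simp add: g_def)
      moreover have "restrict \<tau> E \<in> E \<rightarrow>\<^sub>E D" by (auto simp: E_def)
      ultimately have m1: "restrict \<tau> E \<in> balanced_maps f D E" unfolding balanced_maps_def by blast
      have "bij_betw (\<lambda>k. if \<delta> k then f (restrict \<tau> (K - E) k) else restrict \<tau> (K - E) k) (K - E) C'"
        by (rule iffD1[OF bij_betw_cong b2]) (simp add: g_def)
      moreover have "restrict \<tau> (K - E) \<in> (K - E) \<rightarrow>\<^sub>E C'" using t D(1) by (auto simp: E_def)
      ultimately have m2: "restrict \<tau> (K - E) \<in> balanced_maps f C' (K - E)" unfolding balanced_maps_def by blast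
      have "card E = card D" by (rule bij_betw_same_card[OF b1])
      then show "y \<in> ?T" unfolding \<tau>(2) Let_def E_def[symmetric] using EK m1 m2 by blast
    qed
    show "?H ` ?T \<subseteq> balanced_maps f C K"
    proof
      fix y assume "y \<in> ?H ` ?T"
      then obtain E \<alpha> \<beta> where E: "E \<subseteq> K" and \<alpha>: "\<alpha> \<in> balanced_maps f D E" and \<beta>: "\<beta> \<in> balanced_maps f C' (K - E)"
        and y: "y = restrict (\<lambda>k. if k \<in> E then \<alpha> k else \<beta> k) K" by auto
      obtain \<delta>1 where a: "\<alpha> \<in> E \<rightarrow>\<^sub>E D" "bij_betw (\<lambda>k. if \<delta>1 k then f (\<alpha> k) else \<alpha> k) E D"
        using \<alpha> unfolding balanced_maps_def by blast
      obtain \<delta>2 where b: "\<beta> \<in> (K - E) \<rightarrow>\<^sub>E C'" "bij_betw (\<lambda>k. if \<delta>2 k then f (\<beta> k) else \<beta> k) (K - E) C'"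
        using \<beta> unfolding balanced_maps_def by blast
      define \<delta> where "\<delta> k = (if k \<in> E then \<delta>1 k else \<delta>2 k)" for k
      define g where "g k = (if \<delta> k then f (y k) else y k)" for k
      have "bij_betw g E D" by (rule iffD1[OF bij_betw_cong a(2)]) (use E in \<open>auto simp: g_def \<delta>_def y\<close>)
      moreover have "bij_betw g (K - E) C'" by (rule iffD1[OF bij_betw_cong b(2)]) (auto simp: g_def \<delta>_def y)
      ultimately have "bij_betw g (E \<union> (K - E)) (D \<union> C')" using D(2) by (rule bij_betw_combine)
      moreover have "E \<union> (K - E) = K" using E by blast
      ultimately have "bij_betw (\<lambda>k. if \<delta> k then f (y k) else y k) K C" unfolding g_def D(1) by simp
      moreover have "y \<in> K \<rightarrow>\<^sub>E C"
      proof (rule PiE_I)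
        fix k assume k: "k \<in> K"
        show "y k \<in> C"
        proof (cases "k \<in> E")
          case True
          then have "\<alpha> k \<in> D" using a(1) by (rule PiE_mem[rotated])
          then show ?thesis using True k D(1) unfolding y by simp
        next
          case False
          then have "\<beta> k \<in> C'" using b(1) k PiE_mem by fastforce
          then show ?thesis using False k D(1) unfolding y by simp
        qed
      qed (simp add: y)
      ultimately show "y \<in> balanced_maps f C K" unfolding balanced_maps_def by blast
    qed
    show "\<forall>\<tau>\<in>balanced_maps f C K. ?H (?F \<tau>) = \<tau>"
    proof
      fix \<tau> assume "\<tau> \<in> balanced_maps f C K"
      then have "\<tau> \<in> extensional K" by (auto simp: balanced_maps_def PiE_def)
      then have u: "\<tau> k = undefined" if "k \<notin> K" for k using that by (rule extensional_arb)
      show "?H (?F \<tau>) = \<tau>"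
      proof (rule ext)
        fix k
        show "?H (?F \<tau>) k = \<tau> k"
          using u by (cases "k \<in> K"; cases "\<tau> k \<in> D") (simp_all add: Let_def)
      qed
    qed
    show "\<forall>y\<in>?T. ?F (?H y) = y"
    proof
      fix y assume "y \<in> ?T"
      then obtain E \<alpha> \<beta> where E: "E \<subseteq> K" and a: "\<alpha> \<in> E \<rightarrow>\<^sub>E D" and b: "\<beta> \<in> (K - E) \<rightarrow>\<^sub>E C'" and y: "y = (E, \<alpha>, \<beta>)"
        unfolding balanced_maps_def by blast
      let ?\<tau> = "restrict (\<lambda>k. if k \<in> E then \<alpha> k else \<beta> k) K"
      have \<alpha>D: "\<alpha> k \<in> D" if "k \<in> E" for k using a that by (rule PiE_mem)
      have \<beta>D: "\<beta> k \<notin> D" if "k \<in> K" "k \<notin> E" for k using PiE_mem[OF b, of k] that D(2) by blast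
      have e: "{k \<in> K. ?\<tau> k \<in> D} = E"
      proof (rule Set.set_eqI)
        fix k show "k \<in> {k \<in> K. ?\<tau> k \<in> D} \<longleftrightarrow> k \<in> E"
          using E \<alpha>D[of k] \<beta>D[of k] by (cases "k \<in> K"; cases "k \<in> E") auto
      qed
      have "restrict ?\<tau> E = \<alpha>"
      proof (rule ext)
        fix k show "restrict ?\<tau> E k = \<alpha> k"
          using E PiE_arb[OF a, of k] by (cases "k \<in> E") auto
      qed
      moreover have "restrict ?\<tau> (K - E) = \<beta>"
      proof (rule ext)
        fix k show "restrict ?\<tau> (K - E) k = \<beta> k"
          using PiE_arb[OF b, of k] by (cases "k \<in> K"; cases "k \<in> E") simp_all
      qed
      ultimately show "?F (?H y) = y" unfolding y by (simp only: Let_def e case_prod_conv)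
    qed
  qed
qed

lemma finite_balanced_maps: "finite K \<Longrightarrow> finite C \<Longrightarrow> finite (balanced_maps f C K)"
  by (rule finite_subset[of _ "K \<rightarrow>\<^sub>E C"]) (auto simp: balanced_maps_def intro: finite_PiE)

lemma card_balanced_maps_split:
  assumes K: "finite K" "finite C" and D: "C = D \<union> C'" "D \<inter> C' = {}" and f: "f ` D \<subseteq> D" "f ` C' \<subseteq> C'"
    and bD: "\<And>E. E \<subseteq> K \<Longrightarrow> card E = card D \<Longrightarrow> card (balanced_maps f D E) = b"
    and bC: "\<And>E. E \<subseteq> K \<Longrightarrow> card E = card D \<Longrightarrow> card (balanced_maps f C' (K - E)) = c"
  shows "card (balanced_maps f C K) = (card K choose card D) * b * c"
proof -
  let ?S = "{E. E \<subseteq> K \<and> card E = card D}"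
  have "card (balanced_maps f C K) = card (SIGMA E : ?S. balanced_maps f D E \<times> balanced_maps f C' (K - E))"
    by (rule bij_betw_same_card[OF balanced_maps_split[OF K(1) D f]])
  also have "\<dots> = (\<Sum>E\<in>?S. card (balanced_maps f D E \<times> balanced_maps f C' (K - E)))"
  proof (rule card_SigmaI)
    show "finite ?S" using K by simp
    show "\<forall>E\<in>?S. finite (balanced_maps f D E \<times> balanced_maps f C' (K - E))"
      using K D by (auto intro!: finite_balanced_maps finite_cartesian_product intro: finite_subset)
  qed
  also have "\<dots> = (\<Sum>E\<in>?S. b * c)" using bD bC by (intro sum.cong refl) (simp add: card_cartesian_product)
  also have "\<dots> = (card K choose card D) * b * c" using n_subsets[OF K(1)] by simp
  finally show ?thesis .
qed

text \<open>
  Orbits of \<open>f\<close> are split off one at a time. A fixed point of \<open>f\<close> is the value of exactly one point. A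
  two-element orbit is shared by two points, whose values in it are arbitrary: four choices instead of the two
  of a bijection. So every two-element orbit contributes a factor 2 over the number of bijections.
\<close>

lemma card_balanced_maps:
  fixes C :: "'c set" and K :: "'k set"
  assumes "finite C" "f ` C \<subseteq> C" "\<And>c. c \<in> C \<Longrightarrow> f (f c) = c" "finite K" "card K = card C"
  shows "card (balanced_maps f C K) = fact (card C) * 2 ^ (card {c \<in> C. f c \<noteq> c} div 2)"
  using assms
proof (induction "card C" arbitrary: C K rule: less_induct)
  case less
  show ?case
  proof (cases "C = {}")
    case True
    then have "K = {}" using less.prems by simp
    then have "balanced_maps f C K = {\<lambda>_. undefined}" using True by (auto simp: balanced_maps_def bij_betw_def)
    then show ?thesis using True by simp
  next
    case False
    then obtain c where c: "c \<in> C" by blast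
    have fC: "f x \<in> C" if "x \<in> C" for x by (rule subsetD[OF less.prems(2) imageI[OF that]])
    have fc: "f c \<in> C" by (rule fC[OF c])
    show ?thesis
    proof (cases "f c = c")
      case True
      let ?C' = "C - {c}"
      have fC': "f ` ?C' \<subseteq> ?C'"
      proof
        fix y assume "y \<in> f ` ?C'"
        then obtain x where x: "x \<in> C" "x \<noteq> c" "y = f x" by blast
        have "f x \<noteq> c" using less.prems(3)[OF x(1)] True x(2) by metis
        then show "y \<in> ?C'" using x fC[OF x(1)] by simp
      qed
      have cc2: "card C = Suc (card ?C')" using less.prems(1) c by (rule card.remove)
      then have cc: "card ?C' < card C" "card C = Suc (card ?C')" by linarith+
      have IH: "card (balanced_maps f ?C' L) = fact (card ?C') * 2 ^ (card {c \<in> ?C'. f c \<noteq> c} div 2)"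
        if "finite L" "card L = card ?C'" for L :: "'k set"
      proof (rule less(1)[where C = ?C' and K = L])
        show "f ` ?C' \<subseteq> ?C'" by (rule fC')
        show "finite L" "card L = card ?C'" using that by auto
        show "card ?C' < card C" using cc by linarith
        show "finite ?C'" using less.prems(1) by simp
        show "f (f x) = x" if "x \<in> ?C'" for x using less.prems(3) that by simp
      qed
      have fix_eq: "{x \<in> ?C'. f x \<noteq> x} = {x \<in> C. f x \<noteq> x}" using True by auto
      have "card (balanced_maps f C K) = (card K choose card {c}) * 1 * (fact (card ?C') * 2 ^ (card {x \<in> C. f x \<noteq> x} div 2))"
      proof (rule card_balanced_maps_split[OF less.prems(4,1)])
        fix E assume E: "E \<subseteq> K" "card E = card {c}"
        then obtain k where k: "E = {k}" by (auto simp: card_1_singleton_iff)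
        have "balanced_maps f {c} {k} = {\<lambda>x\<in>{k}. c}"
        proof
          show "balanced_maps f {c} {k} \<subseteq> {\<lambda>x\<in>{k}. c}" by (auto simp: balanced_maps_def PiE_def extensional_def fun_eq_iff)
          have "bij_betw (\<lambda>x. if False then f ((\<lambda>x\<in>{k}. c) x) else (\<lambda>x\<in>{k}. c) x) {k} {c}" by (simp add: bij_betw_def)
          then show "{\<lambda>x\<in>{k}. c} \<subseteq> balanced_maps f {c} {k}" unfolding balanced_maps_def by (auto intro!: exI[of _ "\<lambda>_. False"])
        qed
        then show "card (balanced_maps f {c} E) = 1" using k by simp
        have "card (K - E) = card ?C'" using E less.prems(4,5) cc(2) by (simp add: card_Diff_subset finite_subset)
        then show "card (balanced_maps f ?C' (K - E)) = fact (card ?C') * 2 ^ (card {x \<in> C. f x \<noteq> x} div 2)"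
          using IH[of "K - E"] less.prems(4) fix_eq by simp
      qed (use c True fC' in auto)
      then show ?thesis using less.prems(5) cc(2) by (simp add: algebra_simps)
    next
      case False
      let ?D = "{c, f c}" and ?C' = "C - {c, f c}"
      have ffc: "f (f c) = c" using less.prems(3)[OF c] .
      have fC': "f ` ?C' \<subseteq> ?C'"
      proof
        fix y assume "y \<in> f ` ?C'"
        then obtain x where x: "x \<in> C" "x \<noteq> c" "x \<noteq> f c" "y = f x" by blast
        have "f x \<noteq> c" "f x \<noteq> f c" using less.prems(3)[OF x(1)] ffc x(2,3) by metis+
        then show "y \<in> ?C'" using x fC[OF x(1)] by simp
      qed
      have D2: "card ?D = 2" using False by auto
      have cc: "card C = Suc (Suc (card ?C'))"
      proof -
        have "card C = card ?D + card ?C'"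
          using card_Un_disjoint[of ?D ?C'] less.prems(1) c fc by (simp add: Un_absorb1 insert_absorb)
        then show ?thesis using D2 by simp
      qed
      have IH: "card (balanced_maps f ?C' L) = fact (card ?C') * 2 ^ (card {c \<in> ?C'. f c \<noteq> c} div 2)"
        if "finite L" "card L = card ?C'" for L :: "'k set"
      proof (rule less(1)[where C = ?C' and K = L])
        show "f ` ?C' \<subseteq> ?C'" by (rule fC')
        show "finite L" "card L = card ?C'" using that by auto
        show "card ?C' < card C" using cc by linarith
        show "finite ?C'" using less.prems(1) by simp
        show "f (f x) = x" if "x \<in> ?C'" for x using less.prems(3) that by simp
      qed
      have fix_eq: "card {x \<in> C. f x \<noteq> x} = Suc (Suc (card {x \<in> ?C'. f x \<noteq> x}))"
      proof -
        have "{x \<in> C. f x \<noteq> x} = ?D \<union> {x \<in> ?C'. f x \<noteq> x}" using c fc ffc False by auto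
        moreover have "card (?D \<union> {x \<in> ?C'. f x \<noteq> x}) = card ?D + card {x \<in> ?C'. f x \<noteq> x}"
          by (rule card_Un_disjoint) (use less.prems(1) in auto)
        ultimately show ?thesis using D2 by simp
      qed
      let ?v = "fact (card ?C') * 2 ^ (card {x \<in> ?C'. f x \<noteq> x} div 2) :: nat"
      have "card (balanced_maps f C K) = (card K choose card ?D) * 4 * ?v"
      proof (rule card_balanced_maps_split[OF less.prems(4,1)])
        fix E assume E: "E \<subseteq> K" "card E = card ?D"
        then obtain k k' where k: "E = {k, k'}" "k \<noteq> k'" using D2 by (metis card_2_iff)
        have "balanced_maps f ?D E = E \<rightarrow>\<^sub>E ?D"
        proof
          show "E \<rightarrow>\<^sub>E ?D \<subseteq> balanced_maps f ?D E"
          proof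
            fix \<tau> assume \<tau>: "\<tau> \<in> E \<rightarrow>\<^sub>E ?D"
            let ?\<delta> = "\<lambda>x. x = k' \<and> \<tau> k' = \<tau> k"
            have v: "\<tau> k = c \<or> \<tau> k = f c" "\<tau> k' = c \<or> \<tau> k' = f c" using \<tau> k by auto
            define g where "g x = (if ?\<delta> x then f (\<tau> x) else \<tau> x)" for x
            have gk: "g k = \<tau> k" using k(2) by (simp add: g_def)
            have gk': "g k' = f (\<tau> k)" using v ffc unfolding g_def by metis
            have ne: "f (\<tau> k) \<noteq> \<tau> k" and D: "{\<tau> k, f (\<tau> k)} = ?D"
              using v(1) ffc False by (metis, metis insert_commute)
            have "inj_on g {k, k'}" using ne gk gk' by (auto simp: inj_on_def)
            moreover have "g ` {k, k'} = ?D" using D gk gk' by simp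
            ultimately have "bij_betw g E ?D" unfolding k(1) bij_betw_def by (rule conjI)
            then have "bij_betw (\<lambda>x. if ?\<delta> x then f (\<tau> x) else \<tau> x) E ?D" unfolding g_def .
            then have "\<exists>\<delta>. bij_betw (\<lambda>x. if \<delta> x then f (\<tau> x) else \<tau> x) E ?D" by (rule exI[of _ ?\<delta>])
            then show "\<tau> \<in> balanced_maps f ?D E" using \<tau> unfolding balanced_maps_def by (intro CollectI conjI)
          qed
        qed (auto simp: balanced_maps_def)
        moreover have "card (E \<rightarrow>\<^sub>E ?D) = 4" using k E D2 by (simp add: card_PiE)
        ultimately show "card (balanced_maps f ?D E) = 4" by simp
        have "card (K - E) = card ?C'" using E D2 less.prems(4,5) cc by (simp add: card_Diff_subset finite_subset)
        then show "card (balanced_maps f ?C' (K - E)) = ?v" using IH[of "K - E"] less.prems(4) by simp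
      qed (use c fc ffc fC' in auto)
      moreover have "(card K choose 2) * 2 * fact (card ?C') = fact (card C)"
      proof -
        have q: "card K = card C" "card K - 2 = card ?C'" "2 \<le> card K" using less.prems(5) cc by linarith+
        have "fact 2 * fact (card K - 2) * (card K choose 2) = fact (card K)"
          by (rule binomial_fact_lemma[OF q(3)])
        then have "(card K choose 2) * 2 * fact (card K - 2) = fact (card K)"
          by (simp only: fact_2 mult.commute mult.left_commute)
        then show ?thesis unfolding q(2) unfolding q(1) .
      qed
      moreover have "(2::nat) ^ (card {x \<in> C. f x \<noteq> x} div 2) = 2 * 2 ^ (card {x \<in> ?C'. f x \<noteq> x} div 2)"
        unfolding fix_eq by (simp only: div2_Suc_Suc power_Suc)
      moreover have "x = a * p" if "x = b * 4 * (y * z)" "b * 2 * y = a" "p = 2 * z" for x a p b y z :: nat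
        using that by simp
      ultimately show ?thesis unfolding D2 by metis
    qed
  qed
qed

lemma card_balanced:
  assumes "finite K" "card K = N"
  shows "card {\<tau> \<in> K \<rightarrow>\<^sub>E {..<N}. balanced N K \<tau>} = fact N * 2 ^ (N div 2)"
proof -
  let ?f = "\<lambda>c. N - 1 - c :: nat"
  have "{\<tau> \<in> K \<rightarrow>\<^sub>E {..<N}. balanced N K \<tau>} = balanced_maps ?f {..<N} K"
    unfolding balanced_maps_def balanced_def ..
  moreover have "card (balanced_maps ?f {..<N} K) = fact (card {..<N}) * 2 ^ (card {c \<in> {..<N}. ?f c \<noteq> c} div 2)"
    by (rule card_balanced_maps) (use assms in auto)
  moreover have "card {c \<in> {..<N}. ?f c \<noteq> c} div 2 = N div 2"
  proof (cases "even N")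
    case True
    have "?f c \<noteq> c" if "c < N" for c using True that by presburger
    then have "{c \<in> {..<N}. ?f c \<noteq> c} = {..<N}" by blast
    then show ?thesis by (simp only: card_lessThan)
  next
    case False
    then obtain q where q: "N = 2 * q + 1" by (auto elim: oddE)
    have "?f c \<noteq> c \<longleftrightarrow> c \<noteq> q" if "c < N" for c using q that by linarith
    then have "{c \<in> {..<N}. ?f c \<noteq> c} = {c \<in> {..<N}. c \<noteq> q}"
      by (intro Collect_cong) (metis lessThan_iff)
    also have "\<dots> = {..<N} - {q}" by blast
    finally show ?thesis using q by simp
  qed
  ultimately show ?thesis by (simp only: card_lessThan)
qed

lemma card_rest: "K \<subseteq> {..<m} \<Longrightarrow> card ({..<m} - K) = m - card (K :: nat set)"
  by (simp add: card_Diff_subset finite_subset)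

lemma steps_subset: "steps m t \<subseteq> {..<m}"
  by (auto simp: steps_def)

lemma fst_label_less: "x \<in> labels n \<Longrightarrow> fst x < n"
  by (auto simp: labels_def)

lemma constant_off_steps:
  assumes "t \<in> {..<m} \<rightarrow>\<^sub>E labels n" "k < m" "k \<notin> steps m t"
  shows "t k = (fst (t k), fst (t k))"
proof -
  have "t k \<in> labels n" using assms(1,2) by (auto simp: PiE_mem)
  moreover have "\<not> fst (t k) < snd (t k)" using assms(2,3) by (simp add: steps_def)
  ultimately show ?thesis by (cases "t k") (simp add: labels_def)
qed

lemma restrict_fst_PiE:
  assumes "t \<in> {..<m} \<rightarrow>\<^sub>E labels n"
  shows "restrict (fst \<circ> t) ({..<m} - K) \<in> ({..<m} - K) \<rightarrow>\<^sub>E {..<n}"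
proof (rule restrict_PiE_iff[THEN iffD2], rule ballI)
  fix k assume "k \<in> {..<m} - K"
  then have "t k \<in> labels n" by (intro PiE_mem[OF assms]) simp
  then show "(fst \<circ> t) k \<in> {..<n}" by (simp add: fst_label_less)
qed

text \<open>
  A leading tuple is determined by the places of its steps, the superdiagonal positions at these places and the
  diagonal positions at all others.
\<close>

lemma card_leading_le:
  "card (leading (Suc N) m) \<le> (m choose N) * (fact N * 2 ^ (N div 2)) * Suc N ^ (m - N)"
proof -
  let ?n = "Suc N"
  let ?S = "{K. K \<subseteq> {..<m} \<and> card K = N}"
  let ?B = "\<lambda>K. {\<tau> \<in> K \<rightarrow>\<^sub>E {..<N}. balanced N K \<tau>}"
  let ?R = "\<lambda>K. ({..<m} - K) \<rightarrow>\<^sub>E {..<?n}"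
  let ?T = "SIGMA K : ?S. ?B K \<times> ?R K"
  let ?F = "\<lambda>t. (steps m t, restrict (fst \<circ> t) (steps m t), restrict (fst \<circ> t) ({..<m} - steps m t))"
  have fS: "finite ?S" by simp
  have fB: "finite (?B K \<times> ?R K)" if "K \<in> ?S" for K
  proof -
    have "finite K" by (rule finite_subset[of _ "{..<m}"]) (use that in auto)
    then show ?thesis by (intro finite_cartesian_product) (simp_all add: finite_PiE)
  qed
  have "inj_on ?F (leading ?n m)"
  proof (rule inj_onI)
    fix t u assume t: "t \<in> leading ?n m" and u: "u \<in> leading ?n m" and e: "?F t = ?F u"
    have tE: "t \<in> {..<m} \<rightarrow>\<^sub>E labels ?n" and uE: "u \<in> {..<m} \<rightarrow>\<^sub>E labels ?n"
      using t u by (simp_all add: leading_def)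
    have e': "steps m t = steps m u \<and> restrict (fst \<circ> t) (steps m t) = restrict (fst \<circ> u) (steps m u)
        \<and> restrict (fst \<circ> t) ({..<m} - steps m t) = restrict (fst \<circ> u) ({..<m} - steps m u)"
      using e unfolding prod.inject .
    have eK: "steps m u = steps m t" using e' by (elim conjE) (rule sym)
    show "t = u"
    proof (rule ext)
      fix k
      consider "k \<in> steps m t" | "k < m" "k \<notin> steps m t" | "\<not> k < m" by blast
      then show "t k = u k"
      proof cases
        case 1
        have "restrict (fst \<circ> t) (steps m t) k = restrict (fst \<circ> u) (steps m u) k"
          using e' by (elim conjE) (rule fun_cong)
        then have "fst (t k) = fst (u k)" using 1 eK by simp
        moreover have "snd (t k) = Suc (fst (t k))" "snd (u k) = Suc (fst (u k))"
          using t u 1 eK by (simp_all add: leading_def)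
        ultimately show ?thesis by (simp add: prod_eq_iff)
      next
        case 2
        have "restrict (fst \<circ> t) ({..<m} - steps m t) k = restrict (fst \<circ> u) ({..<m} - steps m u) k"
          using e' by (elim conjE) (rule fun_cong)
        then have "fst (t k) = fst (u k)" using 2 eK by simp
        then show ?thesis using constant_off_steps[OF tE 2] constant_off_steps[OF uE 2(1)] 2(2) eK by simp
      next
        case 3
        then show ?thesis using PiE_arb[OF tE, of k] PiE_arb[OF uE, of k] by simp
      qed
    qed
  qed
  moreover have "?F ` leading ?n m \<subseteq> ?T"
  proof
    fix y assume "y \<in> ?F ` leading ?n m"
    then obtain t where t: "t \<in> leading ?n m" and y: "y = ?F t" by blast
    have tE: "t \<in> {..<m} \<rightarrow>\<^sub>E labels ?n" using t by (simp add: leading_def)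
    let ?K = "steps m t"
    have lab: "t k \<in> labels ?n" if "k < m" for k by (rule PiE_mem[OF tE]) (use that in simp)
    have "?K \<in> ?S" using t steps_subset by (simp add: leading_def)
    moreover have "restrict (fst \<circ> t) ?K \<in> ?K \<rightarrow>\<^sub>E {..<N}"
    proof (rule restrict_PiE_iff[THEN iffD2], rule ballI)
      fix k assume k: "k \<in> ?K"
      then have "snd (t k) = Suc (fst (t k))" using t by (simp add: leading_def)
      moreover have "k < m" using k by (simp add: steps_def)
      then have "snd (t k) < ?n" using lab by (auto simp: labels_def case_prod_beta)
      ultimately show "(fst \<circ> t) k \<in> {..<N}" by simp
    qed
    moreover have "balanced N ?K (restrict (fst \<circ> t) ?K)"
    proof -
      have "balanced N ?K (fst \<circ> t)" using t by (simp add: leading_def)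
      then obtain \<delta> where "bij_betw (\<lambda>k. if \<delta> k then N - 1 - (fst \<circ> t) k else (fst \<circ> t) k) ?K {..<N}"
        unfolding balanced_def by (rule exE)
      then have "bij_betw (\<lambda>k. if \<delta> k then N - 1 - restrict (fst \<circ> t) ?K k else restrict (fst \<circ> t) ?K k) ?K {..<N}"
        by (rule iffD1[OF bij_betw_cong, rotated]) simp
      then show ?thesis unfolding balanced_def by blast
    qed
    moreover have "restrict (fst \<circ> t) ({..<m} - ?K) \<in> ?R ?K"
      by (rule restrict_fst_PiE[OF tE])
    ultimately show "y \<in> ?T" unfolding y by blast
  qed
  moreover have "finite ?T" by (rule finite_SigmaI[OF fS fB])
  ultimately have "card (leading ?n m) \<le> card ?T" by (rule card_inj_on_le)
  also have "card ?T = (\<Sum>K\<in>?S. card (?B K \<times> ?R K))"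
    by (rule card_SigmaI[OF fS]) (use fB in blast)
  also have "\<dots> = (\<Sum>K\<in>?S. fact N * 2 ^ (N div 2) * ?n ^ (m - N))"
  proof (rule sum.cong[OF refl])
    fix K assume K: "K \<in> ?S"
    then have K': "K \<subseteq> {..<m}" "card K = N" by simp_all
    have fK: "finite K" by (rule finite_subset[OF K'(1)]) simp
    have "card (?B K) = fact N * 2 ^ (N div 2)" by (rule card_balanced[OF fK K'(2)])
    moreover have "card (?R K) = ?n ^ (m - N)" using card_rest[OF K'(1)] K'(2) by (simp add: card_PiE)
    ultimately show "card (?B K \<times> ?R K) = fact N * 2 ^ (N div 2) * ?n ^ (m - N)"
      by (simp only: card_cartesian_product)
  qed
  also have "\<dots> = (m choose N) * (fact N * 2 ^ (N div 2)) * ?n ^ (m - N)"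
    using n_subsets[of "{..<m}" N] by (simp add: mult.assoc)
  finally show ?thesis .
qed

lemma card_labels_le: "card (labels n) \<le> n * n"
proof -
  have "labels n \<subseteq> {..<n} \<times> {..<n}" by (auto simp: labels_def)
  then have "card (labels n) \<le> card ({..<n} \<times> {..<n})" by (intro card_mono) auto
  then show ?thesis by simp
qed

lemma card_small_subsets_le:
  assumes "0 < m"
  shows "m * card {K. K \<subseteq> {..<m} \<and> card K < N} \<le> N * m ^ N"
proof -
  have "{K. K \<subseteq> {..<m} \<and> card K < N} = (\<Union>s\<in>{..<N}. {K. K \<subseteq> {..<m} \<and> card K = s})" by auto
  then have "card {K. K \<subseteq> {..<m} \<and> card K < N} \<le> (\<Sum>s\<in>{..<N}. card {K. K \<subseteq> {..<m} \<and> card K = s})"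
    using card_UN_le[of "{..<N}" "\<lambda>s. {K. K \<subseteq> {..<m} \<and> card K = s}"] by simp
  also have "\<dots> = (\<Sum>s\<in>{..<N}. m choose s)" using n_subsets[of "{..<m}"] by simp
  finally have "m * card {K. K \<subseteq> {..<m} \<and> card K < N} \<le> m * (\<Sum>s\<in>{..<N}. m choose s)" by simp
  also have "\<dots> = (\<Sum>s\<in>{..<N}. m * (m choose s))" by (rule sum_distrib_left)
  also have "\<dots> \<le> (\<Sum>s\<in>{..<N}. m ^ N)"
  proof (rule sum_mono)
    fix s assume s: "s \<in> {..<N}"
    have "(m choose s) * 1 \<le> (m choose s) * fact s" by (rule mult_le_mono2) (simp add: fact_ge_1)
    also have "\<dots> \<le> m ^ s" by (rule binomial_fact_pow)
    finally have "m * (m choose s) \<le> m ^ Suc s" by simp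
    also have "\<dots> \<le> m ^ N" by (rule power_increasing) (use s assms in simp_all)
    finally show "m * (m choose s) \<le> m ^ N" .
  qed
  finally show ?thesis by simp
qed

text \<open>
  Fewer than \<open>N\<close> steps can be placed in at most \<open>N * m ^ N / m\<close> ways, and each label of a step is one of at
  most \<open>n * n\<close> with \<open>n = Suc N\<close>.
\<close>

lemma card_deficient_le:
  assumes m: "0 < m"
  shows "m * card (deficient (Suc N) m) \<le> (Suc N * Suc N) ^ N * N * m ^ N * Suc N ^ m"
proof -
  let ?n = "Suc N"
  let ?S = "{K. K \<subseteq> {..<m} \<and> card K < N}"
  let ?R = "\<lambda>K. ({..<m} - K) \<rightarrow>\<^sub>E {..<?n}"
  let ?T = "SIGMA K : ?S. (K \<rightarrow>\<^sub>E labels ?n) \<times> ?R K"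
  let ?F = "\<lambda>t. (steps m t, restrict t (steps m t), restrict (fst \<circ> t) ({..<m} - steps m t))"
  have fS: "finite ?S" by simp
  have fB: "finite ((K \<rightarrow>\<^sub>E labels ?n) \<times> ?R K)" if "K \<in> ?S" for K
  proof -
    have "finite K" by (rule finite_subset[of _ "{..<m}"]) (use that in auto)
    then show ?thesis by (intro finite_cartesian_product) (simp_all add: finite_PiE)
  qed
  have "inj_on ?F (deficient ?n m)"
  proof (rule inj_onI)
    fix t u assume t: "t \<in> deficient ?n m" and u: "u \<in> deficient ?n m" and e: "?F t = ?F u"
    have tE: "t \<in> {..<m} \<rightarrow>\<^sub>E labels ?n" and uE: "u \<in> {..<m} \<rightarrow>\<^sub>E labels ?n"
      using t u by (simp_all add: deficient_def)
    have e': "steps m t = steps m u \<and> restrict t (steps m t) = restrict u (steps m u)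
        \<and> restrict (fst \<circ> t) ({..<m} - steps m t) = restrict (fst \<circ> u) ({..<m} - steps m u)"
      using e unfolding prod.inject .
    have eK: "steps m u = steps m t" using e' by (elim conjE) (rule sym)
    show "t = u"
    proof (rule ext)
      fix k
      consider "k \<in> steps m t" | "k < m" "k \<notin> steps m t" | "\<not> k < m" by blast
      then show "t k = u k"
      proof cases
        case 1
        have "restrict t (steps m t) k = restrict u (steps m u) k"
          using e' by (elim conjE) (rule fun_cong)
        then show ?thesis using 1 eK by simp
      next
        case 2
        have "restrict (fst \<circ> t) ({..<m} - steps m t) k = restrict (fst \<circ> u) ({..<m} - steps m u) k"
          using e' by (elim conjE) (rule fun_cong)
        then have "fst (t k) = fst (u k)" using 2 eK by simp
        then show ?thesis using constant_off_steps[OF tE 2] constant_off_steps[OF uE 2(1)] 2(2) eK by simp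
      next
        case 3
        then show ?thesis using PiE_arb[OF tE, of k] PiE_arb[OF uE, of k] by simp
      qed
    qed
  qed
  moreover have "?F ` deficient ?n m \<subseteq> ?T"
  proof
    fix y assume "y \<in> ?F ` deficient ?n m"
    then obtain t where t: "t \<in> deficient ?n m" and y: "y = ?F t" by blast
    have tE: "t \<in> {..<m} \<rightarrow>\<^sub>E labels ?n" using t by (simp add: deficient_def)
    have lab: "t k \<in> labels ?n" if "k < m" for k by (rule PiE_mem[OF tE]) (use that in simp)
    have "steps m t \<in> ?S" using t steps_subset by (simp add: deficient_def)
    moreover have "restrict t (steps m t) \<in> steps m t \<rightarrow>\<^sub>E labels ?n"
      by (rule restrict_PiE_iff[THEN iffD2], rule ballI, rule lab) (simp add: steps_def)
    moreover have "restrict (fst \<circ> t) ({..<m} - steps m t) \<in> ?R (steps m t)"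
      by (rule restrict_fst_PiE[OF tE])
    ultimately show "y \<in> ?T" unfolding y by blast
  qed
  moreover have "finite ?T" by (rule finite_SigmaI[OF fS fB])
  ultimately have "card (deficient ?n m) \<le> card ?T" by (rule card_inj_on_le)
  also have "card ?T = (\<Sum>K\<in>?S. card ((K \<rightarrow>\<^sub>E labels ?n) \<times> ?R K))"
    by (rule card_SigmaI[OF fS]) (use fB in blast)
  also have "\<dots> \<le> (\<Sum>K\<in>?S. (?n * ?n) ^ N * ?n ^ m)"
  proof (rule sum_mono)
    fix K assume K: "K \<in> ?S"
    then have K': "K \<subseteq> {..<m}" "card K < N" by simp_all
    have fK: "finite K" by (rule finite_subset[OF K'(1)]) simp
    have "card (K \<rightarrow>\<^sub>E labels ?n) = card (labels ?n) ^ card K" using fK by (simp add: card_PiE)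
    also have "\<dots> \<le> (?n * ?n) ^ card K" by (rule power_mono[OF card_labels_le]) simp
    also have "\<dots> \<le> (?n * ?n) ^ N" by (rule power_increasing) (use K'(2) in simp_all)
    finally have "card (K \<rightarrow>\<^sub>E labels ?n) \<le> (?n * ?n) ^ N" .
    moreover have "card (?R K) \<le> ?n ^ m"
    proof -
      have "card (?R K) = ?n ^ (m - card K)" using card_rest[OF K'(1)] by (simp add: card_PiE)
      also have "\<dots> \<le> ?n ^ m" by (rule power_increasing) auto
      finally show ?thesis .
    qed
    ultimately show "card ((K \<rightarrow>\<^sub>E labels ?n) \<times> ?R K) \<le> (?n * ?n) ^ N * ?n ^ m"
      unfolding card_cartesian_product by (rule mult_le_mono)
  qed
  also have "\<dots> = card ?S * ((?n * ?n) ^ N * ?n ^ m)" by simp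
  finally have "m * card (deficient ?n m) \<le> (m * card ?S) * ((?n * ?n) ^ N * ?n ^ m)"
    by (simp only: mult.assoc mult_le_mono2)
  also have "\<dots> \<le> (N * m ^ N) * ((?n * ?n) ^ N * ?n ^ m)"
    by (rule mult_le_mono1[OF card_small_subsets_le[OF m]])
  finally show ?thesis by (simp only: mult_ac)
qed

definition covering :: "nat \<Rightarrow> nat \<Rightarrow> nat \<Rightarrow> nat set \<Rightarrow> (nat \<Rightarrow> nat) set" where
  "covering N m r K = {\<rho> \<in> ({..<m} - K) \<rightarrow>\<^sub>E {..<Suc N}. \<forall>l<N. \<exists>i<r. \<rho> i = Suc l}"

text \<open>
  Union bound over the value \<open>Suc l\<close> that is missed on the first \<open>r\<close> places.
\<close>

lemma card_covering_ge:
  assumes K: "K \<subseteq> {r..<m}" "card K = N" and m: "r + N \<le> m"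
  shows "Suc N ^ (m - N) \<le> card (covering N m r K) + N * (N ^ r * Suc N ^ (m - N - r))"
proof -
  let ?A = "({..<m} - K) \<rightarrow>\<^sub>E {..<Suc N}"
  let ?M = "\<lambda>l. PiE ({..<m} - K) (\<lambda>i. if i < r then {..<Suc N} - {Suc l} else {..<Suc N})"
  have Km: "K \<subseteq> {..<m}" using K(1) by auto
  have fin: "finite ?A" by (simp add: finite_PiE)
  have sub: "?A \<subseteq> covering N m r K \<union> (\<Union>l\<in>{..<N}. ?M l)"
  proof
    fix \<rho> assume \<rho>: "\<rho> \<in> ?A"
    show "\<rho> \<in> covering N m r K \<union> (\<Union>l\<in>{..<N}. ?M l)"
    proof (cases "\<rho> \<in> covering N m r K")
      case False
      then obtain l where l: "l < N" "\<forall>i<r. \<rho> i \<noteq> Suc l" using \<rho> unfolding covering_def by blast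
      have "\<rho> \<in> ?M l"
      proof (rule PiE_I)
        fix i assume "i \<in> {..<m} - K"
        then have "\<rho> i \<in> {..<Suc N}" using \<rho> by (rule PiE_mem[rotated])
        then show "\<rho> i \<in> (if i < r then {..<Suc N} - {Suc l} else {..<Suc N})" using l(2) by simp
      next
        fix i assume "i \<notin> {..<m} - K"
        then show "\<rho> i = undefined" using \<rho> by (rule PiE_arb[rotated])
      qed
      then show ?thesis using l(1) by blast
    qed simp
  qed
  have M: "card (?M l) = N ^ r * Suc N ^ (m - N - r)" if l: "l < N" for l
  proof -
    have "card (?M l) = (\<Prod>i\<in>{..<m} - K. card (if i < r then {..<Suc N} - {Suc l} else {..<Suc N}))"
      by (rule card_PiE) simp
    also have "\<dots> = (\<Prod>i\<in>{..<m} - K. if i < r then N else Suc N)"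
      using l by (intro prod.cong refl) (simp add: card_Diff_singleton)
    also have "\<dots> = (\<Prod>i\<in>{..<r} \<union> ({r..<m} - K). if i < r then N else Suc N)"
      using K(1) m by (intro prod.cong refl) auto
    also have "\<dots> = (\<Prod>i\<in>{..<r}. if i < r then N else Suc N) * (\<Prod>i\<in>{r..<m} - K. if i < r then N else Suc N)"
      by (rule prod.union_disjoint) auto
    also have "(\<Prod>i\<in>{..<r}. if i < r then N else Suc N) = N ^ r" by simp
    also have "(\<Prod>i\<in>{r..<m} - K. if i < r then N else Suc N) = (\<Prod>i\<in>{r..<m} - K. Suc N)"
      by (rule prod.cong) auto
    also have "\<dots> = Suc N ^ card ({r..<m} - K)" by (rule prod_constant)
    also have "card ({r..<m} - K) = m - N - r"
      using K by (simp add: card_Diff_subset finite_subset)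
    finally show ?thesis .
  qed
  have "Suc N ^ (m - N) = card ?A" using K(2) Km by (simp add: card_PiE card_rest)
  also have "\<dots> \<le> card (covering N m r K \<union> (\<Union>l\<in>{..<N}. ?M l))"
  proof (rule card_mono[OF _ sub])
    have "finite (covering N m r K)" by (rule finite_subset[OF _ fin]) (auto simp: covering_def)
    then show "finite (covering N m r K \<union> (\<Union>l\<in>{..<N}. ?M l))" by (auto intro!: finite_PiE)
  qed
  also have "\<dots> \<le> card (covering N m r K) + card (\<Union>l\<in>{..<N}. ?M l)" by (rule card_Un_le)
  also have "card (\<Union>l\<in>{..<N}. ?M l) \<le> (\<Sum>l\<in>{..<N}. card (?M l))" by (rule card_UN_le) simp
  also have "(\<Sum>l\<in>{..<N}. card (?M l)) = N * (N ^ r * Suc N ^ (m - N - r))" using M by simp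
  finally show ?thesis by simp
qed

text \<open>
  Conversely to \<open>card_leading_le\<close>, the places \<open>K\<close> of the steps behind \<open>r\<close>, a balanced map on \<open>K\<close> and
  a covering map on the rest combine to a separable tuple.
\<close>

lemma card_separable_ge:
  assumes m: "r + N \<le> m"
  shows "(m - r choose N) * (fact N * 2 ^ (N div 2)) * Suc N ^ (m - N)
    \<le> card (separable (Suc N) m r) + (m - r choose N) * (fact N * 2 ^ (N div 2)) * (N * (N ^ r * Suc N ^ (m - N - r)))"
proof -
  let ?n = "Suc N"
  let ?S = "{K. K \<subseteq> {r..<m} \<and> card K = N}"
  let ?B = "\<lambda>K. {\<tau> \<in> K \<rightarrow>\<^sub>E {..<N}. balanced N K \<tau>}"
  let ?T = "SIGMA K : ?S. ?B K \<times> covering N m r K"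
  let ?H = "\<lambda>(K, \<tau>, \<rho>). \<lambda>k\<in>{..<m}. if k \<in> K then (\<tau> k, Suc (\<tau> k)) else (\<rho> k, \<rho> k)"
  let ?Q = "fact N * 2 ^ (N div 2) :: nat" and ?e = "N * (N ^ r * Suc N ^ (m - N - r))"
  have steps: "steps m (?H (K, \<tau>, \<rho>)) = K" if "K \<in> ?S" for K \<tau> \<rho>
    using that by (auto simp: steps_def split: if_splits)
  have fS: "finite ?S" by simp
  have fC: "finite (covering N m r K)" for K
    by (rule finite_subset[of _ "({..<m} - K) \<rightarrow>\<^sub>E {..<Suc N}"]) (auto simp: covering_def intro: finite_PiE)
  have fB: "finite (?B K \<times> covering N m r K)" if "K \<in> ?S" for K
  proof -
    have "finite K" by (rule finite_subset[of _ "{..<m}"]) (use that in auto)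
    then show ?thesis using fC by (intro finite_cartesian_product) (simp_all add: finite_PiE)
  qed
  have inj: "inj_on ?H ?T"
  proof (rule inj_onI)
    fix x y assume x: "x \<in> ?T" and y: "y \<in> ?T" and e: "?H x = ?H y"
    obtain K \<tau> \<rho> where xx: "x = (K, \<tau>, \<rho>)" using prod_cases3 by blast
    obtain K' \<tau>' \<rho>' where yy: "y = (K', \<tau>', \<rho>')" using prod_cases3 by blast
    have K: "K \<in> ?S" and \<tau>: "\<tau> \<in> K \<rightarrow>\<^sub>E {..<N}" and \<rho>: "\<rho> \<in> ({..<m} - K) \<rightarrow>\<^sub>E {..<Suc N}"
      using x unfolding xx covering_def by auto
    have K': "K' \<in> ?S" and \<tau>': "\<tau>' \<in> K' \<rightarrow>\<^sub>E {..<N}" and \<rho>': "\<rho>' \<in> ({..<m} - K') \<rightarrow>\<^sub>E {..<Suc N}"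
      using y unfolding yy covering_def by auto
    have KK: "K' = K" using steps[OF K, of \<tau> \<rho>] steps[OF K', of \<tau>' \<rho>'] e unfolding xx yy by simp
    have v: "(if k \<in> K then (\<tau> k, Suc (\<tau> k)) else (\<rho> k, \<rho> k)) = (if k \<in> K then (\<tau>' k, Suc (\<tau>' k)) else (\<rho>' k, \<rho>' k))"
      if "k < m" for k
      using fun_cong[OF e, of k] that unfolding xx yy KK by (simp only: case_prod_conv restrict_apply lessThan_iff if_True)
    have "\<tau> = \<tau>'"
    proof (rule PiE_ext[OF \<tau> \<tau>'[unfolded KK]])
      fix k assume k: "k \<in> K"
      then have "k < m" using K by auto
      then show "\<tau> k = \<tau>' k" using v[of k] k by simp
    qed
    moreover have "\<rho> = \<rho>'"
    proof (rule PiE_ext[OF \<rho> \<rho>'[unfolded KK]])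
      fix k assume "k \<in> {..<m} - K"
      then show "\<rho> k = \<rho>' k" using v[of k] by simp
    qed
    ultimately show "x = y" unfolding xx yy KK by simp
  qed
  have img: "?H ` ?T \<subseteq> separable ?n m r"
  proof
    fix t assume "t \<in> ?H ` ?T"
    then obtain K \<tau> \<rho> where K: "K \<in> ?S" and \<tau>: "\<tau> \<in> K \<rightarrow>\<^sub>E {..<N}" "balanced N K \<tau>"
      and \<rho>: "\<rho> \<in> covering N m r K" and t: "t = ?H (K, \<tau>, \<rho>)" by blast
    have \<rho>E: "\<rho> \<in> ({..<m} - K) \<rightarrow>\<^sub>E {..<Suc N}" using \<rho> by (simp add: covering_def)
    have st: "steps m t = K" unfolding t by (rule steps[OF K])
    have tK: "t k = (\<tau> k, Suc (\<tau> k))" if "k \<in> K" for k using that K unfolding t by auto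
    have tR: "t k = (\<rho> k, \<rho> k)" if "k < m" "k \<notin> K" for k using that unfolding t by simp
    have lab: "t \<in> {..<m} \<rightarrow>\<^sub>E labels ?n"
    proof (rule PiE_I)
      fix k assume k: "k \<in> {..<m}"
      show "t k \<in> labels ?n"
      proof (cases "k \<in> K")
        case True
        then have "\<tau> k \<in> {..<N}" by (rule PiE_mem[OF \<tau>(1)])
        then show ?thesis using tK[OF True] by (simp add: labels_def)
      next
        case False
        then have "\<rho> k \<in> {..<Suc N}" using k by (intro PiE_mem[OF \<rho>E]) simp
        then show ?thesis using tR[of k] k False by (simp add: labels_def)
      qed
    qed (simp add: t)
    obtain \<delta> where "bij_betw (\<lambda>k. if \<delta> k then N - 1 - \<tau> k else \<tau> k) K {..<N}"
      using \<tau>(2) unfolding balanced_def by blast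
    then have "bij_betw (\<lambda>k. if \<delta> k then N - 1 - (fst \<circ> t) k else (fst \<circ> t) k) K {..<N}"
      by (rule iffD1[OF bij_betw_cong, rotated]) (simp add: tK)
    then have bal: "balanced N K (fst \<circ> t)" unfolding balanced_def by blast
    have lead: "t \<in> leading ?n m"
      unfolding leading_def using lab bal K tK st by simp
    have "\<exists>i. i < r \<and> i < m \<and> t i = (Suc l, Suc l)" if l: "l < N" for l
    proof -
      obtain i where i: "i < r" "\<rho> i = Suc l" using \<rho> l unfolding covering_def by blast
      have im: "i < m" using i(1) m by linarith
      have "i \<notin> K" using i(1) K by auto
      then have "t i = (Suc l, Suc l)" using tR[OF im] i(2) by simp
      then show ?thesis using i(1) im by (intro exI[of _ i] conjI)
    qed
    then show "t \<in> separable ?n m r" unfolding separable_def using lead K st by simp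
  qed
  have fG: "finite (separable ?n m r)"
    by (rule finite_subset[of _ "{..<m} \<rightarrow>\<^sub>E labels ?n"]) (auto simp: separable_def leading_def intro: finite_PiE)
  have "(m - r choose N) * ?Q * ?n ^ (m - N) = (\<Sum>K\<in>?S. ?Q * ?n ^ (m - N))"
    using n_subsets[of "{r..<m}" N] by (simp add: mult.assoc)
  also have "\<dots> \<le> (\<Sum>K\<in>?S. card (?B K \<times> covering N m r K) + ?Q * ?e)"
  proof (rule sum_mono)
    fix K assume K: "K \<in> ?S"
    then have K': "K \<subseteq> {r..<m}" "card K = N" by simp_all
    have fK: "finite K" by (rule finite_subset[OF K'(1)]) simp
    have B: "card (?B K) = ?Q" by (rule card_balanced[OF fK K'(2)])
    have "?Q * ?n ^ (m - N) \<le> ?Q * (card (covering N m r K) + ?e)"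
      by (rule mult_le_mono2[OF card_covering_ge[OF K' m]])
    then show "?Q * ?n ^ (m - N) \<le> card (?B K \<times> covering N m r K) + ?Q * ?e"
      unfolding card_cartesian_product B by (simp only: distrib_left)
  qed
  also have "\<dots> = (\<Sum>K\<in>?S. card (?B K \<times> covering N m r K)) + card ?S * (?Q * ?e)"
    by (simp add: sum.distrib)
  also have "card ?S = (m - r choose N)" using n_subsets[of "{r..<m}" N] by simp
  also have "(\<Sum>K\<in>?S. card (?B K \<times> covering N m r K)) = card ?T"
    by (rule card_SigmaI[OF fS, symmetric]) (use fB in blast)
  also have "card ?T \<le> card (separable ?n m r)"
    by (rule card_inj_on_le[OF inj img fG])
  finally show ?thesis by (simp only: mult.assoc add_le_mono1)
qed

section \<open>Asymptotics\<close>

text \<open>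
  A lower bound by a factor with limit \<open>w r\<close> for each fixed \<open>r\<close> suffices: letting the argument grow
  first and \<open>r\<close> afterwards gives the limit 1.
\<close>

lemma asymp_equiv_by_bounds:
  fixes c g :: "nat \<Rightarrow> real"
  assumes pos: "eventually (\<lambda>m. 0 < g m) at_top"
    and upper: "eventually (\<lambda>m. c m \<le> b m * g m) at_top" "b \<longlonglongrightarrow> 1"
    and lower: "\<And>r. eventually (\<lambda>m. u r m * g m \<le> c m) at_top" "\<And>r. u r \<longlonglongrightarrow> w r" "w \<longlonglongrightarrow> 1"
  shows "c \<sim>[at_top] g"
proof (rule asymp_equivI', rule order_tendstoI)
  fix a :: real assume "a < 1"
  then have "eventually (\<lambda>r. a < w r) sequentially" by (rule order_tendstoD(1)[OF lower(3)])
  then obtain r where "a < w r" by (auto simp: eventually_sequentially)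
  then have "eventually (\<lambda>m. a < u r m) at_top" by (rule order_tendstoD(1)[OF lower(2)])
  then show "eventually (\<lambda>m. a < c m / g m) at_top"
    using lower(1)[of r] pos
  proof eventually_elim
    case (elim m)
    then have "u r m \<le> c m / g m" by (simp add: pos_le_divide_eq)
    then show ?case using elim(1) by linarith
  qed
next
  fix a :: real assume "1 < a"
  then have "eventually (\<lambda>m. b m < a) at_top" by (rule order_tendstoD(2)[OF upper(2)])
  then show "eventually (\<lambda>m. c m / g m < a) at_top"
    using upper(1) pos
  proof eventually_elim
    case (elim m)
    then have "c m / g m \<le> b m" by (simp add: pos_divide_le_eq)
    then show ?case using elim(1) by linarith
  qed
qed

lemma binomial_times_fact_prod: "real (M choose N) * fact N = (\<Prod>i<N. real M - real i)"
  using gbinomial_mult_fact[of N "real M"] by (simp add: binomial_gbinomial atLeast0LessThan mult.commute)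

context graded_star_UT
begin

lemma codim_asymp_equiv:
  "(\<lambda>m. real (star_codim G (ut_algebra n) \<Gamma> star m)) \<sim>[at_top]
   (\<lambda>m. 2 ^ ((n - 1) div 2) / real n ^ (n - 1) * real m ^ (n - 1) * real n ^ m)"
proof -
  obtain N where n: "n = Suc N" using n_pos by (cases n) auto
  define B :: real where "B = 2 ^ (N div 2)"
  define \<nu> where "\<nu> = real n"
  define c where "c m = real (star_codim G (ut_algebra n) \<Gamma> star m)" for m
  define g where "g m = B / \<nu> ^ N * real m ^ N * \<nu> ^ m" for m
  define D where "D = (\<nu> * \<nu>) ^ N * real N"
  define b where "b m = 1 + (\<nu> * \<nu> * D * \<nu> ^ N / B) / real m" for m :: nat
  (* w r bounds from below the proportion of the choices of diagonal labels in which each of 1, ..., N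
     occurs on the first r places. *)
  define w where "w r = 1 - real N * (real N / \<nu>) ^ r" for r
  define u where "u r m = (\<Prod>i<N. 1 - (real r + real i) / real m) * w r" for r m :: nat
  have B: "B > 0" and \<nu>: "\<nu> > 0" by (simp_all add: B_def \<nu>_def n)
  have "c \<sim>[at_top] g"
  proof (rule asymp_equiv_by_bounds)
    show "eventually (\<lambda>m. 0 < g m) at_top"
      using eventually_gt_at_top[of 0] by eventually_elim (use B \<nu> in \<open>simp add: g_def\<close>)
  next
    show "eventually (\<lambda>m. c m \<le> b m * g m) at_top"
      using eventually_gt_at_top[of 0] eventually_ge_at_top[of N]
    proof eventually_elim
      case (elim m)
      have pw: "\<nu> ^ (m - N) = \<nu> ^ m / \<nu> ^ N" using \<nu> elim by (simp add: power_diff)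
      have L: "real (card (leading n m)) \<le> g m"
      proof -
        have "real (card (leading n m)) \<le> real ((m choose N) * (fact N * 2 ^ (N div 2)) * Suc N ^ (m - N))"
          using card_leading_le[of N m] unfolding n by (simp only: of_nat_le_iff)
        also have "\<dots> = real ((m choose N) * fact N) * (B * \<nu> ^ (m - N))"
          by (simp add: B_def \<nu>_def n)
        also have "\<dots> \<le> real (m ^ N) * (B * \<nu> ^ (m - N))"
          using B \<nu> binomial_fact_pow[of m N] by (intro mult_right_mono of_nat_mono) simp_all
        also have "\<dots> = g m" by (simp add: g_def pw)
        finally show ?thesis .
      qed
      have E: "real m * real (card (deficient n m)) \<le> D * real m ^ N * \<nu> ^ m"
      proof -
        have "real (m * card (deficient n m)) \<le> real ((Suc N * Suc N) ^ N * N * m ^ N * Suc N ^ m)"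
          using card_deficient_le[OF elim(1), of N] unfolding n by (simp only: of_nat_le_iff)
        also have "\<dots> = D * real m ^ N * \<nu> ^ m"
          unfolding D_def \<nu>_def n by (simp only: of_nat_mult of_nat_power)
        finally show ?thesis by simp
      qed
      have "c m \<le> real (card (leading n m) + n * n * card (deficient n m))"
        unfolding c_def by (rule of_nat_mono[OF star_codim_bounds_leading(1)])
      also have "\<dots> = real (card (leading n m)) + \<nu> * \<nu> * real (card (deficient n m))"
        by (simp add: \<nu>_def)
      also have "\<dots> \<le> g m + \<nu> * \<nu> * (D * real m ^ N * \<nu> ^ m / real m)"
      proof (intro add_mono L mult_left_mono)
        show "real (card (deficient n m)) \<le> D * real m ^ N * \<nu> ^ m / real m"
          using E elim(1) by (simp add: pos_le_divide_eq mult.commute)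
      qed (use \<nu> in simp)
      also have "\<dots> = b m * g m"
      proof -
        have "(\<nu> * \<nu> * D * \<nu> ^ N / B) / real m * g m = \<nu> * \<nu> * (D * real m ^ N * \<nu> ^ m / real m)"
          using B \<nu> elim(1) by (simp add: g_def)
        then show ?thesis unfolding b_def by (simp only: distrib_right mult_1)
      qed
      finally show ?case .
    qed
    have "(\<lambda>m. 1 + (\<nu> * \<nu> * D * \<nu> ^ N / B) / real m) \<longlonglongrightarrow> 1 + 0"
      by (intro tendsto_add tendsto_const lim_const_over_n)
    then show "b \<longlonglongrightarrow> 1" unfolding b_def by simp
  next
    fix r :: nat
    show "eventually (\<lambda>m. u r m * g m \<le> c m) at_top"
      using eventually_gt_at_top[of 0] eventually_ge_at_top[of "r + N"]
    proof eventually_elim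
      case (elim m)
      define p where "p = (\<Prod>i<N. real m - real r - real i)"
      have pw: "\<nu> ^ (m - N) = \<nu> ^ m / \<nu> ^ N" "\<nu> ^ (m - N - r) = \<nu> ^ m / \<nu> ^ N / \<nu> ^ r"
        using \<nu> elim by (simp_all add: power_diff power_add)
      have pb: "real (m - r choose N) * fact N = p"
        using elim(2) by (simp add: binomial_times_fact_prod p_def of_nat_diff)
      have "(\<Prod>i<N. 1 - (real r + real i) / real m) = (\<Prod>i<N. (real m - real r - real i) / real m)"
        using elim(1) by (intro prod.cong refl) (simp add: field_simps)
      also have "\<dots> = p / real m ^ N" by (simp add: p_def prod_dividef)
      finally have u: "u r m = p / real m ^ N * w r" by (simp add: u_def)
      have "real ((m - r choose N) * (fact N * 2 ^ (N div 2)) * Suc N ^ (m - N))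
        \<le> real (card (separable n m r) + (m - r choose N) * (fact N * 2 ^ (N div 2)) * (N * (N ^ r * Suc N ^ (m - N - r))))"
        using card_separable_ge[OF elim(2)] unfolding n by (simp only: of_nat_le_iff)
      then have "(real (m - r choose N) * fact N) * B * \<nu> ^ (m - N)
        \<le> real (card (separable n m r)) + (real (m - r choose N) * fact N) * B * (real N * (real N ^ r * \<nu> ^ (m - N - r)))"
        unfolding B_def \<nu>_def n
        by (simp only: of_nat_add of_nat_mult of_nat_power of_nat_fact of_nat_numeral mult.assoc)
      then have "p * B * (\<nu> ^ m / \<nu> ^ N) \<le> real (card (separable n m r)) + p * B * (real N * (real N ^ r * (\<nu> ^ m / \<nu> ^ N / \<nu> ^ r)))"
        unfolding pb pw .
      also have "p * B * (real N * (real N ^ r * (\<nu> ^ m / \<nu> ^ N / \<nu> ^ r)))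
        = p * B * (\<nu> ^ m / \<nu> ^ N) * (real N * (real N / \<nu>) ^ r)"
        by (simp add: power_divide)
      finally have "p * B * (\<nu> ^ m / \<nu> ^ N) * w r \<le> real (card (separable n m r))"
        by (simp add: w_def right_diff_distrib)
      also have "p * B * (\<nu> ^ m / \<nu> ^ N) * w r = u r m * g m"
        using elim(1) by (simp add: u g_def)
      also have "real (card (separable n m r)) \<le> c m"
        unfolding c_def by (rule of_nat_mono[OF card_separable_le_codim])
      finally show ?case .
    qed
    have "u r \<longlonglongrightarrow> (\<Prod>i<N. 1 - 0) * w r"
      unfolding u_def by (intro tendsto_mult tendsto_prod tendsto_diff tendsto_const lim_const_over_n)
    then show "u r \<longlonglongrightarrow> w r" by simp
  next
    have "(\<lambda>r. (real N / \<nu>) ^ r) \<longlonglongrightarrow> 0"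
      by (rule LIMSEQ_realpow_zero) (simp_all add: \<nu>_def n)
    then have "w \<longlonglongrightarrow> 1 - real N * 0"
      unfolding w_def by (intro tendsto_diff tendsto_mult tendsto_const)
    then show "w \<longlonglongrightarrow> 1" by simp
  qed
  moreover have "n - 1 = N" using n by simp
  ultimately show ?thesis unfolding c_def g_def B_def \<nu>_def by simp
qed

end

theorem corollary3p3:
  fixes G :: "('g, 'r) monoid_scheme"
    and n :: nat
    and \<Gamma> :: "'g \<Rightarrow> 'f :: field mat set"
    and star :: "'f mat \<Rightarrow> 'f mat"
  assumes "group G"
    and "infinite (UNIV :: 'f set)"
    and "n \<ge> 1"
    and "grading G class_ring (ut_algebra n) \<Gamma>"
    and "graded_involution G class_ring (ut_algebra n) \<Gamma> star"
  shows "(\<lambda>m. real (star_codim G (ut_algebra n) \<Gamma> star m)) \<sim>[at_top]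
         (\<lambda>m. 2 ^ ((n - 1) div 2) / real n ^ (n - 1) * real m ^ (n - 1) * real n ^ m)"
proof -
  interpret graded_star_UT G n \<Gamma> star
    by (rule graded_star_UT.intro) (rule assms)+
  show ?thesis by (rule codim_asymp_equiv)
qed

end
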